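(* Let $1\le p<\infty$ and let $f$ be a somewhere convergent Dirichlet series with $f(+\infty)\ne0$ and with analytic continuation to $\mathbb C_0$ satisfying $$\sup_{\sigma>0}\sup_{T\ge1}\frac1{2T}\int_{-T}^T|f(\sigma+it)|^p\,\mathrm dt<\infty .$$ Then $$\lim_{T\to\infty}\frac{\pi}{T}\sum_{\substack{s\in\mathscr Z(f)\\|\operatorname{Im}s|<T\\\operatorname{Re}s>\sigma_0}}(\operatorname{Re}s-\sigma_0)=\mathscr J(f,\sigma_0)-\log|f(+\infty)|,$$ where the limit converges uniformly in $\sigma_0$ on $(\kappa,\infty)$ for all $\kappa>0$.
   Context: For real $\kappa$, $\mathbb C_\kappa=\{s\in\mathbb C:\operatorname{Re}s>\kappa\}$. A somewhere convergent Dirichlet series is a series $f(s)=\sum_{n\ge1}a_nn^{-s}$ that converges at some $s\in\mathbb C$ (hence in some half-plane); its analytic continuation to $\mathbb C_0$ is again denoted $f$. $f(+\infty)=a_1$ denotes the constant term. $\mathscr Z(f)$ is the zero set of $f$ (in $\mathbb C_0$), and in sums over it each term is repeated according to the multiplicity of the zero. The Jessen function is $$\mathscr J(f,\sigma)=\lim_{T\to\infty}\frac1{2T}\int_{-T}^T\log|f(\sigma+it)|\,\mathrm dt,$$ which under the stated hypotheses exists and is finite for every $\sigma>0$. *)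

theory Defs
  imports "HOL-Complex_Analysis.Complex_Analysis"
begin

definition half_plane :: "real \<Rightarrow> complex set" where
  "half_plane \<kappa> = {s. Re s > \<kappa>}"

text \<open>A Dirichlet series is given by its coefficients \<open>a 1, a 2, \<dots>\<close>; the value \<open>a 0\<close> is
  never used.  Convergence is that of the partial sums in the natural order.\<close>

definition dirichlet_term :: "(nat \<Rightarrow> complex) \<Rightarrow> complex \<Rightarrow> nat \<Rightarrow> complex" where
  "dirichlet_term a s n = a (Suc n) * of_nat (Suc n) powr (- s)"

definition dirichlet_converges :: "(nat \<Rightarrow> complex) \<Rightarrow> complex \<Rightarrow> bool" where
  "dirichlet_converges a s \<longleftrightarrow> summable (dirichlet_term a s)"

definition dirichlet_sum :: "(nat \<Rightarrow> complex) \<Rightarrow> complex \<Rightarrow> complex" where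
  "dirichlet_sum a s = (\<Sum>n. dirichlet_term a s n)"

definition somewhere_convergent :: "(nat \<Rightarrow> complex) \<Rightarrow> bool" where
  "somewhere_convergent a \<longleftrightarrow> (\<exists>s. dirichlet_converges a s)"

definition conv_abscissa :: "(nat \<Rightarrow> complex) \<Rightarrow> ereal" where
  "conv_abscissa a = (INF s \<in> {s. dirichlet_converges a s}. ereal (Re s))"

text \<open>The function \<open>f\<close> is the analytic continuation of the series to the right half-plane.  Its values
  outside that half-plane are irrelevant throughout.\<close>

definition continues_dirichlet :: "(nat \<Rightarrow> complex) \<Rightarrow> (complex \<Rightarrow> complex) \<Rightarrow> bool" where
  "continues_dirichlet a f \<longleftrightarrow> f holomorphic_on half_plane 0 \<and>
     (\<forall>s \<in> half_plane 0. ereal (Re s) > conv_abscissa a \<longrightarrow> f s = dirichlet_sum a s)"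

text \<open>The constant term of the series, i.e. the value \<open>f(+\<infinity>)\<close>.\<close>

definition value_at_infinity :: "(nat \<Rightarrow> complex) \<Rightarrow> complex" where
  "value_at_infinity a = a 1"

definition mean_pow :: "real \<Rightarrow> (complex \<Rightarrow> complex) \<Rightarrow> real \<Rightarrow> real \<Rightarrow> real" where
  "mean_pow p f \<sigma> T = 1 / (2 * T) * (LBINT t:{-T..T}. norm (f (Complex \<sigma> t)) powr p)"

text \<open>Here \<open>ln 0 = 0\<close> instead of \<open>-\<infinity>\<close>; this does not affect the integral when \<open>f\<close> is holomorphic on
  the right half-plane and not identically zero, and \<open>\<sigma> > 0\<close>, since the zeros on the line are then
  isolated.\<close>

definition mean_log :: "(complex \<Rightarrow> complex) \<Rightarrow> real \<Rightarrow> real \<Rightarrow> real" where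
  "mean_log f \<sigma> T = 1 / (2 * T) * (LBINT t:{-T..T}. ln (norm (f (Complex \<sigma> t))))"

definition jessen :: "(complex \<Rightarrow> complex) \<Rightarrow> real \<Rightarrow> real" where
  "jessen f \<sigma> = Lim at_top (mean_log f \<sigma>)"

definition zero_set :: "(complex \<Rightarrow> complex) \<Rightarrow> complex set" where
  "zero_set f = {s \<in> half_plane 0. f s = 0}"

text \<open>At a zero, \<open>zorder\<close> is the multiplicity, so weighting by it repeats each zero according to
  multiplicity.  The index set is finite in the situation of interest (\<open>\<sigma>\<^sub>0 > 0\<close> and \<open>f\<close> the
  continuation of a Dirichlet series with nonzero constant term): such an \<open>f\<close> has no zeros with large
  real part, and the zeros left lie in a compact subset of the right half-plane.\<close>

definition zero_sum :: "(complex \<Rightarrow> complex) \<Rightarrow> real \<Rightarrow> real \<Rightarrow> real" where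
  "zero_sum f \<sigma>\<^sub>0 T =
     (\<Sum>s \<in> {s \<in> zero_set f. \<bar>Im s\<bar> < T \<and> Re s > \<sigma>\<^sub>0}. of_int (zorder f s) * (Re s - \<sigma>\<^sub>0))"

end

theory Submission
  imports Defs
begin

text \<open>
  Dividing by the constant term gives a function \<open>F\<close> with \<open>F(+\<infinity>) = 1\<close>; write \<open>u = ln \<bar>F\<bar>\<close>. Only the first
  power of \<open>\<bar>F\<bar>\<close> matters, because \<open>\<bar>F\<bar> \<le> 1 + \<bar>F\<bar>\<^sup>p\<close>.

  Zeros and logarithmic means are linked by Littlewood's lemma, that is, by Green's identity for \<open>u\<close>
  and the harmonic function \<open>x - \<sigma>\<^sub>0\<close> on a rectangle with left edge on \<open>Re s = \<sigma>\<^sub>0\<close>: up to the other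
  three edges, \<open>2\<pi> \<Sum> (Re \<rho> - \<sigma>\<^sub>0)\<close> is the integral of \<open>u\<close> over the left edge. The right edge is pushed
  out to \<open>Re s \<approx> T\<close>, where \<open>F - 1\<close> has decayed. The horizontal edges would bring in the argument of
  \<open>F\<close>; to avoid it, heights are weighted with a trapezoidal cut-off. Its second derivative consists
  of four point masses, so the error is made of four horizontal integrals of \<open>(x - \<sigma>\<^sub>0) u\<close>
  (\<open>littlewood_trapezoid\<close>), and those are \<open>O(log T)\<close> (\<open>segment_log_bounds\<close>). Squeezing the cut-off
  between sharp ones turns the mean of \<open>u\<close> on \<open>Re s = \<sigma>\<^sub>0\<close> into the mean zero sum
  (\<open>weighted_zero_sum_limit\<close>). The zero sum is Lipschitz in \<open>\<sigma>\<^sub>0 \<ge> \<kappa>\<close>, with a constant bounded by the zero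
  sum at \<open>\<kappa>/2\<close>, and vanishes for large \<open>\<sigma>\<^sub>0\<close>; hence the limit is uniform (\<open>zero_sum_uniform_limit\<close>).

  It remains to see that the mean of \<open>u\<close> exists (\<open>log_mean_exists\<close>). On a vertical line, \<open>F\<close> is a limit
  in mean of trigonometric polynomials (\<open>trig_poly_mean_approximation\<close>): in Cauchy's formula on the
  rectangle with corners \<open>-\<sigma>/2 \<plusminus> iV\<close> and \<open>X \<plusminus> iV\<close>, with kernel \<open>exp(Vw + w\<^sup>2)/w\<close>, the right edge lies
  where the series converges uniformly, while the left edge carries the factor \<open>exp(-V\<sigma>/2)\<close> and the
  horizontal edges roughly \<open>exp(-V\<^sup>2)\<close>. Means of continuous functions of trigonometric polynomials
  exist by the Weierstrass approximation theorem, so the mean of \<open>ln (max \<bar>F\<bar> \<eta>)\<close> exists for every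
  \<open>\<eta> > 0\<close>. The truncation is harmless as \<open>\<eta> \<rightarrow> 0\<close> because the square mean of \<open>u\<close> is bounded
  (\<open>log_square_mean_bound\<close>).

  That bound is local. If \<open>\<bar>F\<bar> \<le> e\<^sup>M\<close> on a disc and \<open>\<bar>F\<bar> \<ge> e\<^sup>-\<^sup>M\<close> at its centre, splitting off Blaschke
  factors leaves \<open>O(M)\<close> zeros and a zero-free factor with logarithm \<open>O(M)\<close>, so the integral of \<open>u\<^sup>2\<close>
  over a segment is \<open>O(M\<^sup>2)\<close> (\<open>log_modulus_segment_bound\<close>). Centres are taken far to the right, where
  \<open>\<bar>F\<bar> \<ge> 1/2\<close>, and \<open>e\<^sup>M\<close> is comparable with integrals of \<open>\<bar>F\<bar>\<close> over lines nearby; as \<open>M\<^sup>2 \<le> 4 e\<^sup>M\<close>, the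
  sum of the \<open>M\<^sup>2\<close> over all discs up to height \<open>T\<close> is \<open>O(T)\<close> (\<open>strip_log_bound\<close>).
\<close>

section \<open>Blaschke factors and the logarithm of a bounded function\<close>

text \<open>Schwarz's lemma after moving the zero to the origin. Schwarz wants a strict bound, hence the detour
  through \<open>K + e\<close>.\<close>

lemma blaschke_quotient_bound:
  fixes f :: "complex \<Rightarrow> complex"
  assumes hol: "f holomorphic_on ball 0 1" and bd: "\<And>z. z \<in> ball 0 1 \<Longrightarrow> norm (f z) \<le> K"
    and \<rho>: "norm \<rho> < 1" and zero: "f \<rho> = 0" and z: "norm z < 1"
  shows "norm (f z) \<le> K * norm (Moebius_function 0 \<rho> z)"
proof -
  have K0: "K \<ge> 0" using bd[of 0] norm_ge_zero[of "f 0"] by (simp del: norm_ge_zero)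
  have step: "norm (f z) \<le> (K + e) * norm (Moebius_function 0 \<rho> z)" if "e > 0" for e
  proof -
    have Ke: "K + e > 0" using K0 that by simp
    define g where "g = (\<lambda>w. f (Moebius_function 0 (-\<rho>) w) / of_real (K + e))"
    have im: "Moebius_function 0 (-\<rho>) ` ball 0 1 \<subseteq> ball 0 1"
      using Moebius_function_norm_lt_1[of "-\<rho>"] \<rho> by auto
    have "(f \<circ> Moebius_function 0 (-\<rho>)) holomorphic_on ball 0 1"
      by (rule holomorphic_on_compose_gen[OF Moebius_function_holomorphic hol im]) (use \<rho> in auto)
    then have "g holomorphic_on ball 0 1"
      unfolding g_def o_def using Ke by (intro holomorphic_intros) (auto simp flip: of_real_add)
    moreover have "g 0 = 0" by (simp add: g_def Moebius_function_of_zero zero)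
    moreover have "norm (g w) < 1" if "norm w < 1" for w
    proof -
      have "norm (f (Moebius_function 0 (-\<rho>) w)) \<le> K"
        using Moebius_function_norm_lt_1[of "-\<rho>" w 0] \<rho> that by (intro bd) auto
      then have "norm (f (Moebius_function 0 (-\<rho>) w)) < K + e" using \<open>e > 0\<close> by simp
      then show ?thesis using Ke by (simp add: g_def norm_divide divide_simps flip: of_real_add)
    qed
    moreover have "norm (Moebius_function 0 \<rho> z) < 1"
      using Moebius_function_norm_lt_1[of \<rho> z 0] \<rho> z by simp
    ultimately have "norm (g (Moebius_function 0 \<rho> z)) \<le> norm (Moebius_function 0 \<rho> z)"
      by (rule Schwarz_Lemma)
    moreover have "Moebius_function 0 (-\<rho>) (Moebius_function 0 \<rho> z) = z"
      by (rule Moebius_function_compose) (use \<rho> z in auto)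
    ultimately show ?thesis using Ke
      by (simp add: g_def norm_divide divide_simps mult.commute flip: of_real_add)
  qed
  have "((\<lambda>e. (K + e) * norm (Moebius_function 0 \<rho> z)) \<longlongrightarrow> (K + 0) * norm (Moebius_function 0 \<rho> z)) (at_right 0)"
    by (intro tendsto_intros)
  moreover have "eventually (\<lambda>e. norm (f z) \<le> (K + e) * norm (Moebius_function 0 \<rho> z)) (at_right 0)"
    by (auto intro!: eventually_at_rightI[of 0 1] step)
  ultimately have "norm (f z) \<le> (K + 0) * norm (Moebius_function 0 \<rho> z)"
    by (rule tendsto_lowerbound) simp
  then show ?thesis by simp
qed

lemma blaschke_factor_out:
  fixes f :: "complex \<Rightarrow> complex"
  assumes hol: "f holomorphic_on ball 0 1" and bd: "\<And>z. z \<in> ball 0 1 \<Longrightarrow> norm (f z) \<le> K"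
    and \<rho>: "norm \<rho> < 1" and zero: "f \<rho> = 0"
  obtains g where "g holomorphic_on ball 0 1" "\<And>z. z \<in> ball 0 1 \<Longrightarrow> norm (g z) \<le> K"
    "\<And>z. z \<in> ball 0 1 \<Longrightarrow> f z = Moebius_function 0 \<rho> z * g z"
proof -
  define h where "h = (\<lambda>z. if z = \<rho> then deriv f \<rho> else (f z - f \<rho>) / (z - \<rho>))"
  have holh: "h holomorphic_on ball 0 1" unfolding h_def
    by (rule pole_theorem_open_0[OF hol, of \<rho>]) (auto simp: zero)
  define g where "g = (\<lambda>z. h z * (1 - cnj \<rho> * z))"
  have holg: "g holomorphic_on ball 0 1" unfolding g_def by (intro holomorphic_intros holh)
  have nz: "1 - cnj \<rho> * z \<noteq> 0" if "norm z < 1" for z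
  proof
    assume "1 - cnj \<rho> * z = 0"
    then have "norm (cnj \<rho> * z) = 1" by simp
    moreover have "norm (cnj \<rho> * z) \<le> norm z" using \<rho> by (simp add: norm_mult mult_left_le_one_le)
    ultimately show False using that by simp
  qed
  have eq: "f z = Moebius_function 0 \<rho> z * g z" if "z \<in> ball 0 1" for z
    using nz[of z] that by (auto simp: g_def h_def Moebius_function_simple zero)
  have bd1: "norm (g z) \<le> K" if "z \<in> ball 0 1" "z \<noteq> \<rho>" for z
  proof -
    have "norm (Moebius_function 0 \<rho> z) * norm (g z) \<le> K * norm (Moebius_function 0 \<rho> z)"
      using blaschke_quotient_bound[OF hol bd \<rho> zero, of z] that eq[of z] by (simp add: norm_mult)
    moreover have "norm (Moebius_function 0 \<rho> z) > 0"
      using that nz[of z] by (simp add: Moebius_function_simple)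
    ultimately show ?thesis by (simp add: mult.commute)
  qed
  have "norm (g \<rho>) \<le> K"
  proof -
    have "isCont g \<rho>" using holg \<rho>
      by (intro continuous_on_interior[OF holomorphic_on_imp_continuous_on]) auto
    then have "(g \<longlongrightarrow> g \<rho>) (at \<rho>)" by (simp add: isCont_def)
    then have "((\<lambda>z. norm (g z)) \<longlongrightarrow> norm (g \<rho>)) (at \<rho>)" by (rule tendsto_norm)
    moreover have "eventually (\<lambda>z. norm (g z) \<le> K) (at \<rho>)"
      using \<rho> eventually_at_in_open[of "ball 0 1" \<rho>]
      by (auto elim!: eventually_mono intro: bd1)
    ultimately show ?thesis by (rule tendsto_upperbound) simp
  qed
  with bd1 have "norm (g z) \<le> K" if "z \<in> ball 0 1" for z using that by (cases "z = \<rho>") auto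
  with holg eq show thesis using that by blast
qed

text \<open>Each zero split off multiplies the value at \<open>0\<close> by at least \<open>1 / r\<close> while the bound \<open>K\<close> persists, so a
  lower bound \<open>K r\<^sup>N\<close> at \<open>0\<close> allows at most \<open>N\<close> zeros. This is Jensen's bound for the number of zeros,
  together with the zero-free factor that is needed below.\<close>

lemma blaschke_factorisation:
  fixes f :: "complex \<Rightarrow> complex"
  assumes "0 < r" "r < 1" "0 < K"
  assumes "f holomorphic_on ball 0 1" "\<And>z. z \<in> ball 0 1 \<Longrightarrow> norm (f z) \<le> K"
    and "norm (f 0) \<ge> K * r ^ N"
  shows "\<exists>zs g. length zs \<le> N \<and> set zs \<subseteq> cball 0 r \<and> g holomorphic_on ball 0 1 \<and>
     (\<forall>z\<in>ball 0 1. norm (g z) \<le> K) \<and> norm (f 0) \<le> norm (g 0) \<and> (\<forall>z\<in>cball 0 r. g z \<noteq> 0) \<and>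
     (\<forall>z\<in>ball 0 1. f z = (\<Prod>\<rho>\<leftarrow>zs. Moebius_function 0 \<rho> z) * g z)"
  using assms(4-)
proof (induction N arbitrary: f)
  case (0 f)
  have "f z \<noteq> 0" if "z \<in> cball 0 r" for z
  proof
    assume "f z = 0"
    then have "norm (f 0) \<le> K * norm (Moebius_function 0 z 0)"
      using that \<open>r < 1\<close> by (intro blaschke_quotient_bound 0) auto
    also have "\<dots> = K * norm z" by (simp add: Moebius_function_of_zero)
    also have "\<dots> < K * 1" using that \<open>r < 1\<close> \<open>K > 0\<close> by (intro mult_strict_left_mono) auto
    finally show False using 0 by simp
  qed
  then show ?case using 0 by (intro exI[of _ "[]"] exI[of _ f]) auto
next
  case (Suc N f)
  show ?case
  proof (cases "\<forall>z\<in>cball 0 r. f z \<noteq> 0")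
    case True
    then show ?thesis using Suc.prems by (intro exI[of _ "[]"] exI[of _ f]) auto
  next
    case False
    then obtain \<rho> where \<rho>: "\<rho> \<in> cball 0 r" "f \<rho> = 0" by auto
    obtain g where g: "g holomorphic_on ball 0 1" "\<And>z. z \<in> ball 0 1 \<Longrightarrow> norm (g z) \<le> K"
      "\<And>z. z \<in> ball 0 1 \<Longrightarrow> f z = Moebius_function 0 \<rho> z * g z"
      by (rule blaschke_factor_out[OF Suc.prems(1,2), of \<rho>]) (use \<rho> \<open>r < 1\<close> in auto)
    have f0: "norm (f 0) = norm \<rho> * norm (g 0)"
      using g(3)[of 0] by (simp add: Moebius_function_of_zero norm_mult)
    also have "\<dots> \<le> r * norm (g 0)" using \<rho> by (intro mult_right_mono) auto
    finally have le: "norm (f 0) \<le> r * norm (g 0)" .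
    then have "r * (K * r ^ N) \<le> r * norm (g 0)" using Suc.prems(3) by (simp add: mult_ac)
    then have "K * r ^ N \<le> norm (g 0)" using \<open>r > 0\<close> by simp
    from Suc.IH[OF g(1,2) this] obtain zs h where h: "length zs \<le> N" "set zs \<subseteq> cball 0 r"
      "h holomorphic_on ball 0 1" "\<forall>z\<in>ball 0 1. norm (h z) \<le> K" "norm (g 0) \<le> norm (h 0)"
      "\<forall>z\<in>cball 0 r. h z \<noteq> 0" "\<forall>z\<in>ball 0 1. g z = (\<Prod>\<rho>\<leftarrow>zs. Moebius_function 0 \<rho> z) * h z"
      by blast
    have "r * norm (g 0) \<le> 1 * norm (g 0)" using \<open>r < 1\<close> by (intro mult_right_mono) auto
    with le h(5) have "norm (f 0) \<le> norm (h 0)" by simp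
    with h g(3) \<rho> show ?thesis
      by (intro exI[of _ "\<rho> # zs"] exI[of _ h]) (auto simp: mult.assoc)
  qed
qed

text \<open>The inequality of Borel and Caratheodory: \<open>w \<mapsto> w / (2A - w)\<close> maps the half-plane \<open>Re w < A\<close> into the
  unit disc and fixes \<open>0\<close>, so Schwarz's lemma applies.\<close>

lemma borel_caratheodory_unit:
  fixes k :: "complex \<Rightarrow> complex"
  assumes hol: "k holomorphic_on ball 0 1" and k0: "k 0 = 0" and A: "A > 0"
    and bd: "\<And>z. z \<in> ball 0 1 \<Longrightarrow> Re (k z) < A" and z: "norm z < 1"
  shows "norm (k z) \<le> 2 * A * norm z / (1 - norm z)"
proof -
  define g where "g = (\<lambda>w. k w / (of_real (2 * A) - k w))"
  have nz: "of_real (2 * A) - k w \<noteq> 0" if "norm w < 1" for w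
    using bd[of w] that A by (auto simp: complex_eq_iff)
  have "g holomorphic_on ball 0 1"
    unfolding g_def using nz by (intro holomorphic_intros hol) auto
  moreover have "g 0 = 0" by (simp add: g_def k0)
  moreover have "norm (g w) < 1" if "norm w < 1" for w
  proof -
    have "(norm (k w))\<^sup>2 < (norm (of_real (2 * A) - k w))\<^sup>2"
    proof -
      have "Re (k w) * A < A * A" using bd[of w] that A by simp
      then show ?thesis unfolding cmod_power2 by (simp add: power2_eq_square algebra_simps)
    qed
    then have "norm (k w) < norm (of_real (2 * A) - k w)" by (rule power2_less_imp_less) simp
    then show ?thesis using nz[OF that] by (simp add: g_def norm_divide divide_simps)
  qed
  ultimately have "norm (g z) \<le> norm z" using z by (rule Schwarz_Lemma)
  then have "norm (k z) \<le> norm z * norm (of_real (2 * A) - k z)"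
    using nz[OF z] by (simp add: g_def norm_divide divide_simps)
  also have "\<dots> \<le> norm z * (2 * A + norm (k z))"
    using A norm_triangle_ineq4[of "of_real (2*A)" "k z"] by (intro mult_left_mono) auto
  finally show ?thesis using z by (simp add: field_simps)
qed


text \<open>Near the centre, \<open>ln \<bar>f\<bar>\<close> is a sum of \<open>O(M)\<close> terms \<open>ln \<bar>s - \<rho>\<bar>\<close> and an error \<open>O(M)\<close>: the factorisation bounds
  the number of zeros, the Borel-Caratheodory inequality bounds the logarithm of the zero-free factor,
  and a Blaschke factor differs from \<open>s - \<rho>\<close> by a factor bounded above and below. At a zero of \<open>f\<close> the
  estimate is trivial because \<open>ln 0 = 0\<close>.\<close>

lemma log_modulus_local_bound:
  fixes r R :: real
  assumes r: "0 < r" "r < R"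
  shows "\<exists>C>0. \<forall>f z0 M. 1 \<le> M \<longrightarrow> f holomorphic_on ball z0 R \<longrightarrow>
     (\<forall>z\<in>ball z0 R. norm (f z) \<le> exp M) \<longrightarrow> exp (- M) \<le> norm (f z0) \<longrightarrow>
     (\<exists>(n::nat) \<rho>. real n \<le> C * M \<and> (\<forall>i<n. \<rho> i \<in> ball z0 R) \<and>
       (\<forall>s\<in>cball z0 r. \<bar>ln (norm (f s))\<bar> \<le> (\<Sum>i<n. \<bar>ln (norm (s - \<rho> i))\<bar>) + C * M))"
proof -
  define q where "q = r / R"
  define q1 where "q1 = (1 + q) / 2"
  have q: "0 < q" "q < 1" using r by (auto simp: q_def)
  have q1: "0 < q1" "q1 < 1" "q < q1" using q by (auto simp: q1_def)
  define \<theta> where "\<theta> = q / q1"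
  have \<theta>: "0 < \<theta>" "\<theta> < 1" using q q1 by (auto simp: \<theta>_def)
  define C1 where "C1 = 2 / ln (1 / q1) + 1"
  have lnq1: "ln (1 / q1) > 0" using q1 by simp
  then have C1: "C1 > 0" by (auto simp: C1_def intro!: add_pos_pos)
  define c2 where "c2 = \<bar>ln (1 - q1)\<bar> + ln 2 + \<bar>ln R\<bar>"
  have c2: "c2 \<ge> 0" by (simp add: c2_def)
  define C where "C = C1 + C1 * c2 + 1 + 6 * \<theta> / (1 - \<theta>)"
  have C: "C > 0" unfolding C_def using C1 c2 \<theta> by (intro add_pos_nonneg) auto
  show ?thesis
  proof (intro exI[of _ C] conjI allI impI C)
    fix f :: "complex \<Rightarrow> complex" and z0 M
    assume M: "1 \<le> M" and hol: "f holomorphic_on ball z0 R"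
      and bd: "\<forall>z\<in>ball z0 R. norm (f z) \<le> exp M" and low: "exp (- M) \<le> norm (f z0)"
    define \<phi> where "\<phi> = (\<lambda>w. f (z0 + of_real R * w))"
    have R0: "R > 0" using r by simp
    have inb: "z0 + of_real R * w \<in> ball z0 R" if "w \<in> ball 0 1" for w
      using that R0 by (simp add: dist_norm norm_mult)
    have "(f \<circ> (\<lambda>w. z0 + of_real R * w)) holomorphic_on ball 0 1"
      by (rule holomorphic_on_compose_gen[OF _ hol]) (use inb in \<open>auto intro!: holomorphic_intros\<close>)
    then have hol\<phi>: "\<phi> holomorphic_on ball 0 1" by (simp add: \<phi>_def o_def)
    (* the least N with exp M * q1 ^ N <= exp (-M) *)
    define N where "N = nat \<lceil>2 * M / ln (1 / q1)\<rceil>"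
    have N1: "2 * M \<le> real N * ln (1 / q1)"
    proof -
      have "2 * M / ln (1 / q1) \<le> real N"
        unfolding N_def by linarith
      then show ?thesis using lnq1 by (simp add: divide_le_eq)
    qed
    have "2 * M / ln (1 / q1) \<ge> 0" using lnq1 M by simp
    then have "real N \<le> 2 * M / ln (1 / q1) + 1" unfolding N_def by linarith
    also have "\<dots> \<le> C1 * M" using M by (simp add: C1_def field_simps)
    finally have N2: "real N \<le> C1 * M" .
    have "q1 ^ N = exp (real N * ln q1)" using q1 by (simp add: exp_of_nat_mult)
    also have "\<dots> \<le> exp (- 2 * M)" using N1 q1 by (simp add: ln_div)
    finally have "exp M * q1 ^ N \<le> exp M * exp (- 2 * M)" by simp
    also have "\<dots> = exp (- M)" by (simp add: exp_add[symmetric])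
    also have "\<dots> \<le> norm (\<phi> 0)" using low by (simp add: \<phi>_def)
    finally have "exp M * q1 ^ N \<le> norm (\<phi> 0)" .
    then obtain zs g where zs: "length zs \<le> N" "set zs \<subseteq> cball 0 q1"
      and g: "g holomorphic_on ball 0 1" "\<And>z. z\<in>ball 0 1 \<Longrightarrow> norm (g z) \<le> exp M"
         "norm (\<phi> 0) \<le> norm (g 0)" "\<And>z. z\<in>cball 0 q1 \<Longrightarrow> g z \<noteq> 0"
      and fac: "\<And>z. z\<in>ball 0 1 \<Longrightarrow> \<phi> z = (\<Prod>\<rho>\<leftarrow>zs. Moebius_function 0 \<rho> z) * g z"
      using blaschke_factorisation[of q1 "exp M" \<phi> N] q1 hol\<phi> bd inb
      by (auto simp: \<phi>_def)
    define G where "G = (\<lambda>w. g (of_real q1 * w))"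
    have q1b: "of_real q1 * w \<in> ball 0 1" "of_real q1 * w \<in> cball 0 q1" if "w \<in> ball 0 1" for w :: complex
    proof -
      have "q1 * norm w < 1 * 1" using that q1 by (intro mult_strict_mono) auto
      then show "of_real q1 * w \<in> ball 0 1" using q1 by (simp add: norm_mult)
      show "of_real q1 * w \<in> cball 0 q1" using that q1 by (simp add: norm_mult mult_left_le)
    qed
    have "(g \<circ> (\<lambda>w. of_real q1 * w)) holomorphic_on ball 0 1"
      by (rule holomorphic_on_compose_gen[OF _ g(1)]) (use q1b in \<open>auto intro!: holomorphic_intros\<close>)
    then have holG: "G holomorphic_on ball 0 1" by (simp add: G_def o_def)
    have "contractible (ball (0::complex) 1)" by (intro convex_imp_contractible) auto
    then obtain h where h: "h holomorphic_on ball 0 1" "\<And>w. w \<in> ball 0 1 \<Longrightarrow> G w = exp (h w)"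
      using contractible_imp_holomorphic_log[OF holG] g(4) q1b unfolding G_def by blast
    have lnG: "ln (norm (G w)) = Re (h w)" if "w \<in> ball 0 1" for w
      using h(2)[OF that] by simp
    have G0: "\<bar>ln (norm (g 0))\<bar> \<le> M"
    proof -
      have "exp (- M) \<le> norm (g 0)" using low g(3) by (simp add: \<phi>_def)
      then have "- M \<le> ln (norm (g 0))" using ln_mono[of "exp (- M)"] by fastforce
      moreover have "ln (norm (g 0)) \<le> M"
        using g(2)[of 0] ln_mono[of "norm (g 0)" "exp M"] g(4)[of 0] q1 by simp
      ultimately show ?thesis by linarith
    qed
    have k: "norm (h w - h 0) \<le> 6 * \<theta> / (1 - \<theta>) * M" if "norm w \<le> \<theta>" for w
    proof -
      have w: "norm w < 1" using that \<theta> by simp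
      have "norm (h w - h 0) \<le> 2 * (3 * M) * norm w / (1 - norm w)"
      proof (rule borel_caratheodory_unit[where k="\<lambda>w. h w - h 0"])
        fix z :: complex assume z: "z \<in> ball 0 1"
        have "ln (norm (G z)) \<le> M"
          using ln_mono[of "norm (G z)" "exp M"] g(2)[OF q1b(1)[OF z]] g(4)[OF q1b(2)[OF z]]
          by (simp add: G_def)
        moreover have "- M \<le> ln (norm (G 0))" using G0 by (simp add: G_def)
        ultimately show "Re (h z - h 0) < 3 * M" using lnG[OF z] lnG[of 0] M by simp
      qed (use M w h in \<open>auto intro!: holomorphic_intros\<close>)
      also have "\<dots> \<le> 2 * (3 * M) * \<theta> / (1 - \<theta>)"
        using that \<theta> M by (intro frac_le mult_mono) auto
      finally show ?thesis by (simp add: mult_ac)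
    qed
    have Mb: "\<bar>ln (norm (Moebius_function 0 \<rho> w))\<bar> \<le> \<bar>ln (norm (z0 + of_real R * w - (z0 + of_real R * \<rho>)))\<bar> + c2"
      if \<rho>: "\<rho> \<in> cball 0 q1" and w: "norm w \<le> q" for \<rho> w
    proof (cases "w = \<rho>")
      case False
      have "norm (cnj \<rho> * w) \<le> q1 * 1" unfolding norm_mult using \<rho> w q q1 by (intro mult_mono) auto
      moreover have "norm (1 - cnj \<rho> * w) \<ge> 1 - norm (cnj \<rho> * w)"
        using norm_triangle_ineq2[of 1 "cnj \<rho> * w"] by simp
      moreover have "norm (1 - cnj \<rho> * w) \<le> 1 + norm (cnj \<rho> * w)"
        using norm_triangle_ineq4[of 1 "cnj \<rho> * w"] by simp
      ultimately have b: "1 - q1 \<le> norm (1 - cnj \<rho> * w)" "norm (1 - cnj \<rho> * w) \<le> 2" using q1 by auto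
      have b': "ln (1 - q1) \<le> ln (norm (1 - cnj \<rho> * w))" "ln (norm (1 - cnj \<rho> * w)) \<le> ln 2"
        using b q1 by (auto intro!: ln_mono)
      have p: "norm (1 - cnj \<rho> * w) > 0" using b q1 by linarith
      have "ln (norm (Moebius_function 0 \<rho> w)) = ln (norm (w - \<rho>)) - ln (norm (1 - cnj \<rho> * w))"
        using False p by (simp add: Moebius_function_simple norm_divide ln_div)
      moreover have "z0 + of_real R * w - (z0 + of_real R * \<rho>) = of_real R * (w - \<rho>)"
        by (simp add: algebra_simps)
      then have "ln (norm (z0 + of_real R * w - (z0 + of_real R * \<rho>))) = ln R + ln (norm (w - \<rho>))"
        using False R0 by (simp add: norm_mult ln_mult)
      moreover have "ln 2 \<ge> (0::real)" by simp
      ultimately show ?thesis unfolding c2_def using b' by linarith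
    qed (use c2 in \<open>simp add: Moebius_function_simple\<close>)
    have prod: "\<bar>ln (norm (\<Prod>\<rho>\<leftarrow>xs. Moebius_function 0 \<rho> w))\<bar> \<le>
       (\<Sum>\<rho>\<leftarrow>xs. \<bar>ln (norm (z0 + of_real R * w - (z0 + of_real R * \<rho>)))\<bar> + c2)"
      if "set xs \<subseteq> cball 0 q1" "norm w \<le> q" for xs w using that(1)
    proof (induction xs)
      case (Cons x xs)
      show ?case
      proof (cases "(\<Prod>\<rho>\<leftarrow>x#xs. Moebius_function 0 \<rho> w) = 0")
        case True
        then show ?thesis using c2 by (auto simp: simp del: prod_list_zero_iff intro!: add_nonneg_nonneg sum_list_nonneg)
      next
        case False
        then have "Moebius_function 0 x w \<noteq> 0" "(\<Prod>\<rho>\<leftarrow>xs. Moebius_function 0 \<rho> w) \<noteq> 0" by auto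
        then have "ln (norm (\<Prod>\<rho>\<leftarrow>x#xs. Moebius_function 0 \<rho> w)) =
           ln (norm (Moebius_function 0 x w)) + ln (norm (\<Prod>\<rho>\<leftarrow>xs. Moebius_function 0 \<rho> w))"
          by (simp add: norm_mult ln_mult del: prod_list_zero_iff)
        with Cons Mb[of x w] that(2) show ?thesis by (auto simp del: mem_cball_0)
      qed
    qed simp
    show "\<exists>(n::nat) \<rho>. real n \<le> C * M \<and> (\<forall>i<n. \<rho> i \<in> ball z0 R) \<and>
       (\<forall>s\<in>cball z0 r. \<bar>ln (norm (f s))\<bar> \<le> (\<Sum>i<n. \<bar>ln (norm (s - \<rho> i))\<bar>) + C * M)"
    proof (intro exI conjI allI ballI impI)
      have "real (length zs) \<le> C1 * M" using zs N2 by simp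
      also have "\<dots> \<le> C * M" unfolding C_def using M C1 c2 \<theta> by (intro mult_right_mono) auto
      finally show "real (length zs) \<le> C * M" .
      show "z0 + of_real R * zs ! i \<in> ball z0 R" if "i < length zs" for i
        using zs(2) that q1 by (intro inb) (auto simp: subset_iff dest!: nth_mem)
      fix s assume s: "s \<in> cball z0 r"
      define w where "w = (s - z0) / of_real R"
      have s_eq: "s = z0 + of_real R * w" using R0 by (simp add: w_def)
      have nw: "norm w \<le> q" using s R0
        by (simp add: w_def q_def norm_divide dist_norm norm_minus_commute divide_right_mono)
      then have wb: "w \<in> ball 0 1" using q by simp
      have fs: "f s = (\<Prod>\<rho>\<leftarrow>zs. Moebius_function 0 \<rho> w) * g w"
        using fac[OF wb] by (simp add: \<phi>_def s_eq)
      have gw: "g w \<noteq> 0" using nw q1 by (intro g(4)) simp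
      have "\<bar>ln (norm (g w))\<bar> \<le> M + 6 * \<theta> / (1 - \<theta>) * M"
      proof -
        define v where "v = w / of_real q1"
        have v: "norm v \<le> \<theta>" using nw q1 by (simp add: v_def \<theta>_def norm_divide divide_right_mono)
        then have v1: "v \<in> ball 0 1" using \<theta> by simp
        have "G v = g w" using q1 by (simp add: G_def v_def)
        then have "ln (norm (g w)) - ln (norm (g 0)) = Re (h v - h 0)"
          using lnG[OF v1] lnG[of 0] by (simp add: G_def)
        then have "\<bar>ln (norm (g w)) - ln (norm (g 0))\<bar> \<le> 6 * \<theta> / (1 - \<theta>) * M"
          using k[OF v] abs_Re_le_cmod[of "h v - h 0"] by linarith
        then show ?thesis using G0 by linarith
      qed
      moreover have "\<bar>ln (norm (\<Prod>\<rho>\<leftarrow>zs. Moebius_function 0 \<rho> w))\<bar> \<le>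
         (\<Sum>i<length zs. \<bar>ln (norm (s - (z0 + of_real R * zs ! i)))\<bar>) + C1 * M * c2"
      proof -
        have "(\<Sum>\<rho>\<leftarrow>zs. \<bar>ln (norm (s - (z0 + of_real R * \<rho>)))\<bar> + c2) =
           (\<Sum>i<length zs. \<bar>ln (norm (s - (z0 + of_real R * zs ! i)))\<bar>) + length zs * c2"
          by (simp add: sum_list_sum_nth sum.distrib atLeast0LessThan)
        moreover have "length zs * c2 \<le> C1 * M * c2"
          using zs N2 c2 by (intro mult_right_mono) auto
        ultimately show ?thesis using prod[OF zs(2) nw] unfolding s_eq by linarith
      qed
      moreover have "\<bar>ln (norm (f s))\<bar> \<le> \<bar>ln (norm (\<Prod>\<rho>\<leftarrow>zs. Moebius_function 0 \<rho> w))\<bar> + \<bar>ln (norm (g w))\<bar>"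
        using gw by (cases "(\<Prod>\<rho>\<leftarrow>zs. Moebius_function 0 \<rho> w) = 0")
          (auto simp: fs norm_mult ln_mult simp del: prod_list_zero_iff)
      ultimately have "\<bar>ln (norm (f s))\<bar> \<le> (\<Sum>i<length zs. \<bar>ln (norm (s - (z0 + of_real R * zs ! i)))\<bar>) +
         (C1 * c2 + 1 + 6 * \<theta> / (1 - \<theta>)) * M" by (simp add: algebra_simps)
      also have "(C1 * c2 + 1 + 6 * \<theta> / (1 - \<theta>)) * M \<le> C * M"
        using C1 M by (intro mult_right_mono) (auto simp: C_def)
      finally show "\<bar>ln (norm (f s))\<bar> \<le> (\<Sum>i<length zs. \<bar>ln (norm (s - (z0 + of_real R * zs ! i)))\<bar>) + C * M"
        by simp
    qed
  qed
qed

section \<open>The logarithm on line segments\<close>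

text \<open>The logarithm is squared-integrable near \<open>0\<close>; the form with two variables lets \<open>x\<close> be the distance of a
  point of a line to a zero and \<open>v\<close> its component along the line.\<close>

lemma abs_ln_le_powr:
  assumes "D \<ge> 1"
  shows "\<exists>c\<ge>0. \<forall>x v::real. 0 < \<bar>v\<bar> \<longrightarrow> \<bar>v\<bar> \<le> x \<longrightarrow> x \<le> D \<longrightarrow> (ln x)\<^sup>2 \<le> c * \<bar>v\<bar> powr (-1/2)"
proof (intro exI[of _ "16 + (ln D)\<^sup>2 * D powr (1/2)"] conjI allI impI)
  fix x v :: real assume v: "0 < \<bar>v\<bar>" "\<bar>v\<bar> \<le> x" "x \<le> D"
  have x: "x > 0" using v by simp
  have le: "x powr (-1/2) \<le> \<bar>v\<bar> powr (-1/2)" using v by (intro powr_mono2') auto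
  show "(ln x)\<^sup>2 \<le> (16 + (ln D)\<^sup>2 * D powr (1/2)) * \<bar>v\<bar> powr (-1/2)"
  proof (cases "x \<le> 1")
    case True
    have "- ln x = 4 * ln (x powr (-1/4))" using x by (simp add: ln_powr)
    also have "\<dots> \<le> 4 * x powr (-1/4)" using ln_bound[of "x powr (-1/4)"] x by simp
    finally have "(- ln x)\<^sup>2 \<le> (4 * x powr (-1/4))\<^sup>2"
      using True x by (intro power_mono) auto
    also have "\<dots> = 16 * x powr (-1/2)"
      using x by (simp add: power_mult_distrib powr_power)
    also have "\<dots> \<le> (16 + (ln D)\<^sup>2 * D powr (1/2)) * \<bar>v\<bar> powr (-1/2)"
      using le by (intro mult_mono) auto
    finally show ?thesis by simp
  next
    case False
    have "(ln x)\<^sup>2 \<le> (ln D)\<^sup>2" using False v by (intro power_mono ln_mono) auto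
    also have "\<dots> = (ln D)\<^sup>2 * D powr (1/2) * D powr (-1/2)"
      using assms by (simp add: powr_add[symmetric] mult.assoc)
    also have "\<dots> \<le> (16 + (ln D)\<^sup>2 * D powr (1/2)) * \<bar>v\<bar> powr (-1/2)"
    proof (intro mult_mono)
      show "D powr (-1/2) \<le> \<bar>v\<bar> powr (-1/2)" using v by (intro powr_mono2') auto
    qed auto
    finally show ?thesis .
  qed
qed auto

lemma integral_inv_sqrt_bound:
  fixes a b \<eta> L :: real
  assumes ab: "a \<le> b" "\<And>t. t \<in> {a..b} \<Longrightarrow> \<bar>t - \<eta>\<bar> \<le> L" and L: "L > 0"
  shows "(\<lambda>t. \<bar>t - \<eta>\<bar> powr (-1/2)) integrable_on {a..b}"
    and "integral {a..b} (\<lambda>t. \<bar>t - \<eta>\<bar> powr (-1/2)) \<le> 4 * sqrt L"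
proof -
  have base: "((\<lambda>x. x powr (-1/2)) has_integral (2 * sqrt L)) {0..L}"
    using has_integral_powr_from_0[of "-1/2" L] L by (simp add: powr_half_sqrt mult.commute)
  have b1: "((\<lambda>x. \<bar>x\<bar> powr (-1/2)) has_integral (2 * sqrt L)) {0..L}"
    by (rule has_integral_eq[OF _ base]) auto
  have b2: "((\<lambda>x. \<bar>x\<bar> powr (-1/2)) has_integral (2 * sqrt L)) {-L..0}"
    using has_integral_reflect_lemma_real[OF b1] by simp
  have "((\<lambda>x. \<bar>x\<bar> powr (-1/2)) has_integral (2 * sqrt L + 2 * sqrt L)) {-L..L}"
    by (rule has_integral_combine[OF _ _ b2 b1]) (use L in auto)
  from has_integral_shift_real_ivl[OF this, of "-\<eta>"]
  have i: "((\<lambda>x. \<bar>x - \<eta>\<bar> powr (-1/2)) has_integral (2 * sqrt L + 2 * sqrt L)) {\<eta>-L..\<eta>+L}"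
    by (simp add: algebra_simps)
  have sub: "{a..b} \<subseteq> {\<eta>-L..\<eta>+L}" using ab(2) by (force simp: abs_le_iff)
  then show int: "(\<lambda>t. \<bar>t - \<eta>\<bar> powr (-1/2)) integrable_on {a..b}"
    using i integrable_subinterval_real by blast
  have "integral {a..b} (\<lambda>t. \<bar>t - \<eta>\<bar> powr (-1/2)) \<le> integral {\<eta>-L..\<eta>+L} (\<lambda>t. \<bar>t - \<eta>\<bar> powr (-1/2))"
    using i by (intro integral_subset_le sub int) auto
  also have "\<dots> = 4 * sqrt L" using i by (simp add: integral_unique)
  finally show "integral {a..b} (\<lambda>t. \<bar>t - \<eta>\<bar> powr (-1/2)) \<le> 4 * sqrt L" .
qed

lemma sum_squared_le:
  fixes x :: "nat \<Rightarrow> real"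
  shows "(\<Sum>i<n. x i)\<^sup>2 \<le> real n * (\<Sum>i<n. (x i)\<^sup>2)"
  using Cauchy_Schwarz_ineq_sum[of "\<lambda>_. 1" x "{..<n}"] by simp

text \<open>By Cauchy-Schwarz the square of a sum of \<open>n = O(M)\<close> logarithms costs a factor \<open>n\<close>, so its integral is
  \<open>O(n\<^sup>2) = O(M\<^sup>2)\<close>. The direction \<open>e\<close> is free so that vertical and horizontal segments are covered
  at once.\<close>

lemma log_modulus_segment_bound:
  fixes r R :: real
  assumes r: "0 < r" "r < R"
  shows "\<exists>C>0. \<forall>f z0 M w e a b. 1 \<le> M \<longrightarrow> f holomorphic_on ball z0 R \<longrightarrow>
     (\<forall>z\<in>ball z0 R. norm (f z) \<le> exp M) \<longrightarrow> exp (- M) \<le> norm (f z0) \<longrightarrow>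
     norm e = 1 \<longrightarrow> a \<le> b \<longrightarrow> (\<forall>t\<in>{a..b}. w + of_real t * e \<in> cball z0 r) \<longrightarrow>
     (\<lambda>t. (ln (norm (f (w + of_real t * e))))\<^sup>2) integrable_on {a..b} \<and>
     (\<lambda>t. ln (norm (f (w + of_real t * e)))) absolutely_integrable_on {a..b} \<and>
     integral {a..b} (\<lambda>t. (ln (norm (f (w + of_real t * e))))\<^sup>2) \<le> C * M\<^sup>2 \<and>
     integral {a..b} (\<lambda>t. \<bar>ln (norm (f (w + of_real t * e)))\<bar>) \<le> C * M"
proof -
  define D where "D = 2 * R + 1"
  have D: "D \<ge> 1" using r by (simp add: D_def)
  obtain C1 where C1: "C1 > 0" and loc: "\<And>f z0 M. 1 \<le> M \<Longrightarrow> f holomorphic_on ball z0 R \<Longrightarrow>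
     (\<forall>z\<in>ball z0 R. norm (f z) \<le> exp M) \<Longrightarrow> exp (- M) \<le> norm (f z0) \<Longrightarrow>
     (\<exists>(n::nat) \<rho>. real n \<le> C1 * M \<and> (\<forall>i<n. \<rho> i \<in> ball z0 R) \<and>
       (\<forall>s\<in>cball z0 r. \<bar>ln (norm (f s))\<bar> \<le> (\<Sum>i<n. \<bar>ln (norm (s - \<rho> i))\<bar>) + C1 * M))"
    using log_modulus_local_bound[OF r] by blast
  obtain c where c: "c \<ge> 0" and lnc: "\<And>x v::real. 0 < \<bar>v\<bar> \<Longrightarrow> \<bar>v\<bar> \<le> x \<Longrightarrow> x \<le> D \<Longrightarrow> (ln x)\<^sup>2 \<le> c * \<bar>v\<bar> powr (-1/2)"
    using abs_ln_le_powr[OF D] by blast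
  define C2 where "C2 = 2 * C1\<^sup>2 * c * (4 * sqrt D) + 2 * C1\<^sup>2 * (2 * r)"
  have C2: "C2 \<ge> 0" using c C1 D r by (simp add: C2_def)
  define C where "C = C2 + 2 * r"
  have C: "C > 0" using C2 r by (simp add: C_def)
  show ?thesis
  proof (rule exI[of _ C], rule conjI[OF C], intro allI impI)
    fix f :: "complex \<Rightarrow> complex" and z0 w e :: complex and M a b :: real
    assume M: "1 \<le> M" and hol: "f holomorphic_on ball z0 R"
      and bd: "\<forall>z\<in>ball z0 R. norm (f z) \<le> exp M" and low: "exp (- M) \<le> norm (f z0)"
      and e: "norm e = 1" and ab: "a \<le> b" and seg: "\<forall>t\<in>{a..b}. w + of_real t * e \<in> cball z0 r"
    obtain n \<rho> where n: "real n \<le> C1 * M" "\<And>i. i < n \<Longrightarrow> \<rho> i \<in> ball z0 R"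
      and lb: "\<And>s. s \<in> cball z0 r \<Longrightarrow> \<bar>ln (norm (f s))\<bar> \<le> (\<Sum>i<n. \<bar>ln (norm (s - \<rho> i))\<bar>) + C1 * M"
      using loc[OF M hol bd low] by blast
    define \<eta> where "\<eta> = (\<lambda>i. Re ((\<rho> i - w) / e))"
    have e0: "e \<noteq> 0" using e by auto
    have eta: "\<bar>t - \<eta> i\<bar> \<le> norm (w + of_real t * e - \<rho> i)" for t i
    proof -
      have "w + of_real t * e - \<rho> i = e * (of_real t - (\<rho> i - w) / e)"
        using e0 by (simp add: field_simps)
      then have "norm (w + of_real t * e - \<rho> i) = norm (of_real t - (\<rho> i - w) / e)"
        using e by (simp add: norm_mult)
      also have "\<dots> \<ge> \<bar>Re (of_real t - (\<rho> i - w) / e)\<bar>" by (rule abs_Re_le_cmod)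
      finally show ?thesis by (simp add: \<eta>_def)
    qed
    have dD: "norm (s - \<rho> i) \<le> D" if "s \<in> cball z0 r" "i < n" for s i
      using n(2)[OF that(2)] that(1) r dist_triangle[of s "\<rho> i" z0]
      by (simp add: D_def dist_norm[symmetric] dist_commute)
    have ab2: "b - a \<le> 2 * r"
    proof -
      have "dist (w + of_real a * e) (w + of_real b * e) \<le> r + r"
        using seg ab by (intro dist_triangle_le[where z=z0] add_mono) (auto simp: dist_commute)
      also have "dist (w + of_real a * e) (w + of_real b * e) = norm (of_real (a - b) * e)"
        by (simp add: dist_norm algebra_simps)
      also have "\<dots> = b - a" using ab e by (simp add: norm_mult del: of_real_diff)
      finally show "b - a \<le> 2 * r" by simp
    qed
    define u where "u = (\<lambda>t. ln (norm (f (w + of_real t * e))))"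
    define d where "d = (\<lambda>t. 2 * real n * (\<Sum>i<n. c * \<bar>t - \<eta> i\<bar> powr (-1/2)) + 2 * (C1 * M)\<^sup>2)"
    have ud: "(u t)\<^sup>2 \<le> d t" if t: "t \<in> {a..b}" "t \<notin> \<eta> ` {..<n}" for t
    proof -
      let ?s = "w + of_real t * e"
      have s: "?s \<in> cball z0 r" using seg t by blast
      have "(u t)\<^sup>2 = \<bar>u t\<bar>\<^sup>2" by simp
      also have "\<dots> \<le> ((\<Sum>i<n. \<bar>ln (norm (?s - \<rho> i))\<bar>) + C1 * M)\<^sup>2"
        using lb[OF s] by (intro power_mono) (auto simp: u_def)
      also have "\<dots> \<le> 2 * (\<Sum>i<n. \<bar>ln (norm (?s - \<rho> i))\<bar>)\<^sup>2 + 2 * (C1 * M)\<^sup>2"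
        using sum_squares_bound[of "\<Sum>i<n. \<bar>ln (norm (?s - \<rho> i))\<bar>" "C1 * M"] by (simp add: power2_sum)
      also have "\<dots> \<le> 2 * (real n * (\<Sum>i<n. \<bar>ln (norm (?s - \<rho> i))\<bar>\<^sup>2)) + 2 * (C1 * M)\<^sup>2"
        using sum_squared_le[where x="\<lambda>i. \<bar>ln (norm (?s - \<rho> i))\<bar>" and n=n] by simp
      also have "\<dots> \<le> d t"
        unfolding d_def mult.assoc power2_abs
        using t eta dD[OF s] by (intro add_mono mult_left_mono sum_mono lnc) auto
      finally show ?thesis .
    qed
    have Ld: "\<bar>t - \<eta> i\<bar> \<le> D" if "t \<in> {a..b}" "i < n" for t i
      using eta[of t i] dD[OF bspec[OF seg that(1)] that(2)] by linarith
    have D0: "D > 0" using D by simp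
    have iv1: "(\<lambda>t. \<bar>t - \<eta> i\<bar> powr (-1/2)) integrable_on {a..b}"
      and iv2: "integral {a..b} (\<lambda>t. \<bar>t - \<eta> i\<bar> powr (-1/2)) \<le> 4 * sqrt D" if "i < n" for i
      using integral_inv_sqrt_bound[OF ab Ld[OF _ that] D0] by auto
    have dint: "d integrable_on {a..b}"
      unfolding d_def using iv1
      by (intro integrable_add integrable_on_mult_right integrable_sum integrable_const_ivl) auto
    have "integral {a..b} d = 2 * real n * (\<Sum>i<n. c * integral {a..b} (\<lambda>t. \<bar>t - \<eta> i\<bar> powr (-1/2))) + 2 * (C1 * M)\<^sup>2 * (b - a)"
      
    proof -
      have i: "(\<lambda>t. c * \<bar>t - \<eta> i\<bar> powr (-1/2)) integrable_on {a..b}" if "i < n" for i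
        using iv1[OF that] by (rule integrable_on_mult_right)
      then have "(\<lambda>t. \<Sum>i<n. c * \<bar>t - \<eta> i\<bar> powr (-1/2)) integrable_on {a..b}"
        by (intro integrable_sum) auto
      then have "integral {a..b} d = 2 * real n * integral {a..b} (\<lambda>t. \<Sum>i<n. c * \<bar>t - \<eta> i\<bar> powr (-1/2)) + 2 * (C1 * M)\<^sup>2 * (b - a)"
        unfolding d_def using ab
        by (subst integral_add) (auto intro!: integrable_on_mult_right integrable_const_ivl)
      also have "integral {a..b} (\<lambda>t. \<Sum>i<n. c * \<bar>t - \<eta> i\<bar> powr (-1/2)) =
         (\<Sum>i<n. c * integral {a..b} (\<lambda>t. \<bar>t - \<eta> i\<bar> powr (-1/2)))"
        using i by (subst integral_sum) auto
      finally show ?thesis .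
    qed
    also have "\<dots> \<le> 2 * real n * (\<Sum>i<n. c * (4 * sqrt D)) + 2 * (C1 * M)\<^sup>2 * (2 * r)"
      by (intro add_mono mult_left_mono sum_mono iv2 c ab2) auto
    also have "\<dots> = 2 * (real n)\<^sup>2 * (c * (4 * sqrt D)) + 2 * (C1 * M)\<^sup>2 * (2 * r)"
      by (simp add: power2_eq_square)
    also have "\<dots> \<le> 2 * (C1 * M)\<^sup>2 * (c * (4 * sqrt D)) + 2 * (C1 * M)\<^sup>2 * (2 * r)"
      using n c D by (intro add_mono mult_right_mono mult_left_mono power_mono) auto
    also have "\<dots> = C2 * M\<^sup>2" by (simp add: C2_def power_mult_distrib algebra_simps)
    finally have dI: "integral {a..b} d \<le> C2 * M\<^sup>2" .
    (* At the finitely many parameters eta i the majorant d fails, since powr takes 0 to 0 there. *)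
    define d' where "d' = (\<lambda>t. if t \<in> \<eta> ` {..<n} then (u t)\<^sup>2 else d t)"
    have d'int: "d' integrable_on {a..b}"
      by (rule integrable_spike_finite[OF _ _ dint, of "\<eta> ` {..<n}"]) (auto simp: d'_def)
    have d'I: "integral {a..b} d' \<le> C2 * M\<^sup>2"
      using integral_spike[of "\<eta> ` {..<n}" "{a..b}" d' d] dI by (simp add: d'_def negligible_finite)
    have ud': "(u t)\<^sup>2 \<le> d' t" if "t \<in> {a..b}" for t using ud[OF that] by (simp add: d'_def)
    have "continuous_on {a..b} (\<lambda>t. f (w + of_real t * e))"
    proof (rule continuous_on_compose2[OF holomorphic_on_imp_continuous_on[OF hol]])
      show "(\<lambda>t. w + of_real t * e) ` {a..b} \<subseteq> ball z0 R" using seg r by force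
    qed (intro continuous_intros)
    then have "(\<lambda>t. f (w + of_real t * e)) \<in> borel_measurable (lebesgue_on {a..b})"
      by (rule continuous_imp_measurable_on_sets_lebesgue) simp
    then have um: "u \<in> borel_measurable (lebesgue_on {a..b})" unfolding u_def by measurable
    have u2: "(\<lambda>t. (u t)\<^sup>2) absolutely_integrable_on {a..b}"
      by (rule measurable_bounded_by_integrable_imp_absolutely_integrable[OF _ _ d'int])
         (use um ud' in auto)
    have u2int: "(\<lambda>t. (u t)\<^sup>2) integrable_on {a..b}" using u2 by (rule set_lebesgue_integral_eq_integral)
    have u2I: "integral {a..b} (\<lambda>t. (u t)\<^sup>2) \<le> C2 * M\<^sup>2"
      using integral_le[OF u2int d'int ud'] d'I by simp
    have ule: "\<bar>u t\<bar> \<le> M + (u t)\<^sup>2 / M" for t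
    proof -
      have "0 \<le> (M - \<bar>u t\<bar>)\<^sup>2 + M * \<bar>u t\<bar>" using M by simp
      then have "\<bar>u t\<bar> * M \<le> M * M + (u t)\<^sup>2"
        unfolding power2_diff by (simp add: power2_eq_square mult_ac)
      then show ?thesis using M by (simp add: field_simps power2_eq_square)
    qed
    have bint: "(\<lambda>t. M + (u t)\<^sup>2 / M) integrable_on {a..b}"
      using u2int by (intro integrable_add integrable_const_ivl integrable_on_divide) auto
    have u1: "u absolutely_integrable_on {a..b}"
      by (rule measurable_bounded_by_integrable_imp_absolutely_integrable[OF um _ bint]) (use ule in auto)
    have "integral {a..b} (\<lambda>t. \<bar>u t\<bar>) \<le> integral {a..b} (\<lambda>t. M + (u t)\<^sup>2 / M)"
      by (intro integral_le bint absolutely_integrable_on_def[THEN iffD1, OF u1, THEN conjunct2, simplified] ule)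
    also have "\<dots> = M * (b - a) + integral {a..b} (\<lambda>t. (u t)\<^sup>2) / M"
      using u2int ab by (subst integral_add) (auto intro!: integrable_const_ivl integrable_on_divide)
    also have "\<dots> \<le> M * (2 * r) + C2 * M\<^sup>2 / M"
      using ab2 u2I M by (intro add_mono mult_left_mono divide_right_mono) auto
    also have "\<dots> = C * M" using M by (simp add: C_def power2_eq_square field_simps)
    finally have u1I: "integral {a..b} (\<lambda>t. \<bar>u t\<bar>) \<le> C * M" .
    have "C2 * M\<^sup>2 \<le> C * M\<^sup>2" using r by (intro mult_right_mono) (auto simp: C_def)
    with u2I have "integral {a..b} (\<lambda>t. (u t)\<^sup>2) \<le> C * M\<^sup>2" by simp
    with u2int u1 u1I show "(\<lambda>t. (ln (norm (f (w + of_real t * e))))\<^sup>2) integrable_on {a..b} \<and>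
     (\<lambda>t. ln (norm (f (w + of_real t * e)))) absolutely_integrable_on {a..b} \<and>
     integral {a..b} (\<lambda>t. (ln (norm (f (w + of_real t * e))))\<^sup>2) \<le> C * M\<^sup>2 \<and>
     integral {a..b} (\<lambda>t. \<bar>ln (norm (f (w + of_real t * e)))\<bar>) \<le> C * M"
      unfolding u_def by blast
  qed
qed

section \<open>Cauchy's formula on rectangles\<close>

lemma contour_integral_linepath_same_Im:
  assumes "Im z = c" "Im z' = c" "Re z = a" "Re z' = b" "a < b"
  shows   "contour_integral (linepath z z') f = integral {a..b} (\<lambda>x. f (Complex x c))"
proof -
  have zz': "z = Complex a c" "z' = Complex b c"
    using assms by (auto simp: complex_eq_iff)
  have "contour_integral (linepath z z') f =
         (z' - z) * integral {0..1} (\<lambda>x. f (linepath z z' x))"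
    by (simp add: contour_integral_integral)
  also have "z' - z = of_real (b - a)"
    by (simp add: zz' Complex_eq algebra_simps)
  also have "integral {0..1} (\<lambda>x. f (linepath z z' x)) =
             integral {0..1} (\<lambda>x. f (Complex (linepath a b x) c))"
    by (simp add: linepath_def Complex_eq scaleR_conv_of_real algebra_simps zz')
  also have "\<dots> = integral {0..(b - a) / (b - a)} (\<lambda>x. f (Complex (a + (b - a) * x) c))"
    using \<open>a < b\<close> by (simp add: algebra_simps linepath_def)
  also have "{0..(b - a) / (b - a)} = (\<lambda>x. x / (b - a)) ` {0..b - a}"
    using \<open>a < b\<close> by simp
  also have "integral \<dots> (\<lambda>x. f (Complex (a + (b - a) * x) c)) =
             integral {a-a..b-a} (\<lambda>x. f (Complex (x + a) c)) / of_real (b - a)"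
    using \<open>a < b\<close> by (subst integral_stretch_real) (auto simp: scaleR_conv_of_real add_ac)
  also have "\<dots> = integral {a..b} (\<lambda>x. f (Complex x c)) / of_real (b - a)"
    by (subst integral_shift_real_ivl) auto
  finally show ?thesis using \<open>a < b\<close> by simp
qed

lemma cauchy_formula_rectangle:
  fixes a b c d :: real and g :: "complex \<Rightarrow> complex"
  assumes U: "convex U" "open U" "g holomorphic_on U" and sub: "cbox (Complex a c) (Complex b d) \<subseteq> U"
    and z: "a < Re z" "Re z < b" "c < Im z" "Im z < d"
  shows "2 * pi * g z = integral {c..d} (\<lambda>y. g (Complex b y) / (Complex b y - z))
      - integral {c..d} (\<lambda>y. g (Complex a y) / (Complex a y - z))
      - \<i> * (integral {a..b} (\<lambda>x. g (Complex x c) / (Complex x c - z))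
          - integral {a..b} (\<lambda>x. g (Complex x d) / (Complex x d - z)))"
proof -
  define h where "h = (\<lambda>w. g w / (w - z))"
  define p q where "p = Complex a c" and "q = Complex b d"
  have zb: "z \<in> box p q" using z by (simp add: p_def q_def in_box_complex_iff)
  have pi: "path_image (rectpath p q) = cbox p q - box p q"
    using z by (intro path_image_rectpath_cbox_minus_box) (auto simp: p_def q_def)
  have zU: "z \<in> U" using zb sub box_subset_cbox unfolding p_def q_def by blast
  have hc: "(h has_contour_integral (2*pi * \<i> * winding_number (rectpath p q) z * g z)) (rectpath p q)"
    unfolding h_def
    by (rule Cauchy_integral_formula_convex_simple[OF U(1,3)])
       (use zb pi sub zU U(2) in \<open>auto simp: p_def q_def interior_open\<close>)
  then have hc: "(h has_contour_integral (2*pi * \<i> * g z)) (rectpath p q)"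
    using winding_number_rectpath[OF zb] by simp
  have conth: "continuous_on (cbox p q - box p q) h"
    unfolding h_def using U(3) sub zb
    by (intro continuous_intros holomorphic_on_imp_continuous_on holomorphic_on_subset[OF U(3)])
       (auto simp: p_def q_def)
  have seg: "closed_segment u v \<subseteq> cbox p q - box p q"
    if "(u, v) \<in> {(p, Complex b c), (Complex b c, q), (q, Complex a d), (Complex a d, p)}" for u v
    using that z unfolding pi[symmetric]
    by (auto simp: path_image_rectpath p_def q_def closed_segment_same_Re closed_segment_same_Im closed_segment_eq_real_ivl split: if_splits)
  have ci: "h contour_integrable_on linepath u v"
    if "(u, v) \<in> {(p, Complex b c), (Complex b c, q), (q, Complex a d), (Complex a d, p)}" for u v
    by (intro contour_integrable_continuous_linepath continuous_on_subset[OF conth] seg that)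
  have "2*pi * \<i> * g z = contour_integral (rectpath p q) h"
    using contour_integral_unique[OF hc] by simp
  also have "\<dots> = contour_integral (linepath p (Complex b c)) h + (contour_integral (linepath (Complex b c) q) h
      + (contour_integral (linepath q (Complex a d)) h + contour_integral (linepath (Complex a d) p) h))"
    unfolding rectpath_def Let_def using ci by (auto simp: p_def q_def)
  also have "contour_integral (linepath q (Complex a d)) h = - contour_integral (linepath (Complex a d) q) h"
    by (rule contour_integral_reverse_linepath) (use ci[of q "Complex a d"] contour_integrable_continuous_linepath continuous_on_subset[OF conth] seg[of q "Complex a d"] in \<open>auto simp: closed_segment_commute\<close>)
  also have "contour_integral (linepath (Complex a d) p) h = - contour_integral (linepath p (Complex a d)) h"
    by (rule contour_integral_reverse_linepath) (use contour_integrable_continuous_linepath continuous_on_subset[OF conth] seg[of "Complex a d" p] in \<open>auto simp: closed_segment_commute\<close>)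
  also have "contour_integral (linepath p (Complex b c)) h = integral {a..b} (\<lambda>x. h (Complex x c))"
    by (rule contour_integral_linepath_same_Im) (use z in \<open>auto simp: p_def\<close>)
  also have "contour_integral (linepath (Complex a d) q) h = integral {a..b} (\<lambda>x. h (Complex x d))"
    by (rule contour_integral_linepath_same_Im) (use z in \<open>auto simp: q_def\<close>)
  also have "contour_integral (linepath (Complex b c) q) h = \<i> * integral {c..d} (\<lambda>x. h (Complex b x))"
    by (rule contour_integral_linepath_same_Re) (use z in \<open>auto simp: q_def\<close>)
  also have "contour_integral (linepath p (Complex a d)) h = \<i> * integral {c..d} (\<lambda>x. h (Complex a x))"
    by (rule contour_integral_linepath_same_Re) (use z in \<open>auto simp: p_def\<close>)
  finally have "\<i> * (2 * pi * g z) = \<i> * (integral {c..d} (\<lambda>y. h (Complex b y))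
      - integral {c..d} (\<lambda>y. h (Complex a y))
      - \<i> * (integral {a..b} (\<lambda>x. h (Complex x c)) - integral {a..b} (\<lambda>x. h (Complex x d))))"
    by (simp add: algebra_simps)
  then show ?thesis unfolding h_def by simp
qed

lemma has_integral_unit_intervals:
  fixes g :: "real \<Rightarrow> real"
  assumes "m \<le> n" "\<And>k. g integrable_on {real_of_int k..real_of_int k + 1}"
  shows "(g has_integral (\<Sum>k\<in>{m..<n}. integral {real_of_int k..real_of_int k + 1} g)) {real_of_int m..real_of_int n}"
  using assms(1)
proof (induction n rule: int_ge_induct)
  case (step n)
  have "(g has_integral ((\<Sum>k\<in>{m..<n}. integral {real_of_int k..real_of_int k + 1} g) + integral {real_of_int n..real_of_int n + 1} g))
      {real_of_int m..real_of_int n + 1}"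
    using step assms(2) by (intro has_integral_combine[where c="real_of_int n"]) auto
  moreover have "{m..<n+1} = insert n {m..<n}" using step.hyps by auto
  ultimately show ?case by (simp add: add.commute)
qed (auto intro: has_integral_refl)

text \<open>A unit interval lies in at most \<open>2H\<close> of the windows.\<close>

lemma sum_window_integrals_le:
  fixes g :: "real \<Rightarrow> real" and H N :: nat
  assumes g: "continuous_on UNIV g" "\<And>t. g t \<ge> 0"
  shows "(\<Sum>m\<in>{-int N..<int N}. integral {real_of_int m - real H..real_of_int m + real H} g)
      \<le> 2 * real H * integral {-real (N + H)..real (N + H)} g"
proof -
  have "g integrable_on {p..q}" for p q
    using g(1) by (intro integrable_continuous_interval continuous_on_subset[OF g(1)]) auto
  note unit = integral_unique[OF has_integral_unit_intervals[OF _ this]]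
  define u where "u = (\<lambda>k. integral {real_of_int k..real_of_int k + 1} g)"
  have u: "u k \<ge> 0" for k unfolding u_def
    by (intro integral_nonneg integrable_continuous_interval continuous_on_subset[OF g(1)]) (use g in auto)
  have "integral {real_of_int m - real H..real_of_int m + real H} g = (\<Sum>j\<in>{-int H..<int H}. u (m + j))" for m
  proof -
    have "integral {real_of_int m - real H..real_of_int m + real H} g = (\<Sum>k\<in>{m - int H..<m + int H}. u k)"
      using unit[of "m - int H" "m + int H"] by (simp add: u_def)
    also have "\<dots> = (\<Sum>j\<in>{-int H..<int H}. u (m + j))"
      by (rule sum.reindex_bij_witness[of _ "\<lambda>j. m + j" "\<lambda>k. k - m"]) auto
    finally show ?thesis .
  qed
  then have "(\<Sum>m\<in>{-int N..<int N}. integral {real_of_int m - real H..real_of_int m + real H} g) =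
     (\<Sum>m\<in>{-int N..<int N}. \<Sum>j\<in>{-int H..<int H}. u (m + j))" by simp
  also have "\<dots> = (\<Sum>j\<in>{-int H..<int H}. \<Sum>m\<in>{-int N..<int N}. u (m + j))" by (rule sum.swap)
  also have "\<dots> \<le> (\<Sum>j\<in>{-int H..<int H}. integral {-real (N + H)..real (N + H)} g)"
  proof (intro sum_mono)
    fix j assume j: "j \<in> {-int H..<int H}"
    have "(\<Sum>m\<in>{-int N..<int N}. u (m + j)) = (\<Sum>k\<in>{j - int N..<j + int N}. u k)"
      by (rule sum.reindex_bij_witness[of _ "\<lambda>k. k - j" "\<lambda>m. m + j"]) auto
    also have "\<dots> \<le> (\<Sum>k\<in>{-int (N+H)..<int (N+H)}. u k)"
      using j u by (intro sum_mono2) auto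
    also have "\<dots> = integral {-real (N + H)..real (N + H)} g"
      using unit[of "-int (N+H)" "int (N+H)"] by (simp add: u_def)
    finally show "(\<Sum>m\<in>{-int N..<int N}. u (m + j)) \<le> integral {-real (N + H)..real (N + H)} g" .
  qed
  also have "\<dots> = 2 * real H * integral {-real (N + H)..real (N + H)} g" by simp
  finally show ?thesis .
qed

lemma integral_swap_le:
  fixes h :: "real \<Rightarrow> real \<Rightarrow> real"
  assumes cont: "continuous_on ({p..q} \<times> {p'..q'}) (\<lambda>x. h (fst x) (snd x))"
    and C: "C integrable_on {p..q}" "\<And>x. x \<in> {p..q} \<Longrightarrow> integral {p'..q'} (h x) \<le> C x"
  shows "(\<lambda>y. integral {p..q} (\<lambda>x. h x y)) integrable_on {p'..q'}"
    and "integral {p'..q'} (\<lambda>y. integral {p..q} (\<lambda>x. h x y)) \<le> integral {p..q} C"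
proof -
  have sw: "continuous_on ({p'..q'} \<times> {p..q}) (\<lambda>x. h (snd x) (fst x))"
  proof -
    have c: "continuous_on ({p'..q'} \<times> {p..q}) (\<lambda>x. (snd x, fst x))" by (intro continuous_intros)
    have "(\<lambda>x. (snd x, fst x)) ` ({p'..q'} \<times> {p..q}) \<subseteq> {p..q} \<times> {p'..q'}" by auto
    from continuous_on_compose2[OF cont c this] show ?thesis by simp
  qed
  have "continuous_on {p'..q'} (\<lambda>y. integral (cbox p q) (\<lambda>x. h x y))"
    by (rule integral_continuous_on_param, unfold case_prod_unfold) (use sw in simp)
  then show "(\<lambda>y. integral {p..q} (\<lambda>x. h x y)) integrable_on {p'..q'}"
    by (intro integrable_continuous_interval) simp
  have "continuous_on {p..q} (\<lambda>x. integral (cbox p' q') (h x))"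
    by (rule integral_continuous_on_param, unfold case_prod_unfold) (use cont in simp)
  then have i: "(\<lambda>x. integral {p'..q'} (h x)) integrable_on {p..q}"
    by (intro integrable_continuous_interval) simp
  have "integral (cbox p q) (\<lambda>x. integral (cbox p' q') (h x)) = integral (cbox p' q') (\<lambda>y. integral (cbox p q) (\<lambda>x. h x y))"
    by (rule integral_swap_continuous, unfold case_prod_unfold cbox_Pair_eq) (use cont in simp)
  then have "integral {p'..q'} (\<lambda>y. integral {p..q} (\<lambda>x. h x y)) = integral {p..q} (\<lambda>x. integral {p'..q'} (h x))"
    by simp
  also have "\<dots> \<le> integral {p..q} C" by (intro integral_le i C)
  finally show "integral {p'..q'} (\<lambda>y. integral {p..q} (\<lambda>x. h x y)) \<le> integral {p..q} C" .
qed

lemma half_plane_open: "open {s. Re s > 0}" and half_plane_convex: "convex {s. Re s > 0}"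
  by (auto simp: open_halfspace_Re_gt convex_halfspace_Re_gt)

text \<open>Cauchy's formula on rectangles whose horizontal sides are at distance \<open>h + v\<close> from the height \<open>y\<close>,
  averaged over \<open>1 \<le> v \<le> 2\<close>: the average turns the horizontal sides into integrals over vertical lines, which
  are the only integrals that a bound on the means over vertical lines controls.\<close>

lemma norm_le_line_integrals:
  fixes F :: "complex \<Rightarrow> complex"
  assumes hol: "F holomorphic_on {s. Re s > 0}"
    and ab: "0 < \<alpha>" "\<alpha> < \<alpha>'" "\<beta>' < \<beta>" and d: "0 < d" "d \<le> \<alpha>' - \<alpha>" "d \<le> \<beta> - \<beta>'" "d \<le> 1"
    and z: "\<alpha>' \<le> Re z" "Re z \<le> \<beta>'" "\<bar>Im z - y\<bar> \<le> h" and H: "h + 2 \<le> H"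
  defines "J \<equiv> \<lambda>x. integral {y - H..y + H} (\<lambda>t. norm (F (Complex x t)))"
  shows "2 * pi * d * norm (F z) \<le> J \<alpha> + J \<beta> + 2 * integral {\<alpha>..\<beta>} J"
proof -
  have contF: "continuous_on {s. Re s > 0} F" using hol by (rule holomorphic_on_imp_continuous_on)
  have contC: "continuous_on S (\<lambda>x. norm (F (Complex (p x) (q x))))"
    if "continuous_on S p" "continuous_on S q" "\<And>x. x \<in> S \<Longrightarrow> p x > 0" for S :: "'z::topological_space set" and p q
    by (intro continuous_on_norm continuous_on_compose2[OF contF] continuous_intros that) (use that in auto)
  have Jn: "integral {y - v'..y + v'} (\<lambda>t. norm (F (Complex x t))) \<le> J x" if "x > 0" "v' \<le> H" for x v'
    unfolding J_def using that
    by (intro integral_subset_le integrable_continuous_interval contC continuous_intros) auto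
  have contJ: "continuous_on {\<alpha>..\<beta>} J"
  proof -
    have "continuous_on {\<alpha>..\<beta>} (\<lambda>x. integral (cbox (y - H) (y + H)) (\<lambda>t. norm (F (Complex x t))))"
      by (rule integral_continuous_on_param, unfold case_prod_unfold, rule contC) (use ab in \<open>auto intro!: continuous_intros\<close>)
    then show ?thesis by (simp add: J_def)
  qed
  have \<alpha>\<beta>: "\<alpha> \<le> \<beta>" using ab z by linarith
  define P where "P = (\<lambda>v. integral {\<alpha>..\<beta>} (\<lambda>x. norm (F (Complex x (y - h - v)))))"
  define Q where "Q = (\<lambda>v. integral {\<alpha>..\<beta>} (\<lambda>x. norm (F (Complex x (y + h + v)))))"
  have contP: "continuous_on {1..2} P" "continuous_on {1..2} Q"
  proof -
    have "continuous_on {1..2} (\<lambda>v. integral (cbox \<alpha> \<beta>) (\<lambda>x. norm (F (Complex x (y - h - v)))))"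
      by (rule integral_continuous_on_param, unfold case_prod_unfold, rule contC) (use ab in \<open>auto intro!: continuous_intros\<close>)
    moreover have "continuous_on {1..2} (\<lambda>v. integral (cbox \<alpha> \<beta>) (\<lambda>x. norm (F (Complex x (y + h + v)))))"
      by (rule integral_continuous_on_param, unfold case_prod_unfold, rule contC) (use ab in \<open>auto intro!: continuous_intros\<close>)
    ultimately show "continuous_on {1..2} P" "continuous_on {1..2} Q" by (auto simp: P_def Q_def)
  qed
  have key: "2 * pi * d * norm (F z) \<le> J \<alpha> + J \<beta> + P v + Q v" if v: "v \<in> {1..2}" for v
  proof -
    let ?c = "y - h - v" and ?d = "y + h + v"
    have edge: "norm (integral {s\<^sub>1..s\<^sub>2} (\<lambda>t. F (w t) / (w t - z))) \<le> integral {s\<^sub>1..s\<^sub>2} (\<lambda>t. norm (F (w t))) / d"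
      if "\<And>t. t \<in> {s\<^sub>1..s\<^sub>2} \<Longrightarrow> norm (w t - z) \<ge> d" "\<And>t. t \<in> {s\<^sub>1..s\<^sub>2} \<Longrightarrow> Re (w t) > 0"
        "continuous_on {s\<^sub>1..s\<^sub>2} w" for s\<^sub>1 s\<^sub>2 :: real and w :: "real \<Rightarrow> complex"
    proof -
      have nz: "w t - z \<noteq> 0" if "t \<in> {s\<^sub>1..s\<^sub>2}" for t using \<open>\<And>t. t \<in> {s\<^sub>1..s\<^sub>2} \<Longrightarrow> norm (w t - z) \<ge> d\<close>[OF that] d by auto
      have c1: "continuous_on {s\<^sub>1..s\<^sub>2} (\<lambda>t. F (w t))"
        by (rule continuous_on_compose2[OF contF that(3)]) (use that in auto)
      have "norm (integral {s\<^sub>1..s\<^sub>2} (\<lambda>t. F (w t) / (w t - z))) \<le> integral {s\<^sub>1..s\<^sub>2} (\<lambda>t. norm (F (w t)) / d)"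
      proof (rule integral_norm_bound_integral)
        show "(\<lambda>t. F (w t) / (w t - z)) integrable_on {s\<^sub>1..s\<^sub>2}"
          using c1 nz that(3) by (intro integrable_continuous_interval continuous_intros) auto
        show "(\<lambda>t. norm (F (w t)) / d) integrable_on {s\<^sub>1..s\<^sub>2}"
          using c1 d by (intro integrable_continuous_interval continuous_intros) auto
        show "norm (F (w t) / (w t - z)) \<le> norm (F (w t)) / d" if "t \<in> {s\<^sub>1..s\<^sub>2}" for t
          using \<open>\<And>t. t \<in> {s\<^sub>1..s\<^sub>2} \<Longrightarrow> norm (w t - z) \<ge> d\<close>[OF that] d
          by (auto simp: norm_divide intro!: frac_le)
      qed
      then show ?thesis by simp
    qed
    have "2 * pi * F z = integral {?c..?d} (\<lambda>t. F (Complex \<beta> t) / (Complex \<beta> t - z))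
      - integral {?c..?d} (\<lambda>t. F (Complex \<alpha> t) / (Complex \<alpha> t - z))
      - \<i> * (integral {\<alpha>..\<beta>} (\<lambda>x. F (Complex x ?c) / (Complex x ?c - z))
          - integral {\<alpha>..\<beta>} (\<lambda>x. F (Complex x ?d) / (Complex x ?d - z)))" (is "_ = ?R - ?L - \<i> * (?B - ?T)")
      by (rule cauchy_formula_rectangle[OF half_plane_convex half_plane_open hol])
         (use ab z v d in \<open>auto simp: in_cbox_complex_iff\<close>)
    then have "2 * pi * norm (F z) = norm (?R - ?L - \<i> * (?B - ?T))"
      by (metis norm_mult norm_of_real abs_of_nonneg pi_ge_zero mult_nonneg_nonneg zero_le_numeral)
    also have "\<dots> \<le> norm ?R + norm ?L + (norm ?B + norm ?T)"
      using norm_triangle_ineq4[of "?R - ?L" "\<i> * (?B - ?T)"] norm_triangle_ineq4[of ?R ?L] norm_triangle_ineq4[of ?B ?T]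
      unfolding norm_mult norm_ii mult_1 by linarith
    finally have "2 * pi * norm (F z) \<le> norm ?R + norm ?L + (norm ?B + norm ?T)" .
    moreover have "norm ?R \<le> integral {?c..?d} (\<lambda>t. norm (F (Complex \<beta> t))) / d"
    proof (rule edge[of _ _ "\<lambda>t. Complex \<beta> t"])
      show "d \<le> norm (Complex \<beta> t - z)" for t
        using abs_Re_le_cmod[of "Complex \<beta> t - z"] z d by auto
    qed (use ab z in \<open>auto intro!: continuous_intros\<close>)
    moreover have "norm ?L \<le> integral {?c..?d} (\<lambda>t. norm (F (Complex \<alpha> t))) / d"
    proof (rule edge[of _ _ "\<lambda>t. Complex \<alpha> t"])
      show "d \<le> norm (Complex \<alpha> t - z)" for t
        using abs_Re_le_cmod[of "Complex \<alpha> t - z"] z d by auto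
    qed (use ab z in \<open>auto intro!: continuous_intros\<close>)
    moreover have "norm ?B \<le> P v / d" unfolding P_def
    proof (rule edge[of _ _ "\<lambda>x. Complex x ?c"])
      show "d \<le> norm (Complex x ?c - z)" for x
        using abs_Im_le_cmod[of "Complex x ?c - z"] z d v by auto
    qed (use ab z in \<open>auto intro!: continuous_intros\<close>)
    moreover have "norm ?T \<le> Q v / d" unfolding Q_def
    proof (rule edge[of _ _ "\<lambda>x. Complex x ?d"])
      show "d \<le> norm (Complex x ?d - z)" for x
        using abs_Im_le_cmod[of "Complex x ?d - z"] z d v by auto
    qed (use ab z in \<open>auto intro!: continuous_intros\<close>)
    ultimately have "2 * pi * norm (F z) \<le> integral {?c..?d} (\<lambda>t. norm (F (Complex \<beta> t))) / d +
      integral {?c..?d} (\<lambda>t. norm (F (Complex \<alpha> t))) / d + (P v / d + Q v / d)" by linarith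
    then have "2 * pi * norm (F z) * d \<le> integral {?c..?d} (\<lambda>t. norm (F (Complex \<beta> t))) +
      integral {?c..?d} (\<lambda>t. norm (F (Complex \<alpha> t))) + (P v + Q v)"
      using d by (simp add: add_divide_distrib[symmetric] pos_le_divide_eq add.assoc)
    moreover have "integral {?c..?d} (\<lambda>t. norm (F (Complex \<beta> t))) \<le> J \<beta>" "integral {?c..?d} (\<lambda>t. norm (F (Complex \<alpha> t))) \<le> J \<alpha>"
      using Jn[of \<beta> "h + v"] Jn[of \<alpha> "h + v"] H v ab \<alpha>\<beta> by (auto simp: algebra_simps)
    ultimately show ?thesis by (simp add: mult_ac)
  qed
  have PJ: "integral {1..2} P \<le> integral {\<alpha>..\<beta>} J" "integral {1..2} Q \<le> integral {\<alpha>..\<beta>} J"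
  proof -
    have shift: "integral {1..2} (\<lambda>v. norm (F (Complex x (y - h - v)))) \<le> J x" 
         "integral {1..2} (\<lambda>v. norm (F (Complex x (y + h + v)))) \<le> J x" if "x > 0" for x
    proof -
      let ?g = "\<lambda>t. norm (F (Complex x t))"
      have gi: "?g integrable_on {p..q}" for p q
        using that by (intro integrable_continuous_interval contC continuous_intros) auto
      have i1: "((\<lambda>v. ?g (v + (y + h))) has_integral integral {y+h+1..y+h+2} ?g) {1..2}"
        using has_integral_shift_real_ivl[OF integrable_integral[OF gi[of "y+h+1" "y+h+2"]], of "y + h"] by simp
      have "((\<lambda>v. ?g (v + (y - h))) has_integral integral {y-h-2..y-h-1} ?g) {-2..-1}"
        using has_integral_shift_real_ivl[OF integrable_integral[OF gi[of "y-h-2" "y-h-1"]], of "y - h"] by simp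
      from has_integral_reflect_lemma_real[OF this]
      have i2: "((\<lambda>v. ?g (y - h - v)) has_integral integral {y-h-2..y-h-1} ?g) {1..2}" by simp
      have "integral {y+h+1..y+h+2} ?g \<le> J x" "integral {y-h-2..y-h-1} ?g \<le> J x"
        unfolding J_def using H z by (intro integral_subset_le gi; force)+
      moreover have "integral {1..2} (\<lambda>v. ?g (y + h + v)) = integral {y+h+1..y+h+2} ?g"
        using integral_unique[OF i1] by (simp only: add.commute[of _ "y + h"])
      ultimately show "integral {1..2} (\<lambda>v. ?g (y - h - v)) \<le> J x" "integral {1..2} (\<lambda>v. ?g (y + h + v)) \<le> J x"
        using integral_unique[OF i2] by simp_all
    qed
    have Ji: "J integrable_on {\<alpha>..\<beta>}" by (rule integrable_continuous_interval[OF contJ])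
    have cq: "continuous_on ({\<alpha>..\<beta>} \<times> {1..2}) (\<lambda>x. norm (F (Complex (fst x) (q (snd x)))))"
      if "continuous_on UNIV q" for q :: "real \<Rightarrow> real"
      by (rule contC) (use ab in \<open>auto intro!: continuous_intros continuous_on_compose2[OF that]\<close>)
    show "integral {1..2} P \<le> integral {\<alpha>..\<beta>} J" unfolding P_def
      by (rule integral_swap_le(2)[OF cq Ji shift(1)]) (use ab in \<open>auto intro!: continuous_intros\<close>)
    show "integral {1..2} Q \<le> integral {\<alpha>..\<beta>} J" unfolding Q_def
      by (rule integral_swap_le(2)[OF cq Ji shift(2)]) (use ab in \<open>auto intro!: continuous_intros\<close>)
  qed
  have "integral {1..2::real} (\<lambda>_. 2 * pi * d * norm (F z)) \<le> integral {1..2} (\<lambda>v. J \<alpha> + J \<beta> + P v + Q v)"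
    using contP key by (intro integral_le integrable_continuous_interval continuous_intros) auto
  also have "\<dots> = J \<alpha> + J \<beta> + integral {1..2} P + integral {1..2} Q"
  proof -
    have i: "P integrable_on {1..2}" "Q integrable_on {1..2}"
      using contP by (auto intro: integrable_continuous_interval)
    have "integral {1..2} (\<lambda>v. J \<alpha> + J \<beta> + P v + Q v) = integral {1..2} (\<lambda>v. J \<alpha> + J \<beta> + P v) + integral {1..2} Q"
      by (intro integral_add integrable_add integrable_const_ivl i)
    also have "integral {1..2} (\<lambda>v. J \<alpha> + J \<beta> + P v) = integral {1..2::real} (\<lambda>v. J \<alpha> + J \<beta>) + integral {1..2} P"
      by (intro integral_add integrable_const_ivl i)
    finally show ?thesis by simp
  qed
  finally show ?thesis using PJ by simp
qed

section \<open>Functions with bounded means in a half-plane\<close>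

text \<open>What is used of \<open>f / a\<^sub>1\<close>. The rate \<open>(Re s)\<^sup>-\<^sup>3\<close> in \<open>decay\<close> makes \<open>(x - \<sigma>) ln \<bar>F\<bar>\<close> integrable up to \<open>x = \<infinity>\<close>; it
  suffices in place of the true exponential decay.\<close>

locale normalised_dirichlet_function =
  fixes F :: "complex \<Rightarrow> complex" and B A X :: real and b :: "nat \<Rightarrow> complex"
  assumes hol: "F holomorphic_on {s. Re s > 0}"
    and mean_bound: "\<And>\<sigma> T. \<sigma> > 0 \<Longrightarrow> T \<ge> 1 \<Longrightarrow> integral {-T..T} (\<lambda>t. norm (F (Complex \<sigma> t))) \<le> B * T"
    and X: "X \<ge> 1"
    and decay: "\<And>s. Re s \<ge> X \<Longrightarrow> norm (F s - 1) \<le> A / Re s ^ 3"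
    and near_one: "\<And>s. Re s \<ge> X \<Longrightarrow> norm (F s - 1) \<le> 1 / 2"
    and uniform: "\<And>c. c \<ge> X \<Longrightarrow> uniform_limit UNIV
        (\<lambda>N t. \<Sum>n<N. b n * exp (- Complex c t * ln (real (Suc n)))) (\<lambda>t. F (Complex c t)) sequentially"
begin

lemma contF: "continuous_on {s. Re s > 0} F"
  using hol by (rule holomorphic_on_imp_continuous_on)

lemma contF_compose:
  fixes w :: "'z::topological_space \<Rightarrow> complex"
  assumes "continuous_on S w" "\<And>x. x \<in> S \<Longrightarrow> Re (w x) > 0"
  shows "continuous_on S (\<lambda>x. F (w x))"
  by (rule continuous_on_compose2[OF contF assms(1)]) (use assms(2) in auto)

lemma line_integrable: "\<sigma> > 0 \<Longrightarrow> (\<lambda>t. norm (F (Complex \<sigma> t))) integrable_on {p..q}"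
  by (intro integrable_continuous_interval continuous_intros contF_compose) auto

lemma B_nonneg: "B \<ge> 0"
proof -
  have "0 \<le> integral {-1..1} (\<lambda>t. norm (F (Complex 1 t)))"
    by (intro integral_nonneg line_integrable) auto
  then show ?thesis using mean_bound[of 1 1] by simp
qed

lemma nonzero_right: "Re s \<ge> X \<Longrightarrow> F s \<noteq> 0"
  and norm_ge_half: "Re s \<ge> X \<Longrightarrow> norm (F s) \<ge> 1 / 2"
proof -
  assume "Re s \<ge> X"
  from near_one[OF this] show "norm (F s) \<ge> 1 / 2"
    using norm_triangle_ineq2[of 1 "1 - F s"] by (simp add: norm_minus_commute)
  then show "F s \<noteq> 0" by auto
qed

text \<open>The discs are centred at \<open>X1 + iy\<close>, where \<open>\<bar>F\<bar> \<ge> 1/2\<close>. Their radii \<open>X1 - 3\<kappa>/4\<close> and \<open>X1 - \<kappa>/2\<close> keep them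
  inside \<open>Re s > \<kappa>/2\<close>, and the condition \<open>X1 \<ge> 2/\<kappa> + \<kappa>\<close> makes the smaller disc cover all points of the strip
  within vertical distance \<open>1\<close> of the centre.\<close>

lemma strip_log_bound:
  assumes \<kappa>: "\<kappa> > 0" and X1: "X1 \<ge> X" "X1 \<ge> 2 / \<kappa> + \<kappa>"
  shows "\<exists>C>0. \<exists>M. (\<forall>y. 1 \<le> M y \<and> M y \<le> C * ln (3 + \<bar>y\<bar>)) \<and>
     (\<forall>N::nat. N \<ge> 1 \<longrightarrow> (\<Sum>m\<in>{-int N..<int N}. (M (real_of_int m))\<^sup>2) \<le> C * real N) \<and>
     (\<forall>y w e p q. norm e = 1 \<longrightarrow> p \<le> q \<longrightarrow>
        (\<forall>t\<in>{p..q}. \<kappa> \<le> Re (w + of_real t * e) \<and> Re (w + of_real t * e) \<le> X1 \<and> \<bar>Im (w + of_real t * e) - y\<bar> \<le> 1) \<longrightarrow>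
     (\<lambda>t. (ln (norm (F (w + of_real t * e))))\<^sup>2) integrable_on {p..q} \<and>
     (\<lambda>t. ln (norm (F (w + of_real t * e)))) absolutely_integrable_on {p..q} \<and>
     integral {p..q} (\<lambda>t. (ln (norm (F (w + of_real t * e))))\<^sup>2) \<le> C * (M y)\<^sup>2 \<and>
     integral {p..q} (\<lambda>t. \<bar>ln (norm (F (w + of_real t * e)))\<bar>) \<le> C * M y)"
proof -
  have X1p: "X1 \<ge> 1" using X X1 by simp
  have k1: "X1 > \<kappa>" using X1(2) \<kappa> by (smt (verit) divide_pos_pos)
  define r R where "r = X1 - 3 * \<kappa> / 4" and "R = X1 - \<kappa> / 2"
  have r: "0 < r" "r < R" using k1 \<kappa> by (auto simp: r_def R_def)
  have rk: "(X1 - \<kappa>)\<^sup>2 + 1 \<le> r\<^sup>2"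
  proof -
    have "\<kappa> * X1 \<ge> \<kappa> * (2 / \<kappa> + \<kappa>)" using X1 \<kappa> by (intro mult_left_mono) auto
    also have "\<kappa> * (2 / \<kappa> + \<kappa>) = 2 + \<kappa>\<^sup>2" using \<kappa> by (simp add: field_simps power2_eq_square)
    finally have "\<kappa> * X1 \<ge> 2 + \<kappa>\<^sup>2" .
    moreover have "r\<^sup>2 - (X1 - \<kappa>)\<^sup>2 = \<kappa> * X1 / 2 - 7 / 16 * \<kappa>\<^sup>2"
      by (simp add: r_def power2_eq_square algebra_simps)
    moreover have "\<kappa>\<^sup>2 \<ge> 0" by simp
    ultimately show ?thesis by linarith
  qed
  obtain C0 where C0: "C0 > 0" and seg: "\<And>f z0 M w e p q. 1 \<le> M \<Longrightarrow> f holomorphic_on ball z0 R \<Longrightarrow>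
     (\<forall>z\<in>ball z0 R. norm (f z) \<le> exp M) \<Longrightarrow> exp (- M) \<le> norm (f z0) \<Longrightarrow>
     norm e = 1 \<Longrightarrow> p \<le> q \<Longrightarrow> (\<forall>t\<in>{p..q}. w + of_real t * e \<in> cball z0 r) \<Longrightarrow>
     (\<lambda>t. (ln (norm (f (w + of_real t * e))))\<^sup>2) integrable_on {p..q} \<and>
     (\<lambda>t. ln (norm (f (w + of_real t * e)))) absolutely_integrable_on {p..q} \<and>
     integral {p..q} (\<lambda>t. (ln (norm (f (w + of_real t * e))))\<^sup>2) \<le> C0 * M\<^sup>2 \<and>
     integral {p..q} (\<lambda>t. \<bar>ln (norm (f (w + of_real t * e)))\<bar>) \<le> C0 * M"
    using log_modulus_segment_bound[OF r] by blast
  define H where "H = nat \<lceil>X1\<rceil> + 2"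
  have H: "X1 + 2 \<le> real H" "H \<ge> 1" unfolding H_def by linarith+
  define \<alpha> \<beta> d where "\<alpha> = \<kappa> / 4" and "\<beta> = 3 * X1" and "d = min (\<kappa> / 4) 1"
  have ab: "0 < \<alpha>" "\<alpha> < \<beta>" using \<kappa> k1 by (auto simp: \<alpha>_def \<beta>_def)
  have d: "d > 0" using \<kappa> by (simp add: d_def)
  define J where "J = (\<lambda>y x. integral {y - real H..y + real H} (\<lambda>t. norm (F (Complex x t))))"
  define S where "S = (\<lambda>y. J y \<alpha> + J y \<beta> + 2 * integral {\<alpha>..\<beta>} (J y))"
  have contJ: "continuous_on {\<alpha>..\<beta>} (J y)" for y
  proof -
    have "continuous_on {\<alpha>..\<beta>} (\<lambda>x. integral (cbox (y - real H) (y + real H)) (\<lambda>t. norm (F (Complex x t))))"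
      by (rule integral_continuous_on_param, unfold case_prod_unfold, rule continuous_on_norm, rule contF_compose)
         (use ab in \<open>auto intro!: continuous_intros\<close>)
    then show ?thesis by (simp add: J_def)
  qed
  have Ji: "J y integrable_on {\<alpha>..\<beta>}" for y using contJ by (rule integrable_continuous_interval)
  have J0: "J y x \<ge> 0" if "x > 0" for x y unfolding J_def using that by (intro integral_nonneg line_integrable) auto
  have Jgrow: "J y x \<le> B * (\<bar>y\<bar> + real H)" if "x > 0" for x y
  proof -
    have "J y x \<le> integral {-(\<bar>y\<bar> + real H)..\<bar>y\<bar> + real H} (\<lambda>t. norm (F (Complex x t)))"
      unfolding J_def using that by (intro integral_subset_le line_integrable) auto
    also have "\<dots> \<le> B * (\<bar>y\<bar> + real H)" using H that X1p by (intro mean_bound) auto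
    finally show ?thesis .
  qed
  have Jsum: "(\<Sum>m\<in>{-int N..<int N}. J (real_of_int m) x) \<le> 2 * real H * (B * (real N + real H))"
    if x: "x > 0" for x N
  proof -
    have "(\<Sum>m\<in>{-int N..<int N}. J (real_of_int m) x) \<le> 2 * real H * integral {-real (N + H)..real (N + H)} (\<lambda>t. norm (F (Complex x t)))"
      unfolding J_def using x by (intro sum_window_integrals_le continuous_intros contF_compose) auto
    also have "\<dots> \<le> 2 * real H * (B * real (N + H))"
      using x H by (intro mult_left_mono mean_bound) auto
    finally show ?thesis by simp
  qed
  define K where "K = 2 + 2 * (\<beta> - \<alpha>)"
  have K: "K > 0" using ab by (simp add: K_def)
  have S0: "S y \<ge> 0" for y unfolding S_def using ab by (intro add_nonneg_nonneg mult_nonneg_nonneg integral_nonneg Ji J0) auto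
  have Sgrow: "S y \<le> K * (B * (\<bar>y\<bar> + real H))" for y
  proof -
    have "integral {\<alpha>..\<beta>} (J y) \<le> integral {\<alpha>..\<beta>} (\<lambda>_. B * (\<bar>y\<bar> + real H))"
      using ab by (intro integral_le Ji Jgrow) auto
    then show ?thesis using Jgrow[of \<alpha> y] Jgrow[of \<beta> y] ab by (simp add: S_def K_def algebra_simps)
  qed
  have Ssum: "(\<Sum>m\<in>{-int N..<int N}. S (real_of_int m)) \<le> K * (2 * real H * (B * (real N + real H)))" for N
  proof -
    let ?I = "{-int N..<int N}" and ?R = "2 * real H * (B * (real N + real H))"
    have "(\<Sum>m\<in>?I. integral {\<alpha>..\<beta>} (J (real_of_int m))) = integral {\<alpha>..\<beta>} (\<lambda>x. \<Sum>m\<in>?I. J (real_of_int m) x)"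
      by (intro integral_sum[symmetric] Ji) auto
    also have "\<dots> \<le> integral {\<alpha>..\<beta>} (\<lambda>_. ?R)"
      using ab by (intro integral_le integrable_sum Ji Jsum) auto
    also have "\<dots> = (\<beta> - \<alpha>) * ?R" using ab by (simp add: algebra_simps)
    finally show ?thesis using Jsum[of \<alpha> N] Jsum[of \<beta> N] ab
      by (simp add: S_def K_def sum.distrib sum_distrib_left[symmetric] algebra_simps)
  qed
  define c where "c = 1 / (2 * pi * d)"
  have c: "c > 0" using d by (simp add: c_def)
  have supF: "norm (F z) \<le> c * S y" if "\<kappa> / 2 \<le> Re z" "Re z \<le> 2 * X1" "\<bar>Im z - y\<bar> \<le> X1" for z y
  proof -
    have "2 * pi * d * norm (F z) \<le> S y"
      unfolding S_def J_def
      by (rule norm_le_line_integrals[OF hol, where \<alpha>' = "\<kappa> / 2" and \<beta>' = "2 * X1" and h = X1])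
         (use \<kappa> X1p H d that in \<open>auto simp: \<alpha>_def \<beta>_def d_def min_def\<close>)
    then show ?thesis using d by (simp add: c_def field_simps)
  qed
  (* the summand exp 1 makes M at least 1 and exp (-M) at most 1/2 *)
  define M where "M = (\<lambda>y. ln (exp 1 + c * S y))"
  have arg: "exp 1 + c * S y \<ge> exp 1" for y using c S0[of y] by simp
  have arg0: "exp 1 + c * S y > 0" for y using arg[of y] by (rule less_le_trans[OF exp_gt_zero])
  have M1: "M y \<ge> 1" for y unfolding M_def using arg[of y] arg0[of y] by (subst ln_ge_iff) auto
  have expM: "exp (M y) = exp 1 + c * S y" for y unfolding M_def
    using arg0[of y] by (intro exp_ln)
  have M2: "(M y)\<^sup>2 \<le> 4 * (exp 1 + c * S y)" for y
  proof -
    note p = arg0[of y]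
    have "M y = 2 * ln (sqrt (exp 1 + c * S y))" using p by (simp add: M_def ln_sqrt)
    also have "\<dots> \<le> 2 * sqrt (exp 1 + c * S y)" using p ln_bound[of "sqrt (exp 1 + c * S y)"] by simp
    finally have "(M y)\<^sup>2 \<le> (2 * sqrt (exp 1 + c * S y))\<^sup>2" using M1[of y] by (intro power_mono) auto
    then show ?thesis using p by (simp add: power_mult_distrib)
  qed
  define C1 where "C1 = exp 1 + c * K * B * real H + c * K * B"
  have C1e: "C1 \<ge> exp 1" using c K B_nonneg by (simp add: C1_def)
  then have C11: "C1 > 1" by (smt (verit) exp_gt_one)
  have Mgrow: "M y \<le> (1 + ln C1) * ln (3 + \<bar>y\<bar>)" for y
  proof -
    have "exp 1 + c * S y \<le> exp 1 + c * (K * (B * (\<bar>y\<bar> + real H)))"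
      using Sgrow[of y] c by simp
    also have "\<dots> = (exp 1 + c * K * B * real H) * 1 + c * K * B * \<bar>y\<bar>" by (simp add: algebra_simps)
    also have "\<dots> \<le> C1 * 1 + C1 * \<bar>y\<bar>"
    proof (intro add_mono mult_right_mono)
      have "0 \<le> c * K * B * real H" "0 \<le> c * K * B" using c K B_nonneg by auto
      then show "exp 1 + c * K * B * real H \<le> C1" "c * K * B \<le> C1" by (simp_all add: C1_def add_nonneg_nonneg)
    qed auto
    also have "\<dots> \<le> C1 * (3 + \<bar>y\<bar>)" using C11 by (simp add: algebra_simps)
    finally have "M y \<le> ln (C1 * (3 + \<bar>y\<bar>))"
      unfolding M_def using arg0[of y] by (intro ln_mono) auto
    also have "\<dots> = ln C1 * 1 + ln (3 + \<bar>y\<bar>)" using C11 by (subst ln_mult) auto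
    also have "\<dots> \<le> ln C1 * ln (3 + \<bar>y\<bar>) + ln (3 + \<bar>y\<bar>)"
    proof (intro add_mono mult_left_mono order_refl)
      have "exp (1::real) \<le> 3" by (rule exp_le)
      then have "exp 1 \<le> 3 + \<bar>y\<bar>" by simp
      then show "1 \<le> ln (3 + \<bar>y\<bar>)" by (subst ln_ge_iff) auto
    qed (use C11 in auto)
    finally show ?thesis by (simp add: algebra_simps)
  qed
  define C2 where "C2 = 8 * exp 1 + 4 * c * K * 2 * real H * B * (1 + real H)"
  have C2: "C2 \<ge> 0" using c K B_nonneg by (simp add: C2_def)
  have Msum: "(\<Sum>m\<in>{-int N..<int N}. (M (real_of_int m))\<^sup>2) \<le> C2 * real N" if N: "N \<ge> 1" for N
  proof -
    have "(\<Sum>m\<in>{-int N..<int N}. (M (real_of_int m))\<^sup>2) \<le> (\<Sum>m\<in>{-int N..<int N}. 4 * exp 1 + 4 * c * S (real_of_int m))"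
      by (intro sum_mono order_trans[OF M2]) (simp add: algebra_simps)
    also have "\<dots> = 8 * exp 1 * real N + 4 * c * (\<Sum>m\<in>{-int N..<int N}. S (real_of_int m))"
      by (simp add: sum.distrib sum_distrib_left)
    also have "\<dots> \<le> 8 * exp 1 * real N + 4 * c * (K * (2 * real H * (B * (real N + real H))))"
      using c by (intro add_mono order_refl mult_left_mono Ssum) auto
    also have "\<dots> \<le> 8 * exp 1 * real N + 4 * c * (K * (2 * real H * (B * (real N + real N * real H))))"
    proof -
      have "real H \<le> real N * real H" using N mult_right_mono[of 1 "real N" "real H"] by simp
      then show ?thesis using c K B_nonneg by (intro add_mono mult_left_mono order_refl) auto
    qed
    also have "\<dots> = C2 * real N" by (simp add: C2_def algebra_simps)
    finally show ?thesis .
  qed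
  define C where "C = C0 + (1 + ln C1) + C2"
  have C: "C > 0" "C0 \<le> C" "1 + ln C1 \<le> C" "C2 \<le> C" using C0 C11 C2 by (auto simp: C_def add_pos_nonneg)
  show ?thesis
  proof (intro exI[of _ C] conjI exI[of _ M] allI impI C(1) M1)
    fix y
    have "M y \<le> (1 + ln C1) * ln (3 + \<bar>y\<bar>)" by (rule Mgrow)
    also have "\<dots> \<le> C * ln (3 + \<bar>y\<bar>)" using C by (intro mult_right_mono) auto
    finally show "M y \<le> C * ln (3 + \<bar>y\<bar>)" .
  next
    fix N :: nat assume "N \<ge> 1"
    then have "(\<Sum>m\<in>{-int N..<int N}. (M (real_of_int m))\<^sup>2) \<le> C2 * real N" by (rule Msum)
    also have "\<dots> \<le> C * real N" using C by (intro mult_right_mono) auto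
    finally show "(\<Sum>m\<in>{-int N..<int N}. (M (real_of_int m))\<^sup>2) \<le> C * real N" .
  next
    fix y w e p q assume e: "norm e = 1" and pq: "p \<le> q"
      and w: "\<forall>t\<in>{p..q}. \<kappa> \<le> Re (w + of_real t * e) \<and> Re (w + of_real t * e) \<le> X1 \<and> \<bar>Im (w + of_real t * e) - y\<bar> \<le> 1"
    define z0 where "z0 = Complex X1 y"
    have inb: "\<kappa> / 2 \<le> Re z \<and> Re z \<le> 2 * X1 \<and> \<bar>Im z - y\<bar> \<le> X1" if "z \<in> ball z0 R" for z
    proof -
      have "norm (z - z0) < R" using that by (simp add: dist_norm norm_minus_commute)
      then have "\<bar>Re z - X1\<bar> < R" "\<bar>Im z - y\<bar> < R"
        using abs_Re_le_cmod[of "z - z0"] abs_Im_le_cmod[of "z - z0"] by (auto simp: z0_def)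
      then show ?thesis using \<kappa> by (auto simp: R_def)
    qed
    have "(\<lambda>t. (ln (norm (F (w + of_real t * e))))\<^sup>2) integrable_on {p..q} \<and>
     (\<lambda>t. ln (norm (F (w + of_real t * e)))) absolutely_integrable_on {p..q} \<and>
     integral {p..q} (\<lambda>t. (ln (norm (F (w + of_real t * e))))\<^sup>2) \<le> C0 * (M y)\<^sup>2 \<and>
     integral {p..q} (\<lambda>t. \<bar>ln (norm (F (w + of_real t * e)))\<bar>) \<le> C0 * M y"
    proof (rule seg[of "M y" F z0, OF M1 _ _ _ e pq])
      show "F holomorphic_on ball z0 R" using inb \<kappa> by (intro holomorphic_on_subset[OF hol]) force
      show "\<forall>z\<in>ball z0 R. norm (F z) \<le> exp (M y)"
      proof
        fix z assume "z \<in> ball z0 R"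
        then have "norm (F z) \<le> c * S y" using inb supF by blast
        then show "norm (F z) \<le> exp (M y)" unfolding expM by (smt (verit) exp_gt_zero)
      qed
      have "exp (- M y) \<le> exp (-1)" using M1[of y] by simp
      also have "exp (-1) \<le> (1 / 2 :: real)"
        using exp_ge_add_one_self[of "1::real"] by (simp add: exp_minus field_simps)
      also have "\<dots> \<le> norm (F z0)" using X1 by (intro norm_ge_half) (simp add: z0_def)
      finally show "exp (- M y) \<le> norm (F z0)" .
      show "\<forall>t\<in>{p..q}. w + of_real t * e \<in> cball z0 r"
      proof
        fix t assume "t \<in> {p..q}"
        then have t: "\<kappa> \<le> Re (w + of_real t * e)" "Re (w + of_real t * e) \<le> X1" "\<bar>Im (w + of_real t * e) - y\<bar> \<le> 1"
          using w by blast+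
        let ?s = "w + of_real t * e"
        have "(norm (?s - z0))\<^sup>2 = (Re ?s - X1)\<^sup>2 + (Im ?s - y)\<^sup>2" unfolding cmod_power2 by (simp add: z0_def)
        also have "\<dots> \<le> (X1 - \<kappa>)\<^sup>2 + 1\<^sup>2"
          using t by (intro add_mono abs_le_square_iff[THEN iffD1]) auto
        also have "\<dots> \<le> r\<^sup>2" using rk by simp
        finally have "norm (?s - z0) \<le> r" by (rule power2_le_imp_le) (use r in simp)
        then show "?s \<in> cball z0 r" by (simp add: dist_norm norm_minus_commute)
      qed
    qed
    moreover have "C0 * (M y)\<^sup>2 \<le> C * (M y)\<^sup>2" "C0 * M y \<le> C * M y"
      using C M1[of y] by (auto intro!: mult_right_mono)
    ultimately show "(\<lambda>t. (ln (norm (F (w + of_real t * e))))\<^sup>2) integrable_on {p..q}"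
     "(\<lambda>t. ln (norm (F (w + of_real t * e)))) absolutely_integrable_on {p..q}"
     "integral {p..q} (\<lambda>t. (ln (norm (F (w + of_real t * e))))\<^sup>2) \<le> C * (M y)\<^sup>2"
     "integral {p..q} (\<lambda>t. \<bar>ln (norm (F (w + of_real t * e)))\<bar>) \<le> C * M y"
      by auto
  qed
qed

end

section \<open>Trigonometric polynomials and their means\<close>

inductive trig_poly :: "(real \<Rightarrow> complex) \<Rightarrow> bool" where
  exp: "trig_poly (\<lambda>t. c * exp (\<i> * of_real (l * t)))"
| add: "trig_poly P \<Longrightarrow> trig_poly Q \<Longrightarrow> trig_poly (\<lambda>t. P t + Q t)"

lemma trig_poly_const: "trig_poly (\<lambda>_. c)"
  using trig_poly.exp[of c 0] by simp

lemma trig_poly_mult: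
  assumes "trig_poly P" "trig_poly Q"
  shows "trig_poly (\<lambda>t. P t * Q t)"
  using assms
proof (induction P)
  case (exp c l)
  from exp show ?case
  proof (induction Q)
    case (exp d m)
    have "trig_poly (\<lambda>t. (c * d) * exp (\<i> * of_real ((l + m) * t)))" by (rule trig_poly.exp)
    also have "(\<lambda>t. (c * d) * exp (\<i> * of_real ((l + m) * t))) =
        (\<lambda>t. c * exp (\<i> * of_real (l * t)) * (d * exp (\<i> * of_real (m * t))))"
      by (simp add: ring_distribs exp_add mult_ac fun_eq_iff)
    finally show ?case .
  qed (simp add: ring_distribs trig_poly.add)
qed (simp add: ring_distribs trig_poly.add)

lemma trig_poly_cnj: "trig_poly P \<Longrightarrow> trig_poly (\<lambda>t. cnj (P t))"
proof (induction P rule: trig_poly.induct)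
  case (exp c l)
  have "trig_poly (\<lambda>t. cnj c * exp (\<i> * of_real ((-l) * t)))" by (rule trig_poly.exp)
  then show ?case by (simp add: exp_cnj)
qed (simp add: trig_poly.add)

lemma trig_poly_sum: "(\<And>i. i \<in> I \<Longrightarrow> trig_poly (P i)) \<Longrightarrow> trig_poly (\<lambda>t. \<Sum>i\<in>I. P i t)"
  by (induction I rule: infinite_finite_induct) (simp_all add: trig_poly_const trig_poly.add)

lemma trig_poly_continuous: "trig_poly P \<Longrightarrow> continuous_on S P"
  by (induction P rule: trig_poly.induct) (auto intro!: continuous_intros)

lemma trig_poly_bounded: "trig_poly P \<Longrightarrow> \<exists>R. \<forall>t. norm (P t) \<le> R"
proof (induction P rule: trig_poly.induct)
  case (add P Q)
  then obtain R1 R2 where "\<forall>t. norm (P t) \<le> R1" "\<forall>t. norm (Q t) \<le> R2" by blast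
  then show ?case by (intro exI[of _ "R1 + R2"] allI norm_triangle_le add_mono) auto
qed (auto simp: norm_mult)

lemma tendsto_divide_at_top: "((\<lambda>x::real. c / x) \<longlongrightarrow> (0::real)) at_top"
  by (rule tendsto_divide_0[OF tendsto_const filterlim_at_top_imp_at_infinity[OF filterlim_ident]])

lemma trig_poly_mean:
  assumes "trig_poly P"
  shows "\<exists>L. ((\<lambda>T. integral {-T..T} P / of_real (2 * T)) \<longlongrightarrow> L) at_top"
  using assms
proof (induction P rule: trig_poly.induct)
  case (exp c l)
  show ?case
  proof (cases "l = 0")
    case True
    have "eventually (\<lambda>T::real. integral {-T..T} (\<lambda>t. c * exp (\<i> * of_real (l * t))) / of_real (2 * T) = c) at_top"
      using eventually_gt_at_top[of 0]
      by eventually_elim (simp add: True scaleR_conv_of_real)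
    from tendsto_eventually[OF this] show ?thesis by blast
  next
    case False
    have bnd: "norm (integral {-T..T} (\<lambda>t. c * exp (\<i> * of_real (l * t))) / of_real (2 * T)) \<le> norm c / \<bar>l\<bar> / T"
      if T: "T > 0" for T
    proof -
      have "((\<lambda>t. c * exp (\<i> * of_real (l * t))) has_integral
         (c * exp (\<i> * of_real (l * T)) / (\<i> * of_real l) - c * exp (\<i> * of_real (l * (-T))) / (\<i> * of_real l))) {-T..T}"
      proof (rule fundamental_theorem_of_calculus)
        fix t
        have "((\<lambda>z. c * exp (\<i> * (of_real l * z)) / (\<i> * of_real l)) has_field_derivative
           c * exp (\<i> * (of_real l * of_real t))) (at (of_real t))"
          using False by (auto intro!: derivative_eq_intros simp: field_simps power2_eq_square)
        from has_vector_derivative_real_field[OF this]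
        show "((\<lambda>t. c * exp (\<i> * of_real (l * t)) / (\<i> * of_real l)) has_vector_derivative
           c * exp (\<i> * of_real (l * t))) (at t within {-T..T})" by simp
      qed (use T in simp)
      then have "norm (integral {-T..T} (\<lambda>t. c * exp (\<i> * of_real (l * t)))) =
         norm (c * exp (\<i> * of_real (l * T)) / (\<i> * of_real l) - c * exp (\<i> * of_real (l * (-T))) / (\<i> * of_real l))"
        by (rule arg_cong[OF integral_unique])
      also have "\<dots> \<le> norm c / \<bar>l\<bar> + norm c / \<bar>l\<bar>"
      proof (rule norm_triangle_le_diff)
        have "norm (c * exp (\<i> * of_real (l * s)) / (\<i> * of_real l)) = norm c / \<bar>l\<bar>" for s
          unfolding norm_mult norm_divide norm_exp_i_times norm_ii by simp
        from this[of T] this[of "- T"] show "norm (c * exp (\<i> * of_real (l * T)) / (\<i> * of_real l)) +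
           norm (c * exp (\<i> * of_real (l * - T)) / (\<i> * of_real l)) \<le> norm c / \<bar>l\<bar> + norm c / \<bar>l\<bar>" by linarith
      qed
      finally have "norm (integral {-T..T} (\<lambda>t. c * exp (\<i> * of_real (l * t)))) \<le> norm c / \<bar>l\<bar> * 2" by (simp only: mult_2_right)
      moreover have "norm (of_real (2 * T) :: complex) = 2 * T" using T by simp
      ultimately show ?thesis using T unfolding norm_divide by (simp add: field_simps)
    qed
    have "((\<lambda>T. norm c / \<bar>l\<bar> / T) \<longlongrightarrow> 0) at_top"
      by (rule tendsto_divide_at_top)
    moreover have "eventually (\<lambda>T. norm (integral {-T..T} (\<lambda>t. c * exp (\<i> * of_real (l * t))) / of_real (2 * T)) \<le> norm c / \<bar>l\<bar> / T) at_top"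
      using eventually_gt_at_top[of 0] by eventually_elim (rule bnd)
    ultimately have "((\<lambda>T. integral {-T..T} (\<lambda>t. c * exp (\<i> * of_real (l * t))) / of_real (2 * T)) \<longlongrightarrow> 0) at_top"
      by (rule Lim_null_comparison[rotated])
    then show ?thesis by blast
  qed
next
  case (add P Q)
  then obtain L1 L2 where L: "((\<lambda>T. integral {-T..T} P / of_real (2 * T)) \<longlongrightarrow> L1) at_top"
    "((\<lambda>T. integral {-T..T} Q / of_real (2 * T)) \<longlongrightarrow> L2) at_top" by blast
  have "integral {-T..T} (\<lambda>t. P t + Q t) = integral {-T..T} P + integral {-T..T} Q" for T
    using add.hyps by (intro integral_add integrable_continuous_interval trig_poly_continuous)
  with tendsto_add[OF L] show ?case by (auto simp: add_divide_distrib)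
qed

lemma trig_poly_real_polynomial:
  assumes "real_polynomial_function q" "trig_poly P"
  shows "trig_poly (\<lambda>t. of_real (q (P t)))"
  using assms(1)
proof (induction q rule: real_polynomial_function.induct)
  case (linear f)
  interpret bounded_linear f by fact
  have "trig_poly (\<lambda>t. of_real (f 1) * ((1/2) * (P t + cnj (P t))) + of_real (f \<i>) * (1/(2*\<i>) * (P t + (-1) * cnj (P t))))"
    by (intro trig_poly.add trig_poly_mult trig_poly_const assms trig_poly_cnj)
  also have "(\<lambda>t. of_real (f 1) * ((1/2) * (P t + cnj (P t))) + of_real (f \<i>) * (1/(2*\<i>) * (P t + (-1) * cnj (P t)))) = (\<lambda>t. of_real (f (P t)))"
  proof
    fix t
    have "P t = Re (P t) *\<^sub>R 1 + Im (P t) *\<^sub>R \<i>" by (simp add: complex_eq_iff)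
    then have "f (P t) = Re (P t) * f 1 + Im (P t) * f \<i>" by (metis add scaleR real_scaleR_def)
    moreover have "(1/2) * (P t + cnj (P t)) = of_real (Re (P t))" by (simp add: complex_eq_iff)
    moreover have "1/(2*\<i>) * (P t + (-1) * cnj (P t)) = of_real (Im (P t))" by (simp add: complex_diff_cnj complex_eq_iff)
    ultimately show "of_real (f 1) * ((1/2) * (P t + cnj (P t))) + of_real (f \<i>) * (1/(2*\<i>) * (P t + (-1) * cnj (P t))) = of_real (f (P t))"
      by (simp add: mult.commute)
  qed
  finally show ?case .
next
  case (const c)
  show ?case by (rule trig_poly_const)
next
  case (add q r)
  from trig_poly.add[OF add.IH] show ?case by simp
next
  case (mult q r)
  from trig_poly_mult[OF mult.IH] show ?case by simp
qed

text \<open>Completeness of the reals, in the form in which limits of means are transported along approximation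
  in mean.\<close>

lemma tendsto_of_approximations:
  fixes m :: "real \<Rightarrow> real"
  assumes "\<And>\<epsilon>. \<epsilon> > 0 \<Longrightarrow> \<exists>g L. (g \<longlongrightarrow> L) at_top \<and> eventually (\<lambda>T. \<bar>m T - g T\<bar> \<le> \<epsilon>) at_top"
  shows "\<exists>L. (m \<longlongrightarrow> L) at_top"
proof -
  have ev: "\<exists>L. eventually (\<lambda>T. \<bar>m T - L\<bar> \<le> \<epsilon>) at_top" if "\<epsilon> > 0" for \<epsilon>
  proof -
    obtain g L where g: "(g \<longlongrightarrow> L) at_top" "eventually (\<lambda>T. \<bar>m T - g T\<bar> \<le> \<epsilon> / 2) at_top"
      using assms[of "\<epsilon> / 2"] \<open>\<epsilon> > 0\<close> by auto
    have "eventually (\<lambda>T. dist (g T) L < \<epsilon> / 2) at_top" using tendstoD[OF g(1), of "\<epsilon> / 2"] that by simp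
    with g(2) have "eventually (\<lambda>T. \<bar>m T - L\<bar> \<le> \<epsilon>) at_top"
      unfolding dist_real_def by eventually_elim linarith
    then show ?thesis by blast
  qed
  then have "\<forall>n::nat. \<exists>L. eventually (\<lambda>T. \<bar>m T - L\<bar> \<le> 1 / real (Suc n)) at_top" by simp
  then obtain l where l: "\<And>n. eventually (\<lambda>T. \<bar>m T - l n\<bar> \<le> 1 / real (Suc n)) at_top" by metis
  have d: "\<bar>l n - l k\<bar> \<le> 1 / real (Suc n) + 1 / real (Suc k)" for n k
  proof -
    have "eventually (\<lambda>T::real. \<bar>l n - l k\<bar> \<le> 1 / real (Suc n) + 1 / real (Suc k)) at_top"
      using l[of n] l[of k] by eventually_elim linarith
    then show ?thesis by simp
  qed
  have "Cauchy l"
  proof (rule metric_CauchyI)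
    fix e :: real assume "e > 0"
    then obtain N where N: "inverse (real (Suc N)) < e / 2" using reals_Archimedean[of "e / 2"] by auto
    have "dist (l n) (l k) < e" if "n \<ge> N" "k \<ge> N" for n k
    proof -
      have "1 / real (Suc n) \<le> 1 / real (Suc N)" "1 / real (Suc k) \<le> 1 / real (Suc N)"
        using that by (auto intro!: frac_le)
      then show ?thesis using d[of n k] N by (simp add: dist_real_def inverse_eq_divide)
    qed
    then show "\<exists>M. \<forall>m\<ge>M. \<forall>n\<ge>M. dist (l m) (l n) < e" by blast
  qed
  then obtain L where L: "l \<longlonglongrightarrow> L" using Cauchy_convergent convergent_def by blast
  have "(m \<longlongrightarrow> L) at_top"
  proof (rule tendstoI)
    fix e :: real assume "e > 0"
    have "eventually (\<lambda>n. dist (l n) L < e / 2) sequentially" using tendstoD[OF L, of "e/2"] \<open>e > 0\<close> by simp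
    moreover have "eventually (\<lambda>n. 1 / real (Suc n) < e / 2) sequentially"
      using order_tendstoD(2)[OF LIMSEQ_inverse_real_of_nat, of "e / 2"] \<open>e > 0\<close>
      by (simp add: inverse_eq_divide)
    ultimately have "eventually (\<lambda>n. dist (l n) L < e / 2 \<and> 1 / real (Suc n) < e / 2) sequentially" by eventually_elim simp
    then obtain n where n: "dist (l n) L < e / 2" "1 / real (Suc n) < e / 2"
      using eventually_happens'[OF sequentially_bot] by blast
    show "eventually (\<lambda>T. dist (m T) L < e) at_top"
      using l[of n] n unfolding dist_real_def by (elim eventually_mono) linarith
  qed
  then show ?thesis by blast
qed

text \<open>The values of a trigonometric polynomial stay in a disc, on which \<open>G\<close> is a uniform limit of real
  polynomials in real and imaginary part; these turn trigonometric polynomials into trigonometric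
  polynomials, whose means exist by inspection.\<close>

lemma mean_continuous_trig_poly:
  fixes G :: "complex \<Rightarrow> real"
  assumes P: "trig_poly P" and G: "continuous_on UNIV G"
  shows "\<exists>L. ((\<lambda>T. integral {-T..T} (\<lambda>t. G (P t)) / (2 * T)) \<longlongrightarrow> L) at_top"
proof (rule tendsto_of_approximations)
  fix \<epsilon> :: real assume \<epsilon>: "\<epsilon> > 0"
  obtain R where R: "\<And>t. norm (P t) \<le> R" using trig_poly_bounded[OF P] by blast
  obtain q where q: "real_polynomial_function q" "\<And>z. z \<in> cball 0 R \<Longrightarrow> \<bar>G z - q z\<bar> < \<epsilon>"
    using Stone_Weierstrass_real_polynomial_function[of "cball 0 R" G \<epsilon>] continuous_on_subset[OF G] \<epsilon> by auto
  have tq: "trig_poly (\<lambda>t. of_real (q (P t)))" by (rule trig_poly_real_polynomial[OF q(1) P])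
  obtain L where L: "((\<lambda>T. integral {-T..T} (\<lambda>t. of_real (q (P t)) :: complex) / of_real (2 * T)) \<longlongrightarrow> L) at_top"
    using trig_poly_mean[OF tq] by blast
  have qi: "(\<lambda>t. q (P t)) integrable_on {-T..T}" for T
  proof -
    have "(\<lambda>t. Re (of_real (q (P t)))) integrable_on {-T..T}"
      by (intro integrable_continuous_interval continuous_intros trig_poly_continuous[OF tq])
    then show ?thesis by simp
  qed
  have "integral {-T..T} (\<lambda>t. of_real (q (P t)) :: complex) / of_real (2 * T) = of_real (integral {-T..T} (\<lambda>t. q (P t)) / (2 * T))" for T
    using integral_linear[OF qi bounded_linear_of_real[where 'a=complex], of T] by (simp add: o_def)
  note L = L[unfolded this]
  from tendsto_Re[OF L] have L': "((\<lambda>T. integral {-T..T} (\<lambda>t. q (P t)) / (2 * T)) \<longlongrightarrow> Re L) at_top" by simp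
  moreover have "eventually (\<lambda>T. \<bar>integral {-T..T} (\<lambda>t. G (P t)) / (2 * T) - integral {-T..T} (\<lambda>t. q (P t)) / (2 * T)\<bar> \<le> \<epsilon>) at_top"
    using eventually_gt_at_top[of 0]
  proof eventually_elim
    fix T :: real assume T: "T > 0"
    have Gi: "(\<lambda>t. G (P t)) integrable_on {-T..T}"
      by (intro integrable_continuous_interval continuous_on_compose2[OF G trig_poly_continuous[OF P]]) auto
    have "norm (integral {-T..T} (\<lambda>t. G (P t) - q (P t))) \<le> integral {-T..T} (\<lambda>_. \<epsilon>)"
      using q(2) R by (intro integral_norm_bound_integral integrable_diff Gi qi) (auto intro: less_imp_le)
    then have "\<bar>integral {-T..T} (\<lambda>t. G (P t)) - integral {-T..T} (\<lambda>t. q (P t))\<bar> \<le> \<epsilon> * (2 * T)"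
      using T by (simp add: integral_diff Gi qi mult_ac)
    then show "\<bar>integral {-T..T} (\<lambda>t. G (P t)) / (2 * T) - integral {-T..T} (\<lambda>t. q (P t)) / (2 * T)\<bar> \<le> \<epsilon>"
      using T by (simp add: diff_divide_distrib[symmetric] divide_le_eq)
  qed
  ultimately show "\<exists>g L. (g \<longlongrightarrow> L) at_top \<and> eventually (\<lambda>T. \<bar>integral {-T..T} (\<lambda>t. G (P t)) / (2 * T) - g T\<bar> \<le> \<epsilon>) at_top"
    by blast
qed

section \<open>Approximation in mean on vertical lines\<close>

lemma abs_ln_max_diff_le:
  fixes x y \<eta> :: real
  assumes "\<eta> > 0"
  shows "\<bar>ln (max x \<eta>) - ln (max y \<eta>)\<bar> \<le> \<bar>x - y\<bar> / \<eta>"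
proof -
  have *: "ln (max x \<eta>) - ln (max y \<eta>) \<le> \<bar>x - y\<bar> / \<eta>" for x y
  proof -
    have "ln (max x \<eta>) - ln (max y \<eta>) \<le> (max x \<eta> - max y \<eta>) / max y \<eta>"
      using assms by (intro ln_diff_le) auto
    also have "\<dots> \<le> \<bar>x - y\<bar> / max y \<eta>" using assms by (intro divide_right_mono) auto
    also have "\<dots> \<le> \<bar>x - y\<bar> / \<eta>" using assms by (intro divide_left_mono) auto
    finally show ?thesis .
  qed
  show ?thesis using *[of x y] *[of y x] by (simp add: abs_le_iff abs_minus_commute)
qed

context normalised_dirichlet_function
begin

text \<open>Translates by at most \<open>T\<close> are covered by the mean over \<open>[-2T, 2T]\<close>.\<close>

lemma mean_shift:
  assumes "\<sigma> > 0" "T \<ge> 1" "\<bar>v\<bar> \<le> T"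
  shows "integral {-T..T} (\<lambda>t. norm (F (Complex \<sigma> (v + t)))) \<le> 2 * B * T"
proof -
  let ?g = "\<lambda>t. norm (F (Complex \<sigma> t))"
  have "((\<lambda>t. ?g (t + v)) has_integral integral {-T+v..T+v} ?g) {-T..T}"
    using has_integral_shift_real_ivl[OF integrable_integral[OF line_integrable[OF assms(1), of "-T+v" "T+v"]], of v] by simp
  then have "integral {-T..T} (\<lambda>t. ?g (v + t)) = integral {-T+v..T+v} ?g"
    by (subst add.commute) (rule integral_unique)
  also have "\<dots> \<le> integral {-(2*T)..2*T} ?g"
    using assms by (intro integral_subset_le line_integrable) auto
  also have "\<dots> \<le> B * (2 * T)" using assms by (intro mean_bound) auto
  finally show ?thesis by simp
qed

text \<open>Cauchy's formula for \<open>\<zeta> \<mapsto> F \<zeta> K(\<zeta> - s)\<close> on a rectangle around \<open>s = \<sigma> + it\<close>, where \<open>K 0 = 1\<close>. Only the right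
  edge is kept; the kernel makes the left edge small through \<open>exp(Vw)\<close> and the horizontal edges
  through \<open>exp(w\<^sup>2)\<close>.\<close>

lemma cauchy_split:
  fixes \<sigma> V t :: real
  assumes \<sigma>: "\<sigma> > 0" and V: "V \<ge> 1"
  defines "K \<equiv> \<lambda>w. exp (of_real V * w + w\<^sup>2)"
  defines "k \<equiv> \<lambda>v. K (Complex X v) / Complex X v"
  defines "D \<equiv> \<sigma> / 2 + X"
  shows "norm (2 * pi * F (Complex \<sigma> t) - integral {-V..V} (\<lambda>v. F (Complex (\<sigma> + X) (v + t)) * k v)) \<le>
     exp ((\<sigma>/2)\<^sup>2 - V * (\<sigma>/2)) / (\<sigma>/2) * integral {-V..V} (\<lambda>v. norm (F (Complex (\<sigma>/2) (v + t)))) +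
     exp (V * D + D\<^sup>2 - V\<^sup>2) / V * (integral {\<sigma>/2..\<sigma>+X} (\<lambda>x. norm (F (Complex x (-V + t)))) +
        integral {\<sigma>/2..\<sigma>+X} (\<lambda>x. norm (F (Complex x (V + t)))))"
proof -
  define z where "z = Complex \<sigma> t"
  define g where "g = (\<lambda>\<zeta>. F \<zeta> * K (\<zeta> - z))"
  have holg: "g holomorphic_on {s. Re s > 0}" unfolding g_def K_def by (intro holomorphic_intros hol)
  have gz: "g z = F z" by (simp add: g_def K_def)
  have sh: "integral {t - V..t + V} h = integral {-V..V} (\<lambda>v. h (v + t))" for h :: "real \<Rightarrow> complex"
    using integral_shift_real_ivl[of "t - V" t "t + V" h] by simp
  define IR where "IR = integral {t-V..t+V} (\<lambda>y. g (Complex (\<sigma>+X) y) / (Complex (\<sigma>+X) y - z))"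
  define IL where "IL = integral {t-V..t+V} (\<lambda>y. g (Complex (\<sigma>/2) y) / (Complex (\<sigma>/2) y - z))"
  define IB where "IB = integral {\<sigma>/2..\<sigma>+X} (\<lambda>x. g (Complex x (t-V)) / (Complex x (t-V) - z))"
  define IT where "IT = integral {\<sigma>/2..\<sigma>+X} (\<lambda>x. g (Complex x (t+V)) / (Complex x (t+V) - z))"
  have "2 * pi * g z = IR - IL - \<i> * (IB - IT)" unfolding IR_def IL_def IB_def IT_def
    by (rule cauchy_formula_rectangle[OF half_plane_convex half_plane_open holg])
       (use \<sigma> X V in \<open>auto simp: in_cbox_complex_iff z_def\<close>)
  then have "norm (2 * pi * F z - IR) = norm (- IL - \<i> * (IB - IT))" by (simp add: gz)
  also have "\<dots> \<le> norm IL + (norm IB + norm IT)"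
    using norm_triangle_ineq4[of "- IL" "\<i> * (IB - IT)"] norm_triangle_ineq4[of IB IT]
    unfolding norm_mult norm_ii mult_1 norm_minus_cancel by linarith
  finally have main: "norm (2 * pi * F z - IR) \<le> norm IL + (norm IB + norm IT)" .
  have normK: "norm (K w) = exp (V * Re w + (Re w)\<^sup>2 - (Im w)\<^sup>2)" for w
    by (simp add: K_def power2_eq_square)
  have edge: "norm (integral {p..q} h) \<le> c * integral {p..q} (\<lambda>x. norm (F (w x)))"
    if "continuous_on {p..q} h" "continuous_on {p..q} w" "\<And>x. x \<in> {p..q} \<Longrightarrow> Re (w x) > 0"
       "\<And>x. x \<in> {p..q} \<Longrightarrow> norm (h x) \<le> c * norm (F (w x))"
    for p q c :: real and h w :: "real \<Rightarrow> complex"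
  proof -
    have "norm (integral {p..q} h) \<le> integral {p..q} (\<lambda>x. c * norm (F (w x)))"
      using that by (intro integral_norm_bound_integral integrable_continuous_interval continuous_intros contF_compose) auto
    then show ?thesis by simp
  qed
  have contK: "continuous_on S K" for S unfolding K_def by (intro continuous_intros)
  have cont: "continuous_on {p..q} (\<lambda>x. g (w x) / (w x - z))"
    if w: "continuous_on {p..q} w" "\<And>x. x \<in> {p..q} \<Longrightarrow> Re (w x) > 0" "\<And>x. x \<in> {p..q} \<Longrightarrow> w x \<noteq> z" for p q and w :: "real \<Rightarrow> complex"
    unfolding g_def K_def using w by (intro continuous_intros contF_compose) auto
  have qt: "norm (g s / (s - z)) \<le> E / m * norm (F s)"
    if "norm (K (s - z)) \<le> E" "m > 0" "m \<le> norm (s - z)" for s E m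
  proof -
    have "norm (g s / (s - z)) = norm (K (s - z)) / norm (s - z) * norm (F s)"
      by (simp add: g_def norm_mult norm_divide)
    also have "\<dots> \<le> E / m * norm (F s)"
      using that order_trans[OF norm_ge_zero that(1)] by (intro mult_right_mono frac_le) auto
    finally show ?thesis .
  qed
  have IR: "IR = integral {-V..V} (\<lambda>v. F (Complex (\<sigma> + X) (v + t)) * k v)"
  proof -
    have "Complex (\<sigma> + X) (v + t) - z = Complex X v" for v by (simp add: z_def complex_eq_iff)
    then show ?thesis unfolding IR_def sh g_def k_def by simp
  qed
  have IL: "norm IL \<le> exp ((\<sigma>/2)\<^sup>2 - V * (\<sigma>/2)) / (\<sigma>/2) * integral {-V..V} (\<lambda>v. norm (F (Complex (\<sigma>/2) (v + t))))"
    unfolding IL_def sh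
  proof (rule edge[of _ _ _ "\<lambda>v. Complex (\<sigma>/2) (v + t)"])
    show "continuous_on {-V..V} (\<lambda>v. g (Complex (\<sigma>/2) (v + t)) / (Complex (\<sigma>/2) (v + t) - z))"
      by (rule cont) (use \<sigma> in \<open>auto intro!: continuous_intros simp: z_def\<close>)
    fix v
    show "norm (g (Complex (\<sigma>/2) (v + t)) / (Complex (\<sigma>/2) (v + t) - z)) \<le>
       exp ((\<sigma>/2)\<^sup>2 - V * (\<sigma>/2)) / (\<sigma>/2) * norm (F (Complex (\<sigma>/2) (v + t)))"
    proof (rule qt)
      show "norm (K (Complex (\<sigma>/2) (v + t) - z)) \<le> exp ((\<sigma>/2)\<^sup>2 - V * (\<sigma>/2))"
        unfolding normK by (simp add: z_def power2_eq_square algebra_simps)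
      show "\<sigma> / 2 \<le> norm (Complex (\<sigma>/2) (v + t) - z)"
        using abs_Re_le_cmod[of "Complex (\<sigma>/2) (v + t) - z"] \<sigma> by (simp add: z_def)
    qed (use \<sigma> in auto)
  qed (use \<sigma> in \<open>auto intro!: continuous_intros\<close>)
  have hor: "norm (integral {\<sigma>/2..\<sigma>+X} (\<lambda>x. g (Complex x (r + t)) / (Complex x (r + t) - z))) \<le>
      exp (V * D + D\<^sup>2 - V\<^sup>2) / V * integral {\<sigma>/2..\<sigma>+X} (\<lambda>x. norm (F (Complex x (r + t))))"
    if r: "\<bar>r\<bar> = V" for r
  proof (rule edge[of _ _ _ "\<lambda>x. Complex x (r + t)"])
    show "continuous_on {\<sigma>/2..\<sigma>+X} (\<lambda>x. g (Complex x (r + t)) / (Complex x (r + t) - z))"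
      by (rule cont) (use \<sigma> r V in \<open>auto intro!: continuous_intros simp: z_def\<close>)
    fix x assume x: "x \<in> {\<sigma>/2..\<sigma>+X}"
    show "norm (g (Complex x (r + t)) / (Complex x (r + t) - z)) \<le>
       exp (V * D + D\<^sup>2 - V\<^sup>2) / V * norm (F (Complex x (r + t)))"
    proof (rule qt)
      have "V * (x - \<sigma>) \<le> V * D" using x V \<sigma> by (intro mult_left_mono) (auto simp: D_def)
      moreover have "(x - \<sigma>)\<^sup>2 \<le> D\<^sup>2"
        using x \<sigma> X by (intro abs_le_square_iff[THEN iffD1]) (auto simp: D_def abs_le_iff)
      moreover have "r\<^sup>2 = V\<^sup>2" using r by (metis power2_abs)
      ultimately show "norm (K (Complex x (r + t) - z)) \<le> exp (V * D + D\<^sup>2 - V\<^sup>2)"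
        unfolding normK by (simp add: z_def)
      show "V \<le> norm (Complex x (r + t) - z)"
        using abs_Im_le_cmod[of "Complex x (r + t) - z"] r by (simp add: z_def)
    qed (use V in auto)
  qed (use \<sigma> in \<open>auto intro!: continuous_intros\<close>)
  have IB: "norm IB \<le> exp (V * D + D\<^sup>2 - V\<^sup>2) / V * integral {\<sigma>/2..\<sigma>+X} (\<lambda>x. norm (F (Complex x (-V + t))))"
    using hor[of "-V"] V by (simp add: IB_def)
  have IT: "norm IT \<le> exp (V * D + D\<^sup>2 - V\<^sup>2) / V * integral {\<sigma>/2..\<sigma>+X} (\<lambda>x. norm (F (Complex x (V + t))))"
    using hor[of V] V by (simp add: IT_def add.commute)
  have "norm (2 * pi * F z - IR) \<le> exp ((\<sigma>/2)\<^sup>2 - V * (\<sigma>/2)) / (\<sigma>/2) * integral {-V..V} (\<lambda>v. norm (F (Complex (\<sigma>/2) (v + t)))) +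
     (exp (V * D + D\<^sup>2 - V\<^sup>2) / V * integral {\<sigma>/2..\<sigma>+X} (\<lambda>x. norm (F (Complex x (-V + t)))) +
      exp (V * D + D\<^sup>2 - V\<^sup>2) / V *  integral {\<sigma>/2..\<sigma>+X} (\<lambda>x. norm (F (Complex x (V + t)))))"
    using main IL IB IT by linarith
  then show ?thesis unfolding IR z_def by (simp only: distrib_left)
qed

text \<open>On the right edge of \<open>cauchy_split\<close> the series may be cut off at an error uniform in \<open>t\<close>, and the integral
  of a partial sum against the kernel is a trigonometric polynomial in \<open>t\<close>. The other edges are small
  in mean by \<open>mean_shift\<close> and Fubini.\<close>

lemma trig_poly_mean_approximation:
  assumes \<sigma>: "\<sigma> > 0" and \<epsilon>: "\<epsilon> > 0"
  shows "\<exists>P. trig_poly P \<and> eventually (\<lambda>T. integral {-T..T} (\<lambda>t. norm (F (Complex \<sigma> t) - P t)) \<le> \<epsilon> * (2 * T)) at_top"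
proof -
  define \<delta> D where "\<delta> = \<sigma> / 2" and "D = \<sigma> / 2 + X"
  have \<delta>: "\<delta> > 0" using \<sigma> by (simp add: \<delta>_def)
  have "((\<lambda>V. exp (\<delta>\<^sup>2 - V * \<delta>) / \<delta> * (2 * V * B) + exp (V * D + D\<^sup>2 - V\<^sup>2) / V * (2 * D * B)) \<longlongrightarrow>
      0 + 0) at_top"
  proof (rule tendsto_add)
    have "((\<lambda>V. V * exp (- (V * \<delta>))) \<longlongrightarrow> 0) at_top"
    proof (rule Lim_null_comparison)
      show "((\<lambda>V::real. 2 / \<delta>\<^sup>2 / V) \<longlongrightarrow> 0) at_top"
        by (rule tendsto_divide_at_top)
      show "eventually (\<lambda>V. norm (V * exp (- (V * \<delta>))) \<le> 2 / \<delta>\<^sup>2 / V) at_top"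
        using eventually_gt_at_top[of 0]
      proof eventually_elim
        case (elim V)
        have "(V * \<delta>)\<^sup>2 / 2 \<le> 1 + V * \<delta> + (V * \<delta>)\<^sup>2 / 2" using elim \<delta> by simp
        also have "\<dots> \<le> exp (V * \<delta>)" using elim \<delta> by (intro exp_lower_Taylor_quadratic) auto
        finally have "V * V * \<delta>\<^sup>2 \<le> 2 * exp (V * \<delta>)" by (simp add: power2_eq_square mult_ac)
        then show ?case using elim \<delta> by (simp add: exp_minus field_simps)
      qed
    qed
    from tendsto_mult[OF tendsto_const[of "exp (\<delta>\<^sup>2) / \<delta> * 2 * B"] this]
    show "((\<lambda>V. exp (\<delta>\<^sup>2 - V * \<delta>) / \<delta> * (2 * V * B)) \<longlongrightarrow> 0) at_top"
      by (simp add: exp_diff exp_minus field_simps)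
    have "((\<lambda>V. exp (V * D - V\<^sup>2) / V) \<longlongrightarrow> 0) at_top"
    proof (rule Lim_null_comparison)
      show "((\<lambda>V::real. 1 / V) \<longlongrightarrow> 0) at_top"
        by (rule tendsto_divide_at_top)
      show "eventually (\<lambda>V. norm (exp (V * D - V\<^sup>2) / V) \<le> 1 / V) at_top"
        using eventually_gt_at_top[of 0] eventually_ge_at_top[of D]
      proof eventually_elim
        case (elim V)
        have "V * D \<le> V * V" using elim by (intro mult_left_mono) auto
        then show ?case using elim by (simp add: power2_eq_square divide_right_mono)
      qed
    qed
    from tendsto_mult[OF tendsto_const[of "exp (D\<^sup>2) * 2 * D * B"] this]
    show "((\<lambda>V. exp (V * D + D\<^sup>2 - V\<^sup>2) / V * (2 * D * B)) \<longlongrightarrow> 0) at_top"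
      by (simp add: exp_diff exp_add field_simps)
  qed
  then have "eventually (\<lambda>V. exp (\<delta>\<^sup>2 - V * \<delta>) / \<delta> * (2 * V * B) + exp (V * D + D\<^sup>2 - V\<^sup>2) / V * (2 * D * B) < \<epsilon> / 2) at_top"
    by (rule order_tendstoD) (use \<epsilon> in simp)
  with eventually_ge_at_top[of 1]
  have "eventually (\<lambda>V. V \<ge> 1 \<and> exp (\<delta>\<^sup>2 - V * \<delta>) / \<delta> * (2 * V * B) + exp (V * D + D\<^sup>2 - V\<^sup>2) / V * (2 * D * B) < \<epsilon> / 2) at_top"
    by eventually_elim simp
  from eventually_happens'[OF trivial_limit_at_top_linorder this] obtain V where V: "V \<ge> 1" and Vs: "exp (\<delta>\<^sup>2 - V * \<delta>) / \<delta> * (2 * V * B) + exp (V * D + D\<^sup>2 - V\<^sup>2) / V * (2 * D * B) < \<epsilon> / 2"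
    by blast
  define eL eT where "eL = exp (\<delta>\<^sup>2 - V * \<delta>) / \<delta>" and "eT = exp (V * D + D\<^sup>2 - V\<^sup>2) / V"
  have eLT: "eL \<ge> 0" "eT \<ge> 0" using \<delta> V by (auto simp: eL_def eT_def)
  define k where "k = (\<lambda>v. exp (of_real V * Complex X v + (Complex X v)\<^sup>2) / Complex X v)"
  have Xnz: "Complex X v \<noteq> 0" for v using X by (auto simp: complex_eq_iff)
  have contk: "continuous_on S k" for S unfolding k_def using Xnz by (intro continuous_intros) auto
  define Kc where "Kc = integral {-V..V} (\<lambda>v. norm (k v))"
  have Kc: "Kc \<ge> 0" unfolding Kc_def
    by (intro integral_nonneg integrable_continuous_interval continuous_intros contk) auto
  define \<eta> where "\<eta> = \<epsilon> / (2 * (Kc + 1))"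
  have \<eta>: "\<eta> > 0" "\<eta> * Kc \<le> \<epsilon> / 2" using Kc \<epsilon> by (auto simp: \<eta>_def field_simps)
  define S where "S = (\<lambda>N t. \<Sum>n<N. b n * exp (- Complex (\<sigma> + X) t * ln (real (Suc n))))"
  have "uniform_limit UNIV S (\<lambda>t. F (Complex (\<sigma> + X) t)) sequentially"
    unfolding S_def using uniform[of "\<sigma> + X"] \<sigma> by simp
  from uniform_limitD[OF this \<eta>(1)] obtain N where N: "\<And>t. dist (S N t) (F (Complex (\<sigma> + X) t)) < \<eta>"
    by (auto simp: eventually_sequentially)
  define \<kappa> where "\<kappa> = (\<lambda>n. integral {-V..V} (\<lambda>v. exp (- \<i> * of_real (v * ln (real (Suc n)))) * k v) / of_real (2 * pi))"
  define P where "P = (\<lambda>t. \<Sum>n<N. (b n * exp (- of_real ((\<sigma> + X) * ln (real (Suc n)))) * \<kappa> n) * exp (\<i> * of_real (- ln (real (Suc n)) * t)))"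
  have tP: "trig_poly P" unfolding P_def by (intro trig_poly_sum trig_poly.exp)
  have contS: "continuous_on A (\<lambda>v. S N (v + t))" for A t unfolding S_def by (intro continuous_intros)
  have PS: "2 * pi * P t = integral {-V..V} (\<lambda>v. S N (v + t) * k v)" for t
  proof -
    define a where "a = (\<lambda>n. b n * exp (- of_real ((\<sigma> + X) * ln (real (Suc n)))) * exp (\<i> * of_real (- ln (real (Suc n)) * t)))"
    have e: "b n * exp (- Complex (\<sigma> + X) (v + t) * ln (real (Suc n))) = a n * exp (- \<i> * of_real (v * ln (real (Suc n))))" for n v
    proof -
      have "- Complex (\<sigma> + X) (v + t) * ln (real (Suc n)) =
         - of_real ((\<sigma> + X) * ln (real (Suc n))) + \<i> * of_real (- ln (real (Suc n)) * t) + - \<i> * of_real (v * ln (real (Suc n)))"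
        by (simp add: complex_eq_iff algebra_simps)
      then show ?thesis unfolding a_def exp_add by (simp only: exp_add mult.assoc)
    qed
    have "integral {-V..V} (\<lambda>v. S N (v + t) * k v) = integral {-V..V} (\<lambda>v. \<Sum>n<N. a n * (exp (- \<i> * of_real (v * ln (real (Suc n)))) * k v))"
      unfolding S_def sum_distrib_right e by (simp only: mult.assoc)
    also have "\<dots> = (\<Sum>n<N. integral {-V..V} (\<lambda>v. a n * (exp (- \<i> * of_real (v * ln (real (Suc n)))) * k v)))"
      by (intro integral_sum integrable_continuous_interval continuous_intros contk) auto
    also have "\<dots> = (\<Sum>n<N. a n * (2 * pi * \<kappa> n))"
      unfolding \<kappa>_def by (intro sum.cong refl) simp
    also have "\<dots> = 2 * pi * P t" unfolding P_def a_def sum_distrib_left by (intro sum.cong refl) (simp only: mult_ac)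
    finally show ?thesis by simp
  qed
  have near: "norm (integral {-V..V} (\<lambda>v. F (Complex (\<sigma> + X) (v + t)) * k v) - 2 * pi * P t) \<le> \<epsilon> / 2" for t
  proof -
    have i1: "(\<lambda>v. F (Complex (\<sigma> + X) (v + t)) * k v) integrable_on {-V..V}"
      using \<sigma> X by (intro integrable_continuous_interval continuous_intros contk contF_compose) auto
    have i2: "(\<lambda>v. S N (v + t) * k v) integrable_on {-V..V}"
      by (intro integrable_continuous_interval continuous_intros contk contS)
    have "norm (integral {-V..V} (\<lambda>v. F (Complex (\<sigma> + X) (v + t)) * k v - S N (v + t) * k v)) \<le> integral {-V..V} (\<lambda>v. \<eta> * norm (k v))"
    proof (rule integral_norm_bound_integral[OF integrable_diff[OF i1 i2]])
      show "(\<lambda>v. \<eta> * norm (k v)) integrable_on {-V..V}"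
        by (intro integrable_continuous_interval continuous_intros contk)
      fix v
      have "norm (F (Complex (\<sigma> + X) (v + t)) * k v - S N (v + t) * k v) = dist (S N (v + t)) (F (Complex (\<sigma> + X) (v + t))) * norm (k v)"
        by (simp add: dist_norm norm_mult[symmetric] norm_minus_commute left_diff_distrib)
      also have "\<dots> \<le> \<eta> * norm (k v)" using N[of "v + t"] by (intro mult_right_mono) auto
      finally show "norm (F (Complex (\<sigma> + X) (v + t)) * k v - S N (v + t) * k v) \<le> \<eta> * norm (k v)" .
    qed
    also have "\<dots> = \<eta> * Kc" by (simp add: Kc_def)
    also have "\<dots> \<le> \<epsilon> / 2" by (rule \<eta>)
    finally show ?thesis unfolding PS by (simp only: integral_diff[OF i1 i2])
  qed
  define LI where "LI = (\<lambda>t. integral {-V..V} (\<lambda>v. norm (F (Complex \<delta> (v + t)))))"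
  define HI where "HI = (\<lambda>r t. integral {\<delta>..\<sigma>+X} (\<lambda>x. norm (F (Complex x (r + t)))))"
  have pw: "2 * pi * norm (F (Complex \<sigma> t) - P t) \<le> \<epsilon> / 2 + eL * LI t + eT * (HI (-V) t + HI V t)" for t
  proof -
    have "2 * pi * norm (F (Complex \<sigma> t) - P t) = norm (2 * pi * F (Complex \<sigma> t) - 2 * pi * P t)"
    proof -
      have "2 * pi * F (Complex \<sigma> t) - 2 * pi * P t = of_real (2 * pi) * (F (Complex \<sigma> t) - P t)" by (simp add: algebra_simps)
      then show ?thesis by (simp only: norm_mult norm_of_real) simp
    qed
    also have "\<dots> \<le> norm (2 * pi * F (Complex \<sigma> t) - integral {-V..V} (\<lambda>v. F (Complex (\<sigma> + X) (v + t)) * k v))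
       + norm (integral {-V..V} (\<lambda>v. F (Complex (\<sigma> + X) (v + t)) * k v) - 2 * pi * P t)"
      unfolding dist_norm[symmetric] by (rule dist_triangle)
    also have "\<dots> \<le> (eL * LI t + eT * (HI (-V) t + HI V t)) + \<epsilon> / 2"
      unfolding eL_def eT_def LI_def HI_def \<delta>_def D_def k_def
      by (intro add_mono cauchy_split[OF \<sigma> V] near[unfolded k_def])
    finally show ?thesis by simp
  qed
  have ev: "integral {-T..T} (\<lambda>t. norm (F (Complex \<sigma> t) - P t)) \<le> \<epsilon> * (2 * T)" if T: "T \<ge> V" for T
  proof -
    have T1: "T \<ge> 1" using T V by simp
    have LI: "LI integrable_on {-T..T}" "integral {-T..T} LI \<le> integral {-V..V} (\<lambda>_. 2 * B * T)"
      unfolding LI_def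
      by (rule integral_swap_le, (use \<delta> V T T1 in \<open>auto intro!: continuous_on_norm contF_compose continuous_intros mean_shift\<close>)[3])+
    then have LI2: "integral {-T..T} LI \<le> (V - (-V)) * (2 * B * T)" using V by (simp add: mult_ac)
    have HI: "HI r integrable_on {-T..T}" "integral {-T..T} (HI r) \<le> integral {\<delta>..\<sigma>+X} (\<lambda>_. 2 * B * T)" if "\<bar>r\<bar> = V" for r
      unfolding HI_def
      by (rule integral_swap_le, (use \<delta> V T T1 that X in \<open>auto simp: \<delta>_def intro!: continuous_on_norm contF_compose continuous_intros mean_shift\<close>)[3])+
    have HIi: "HI (-V) integrable_on {-T..T}" "HI V integrable_on {-T..T}" using V by (auto intro!: HI)
    have i: "(\<lambda>t. norm (F (Complex \<sigma> t) - P t)) integrable_on {-T..T}"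
      using \<sigma> by (intro integrable_continuous_interval continuous_intros contF_compose trig_poly_continuous tP) auto
    have HI2: "integral {-T..T} (HI r) \<le> D * (2 * B * T)" if "\<bar>r\<bar> = V" for r
    proof -
      have "integral {\<delta>..\<sigma>+X} (\<lambda>_. 2 * B * T) = D * (2 * B * T)" using \<sigma> X by (simp add: D_def \<delta>_def)
      then show ?thesis using HI(2)[OF that] by (simp only:)
    qed
    have "2 * pi * integral {-T..T} (\<lambda>t. norm (F (Complex \<sigma> t) - P t)) = integral {-T..T} (\<lambda>t. 2 * pi * norm (F (Complex \<sigma> t) - P t))"
      by simp
    also have "\<dots> \<le> integral {-T..T} (\<lambda>t. \<epsilon> / 2 + eL * LI t + eT * (HI (-V) t + HI V t))"
      using LI HIi i pw by (intro integral_le integrable_add integrable_on_mult_right integrable_const_ivl) auto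
    also have "\<dots> = integral {-T..T} (\<lambda>_. \<epsilon> / 2) + integral {-T..T} (\<lambda>t. eL * LI t) + integral {-T..T} (\<lambda>t. eT * (HI (-V) t + HI V t))"
      using LI HIi by (simp only: integral_add integrable_add integrable_on_mult_right integrable_const_ivl)
    also have "\<dots> = \<epsilon> * T + eL * integral {-T..T} LI + eT * (integral {-T..T} (HI (-V)) + integral {-T..T} (HI V))"
      using T1 HIi by (simp add: integral_add)
    also have "\<dots> \<le> \<epsilon> * T + eL * ((V - (-V)) * (2 * B * T)) + eT * (D * (2 * B * T) + D * (2 * B * T))"
      using V \<epsilon> by (intro add_mono mult_left_mono LI2 HI2 eLT) auto
    also have "\<dots> = \<epsilon> * T + 2 * T * (eL * (2 * V * B) + eT * (2 * D * B))" by (simp add: algebra_simps)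
    also have "\<dots> \<le> \<epsilon> * T + 2 * T * (\<epsilon> / 2)"
      using Vs T1 \<epsilon> unfolding eL_def eT_def by (intro add_mono mult_left_mono) auto
    also have "\<dots> = 1 * (\<epsilon> * (2 * T))" by simp
    also have "\<dots> \<le> 2 * pi * (\<epsilon> * (2 * T))" using pi_ge_two T1 \<epsilon> by (intro mult_right_mono) auto
    finally show ?thesis by (simp add: mult_ac)
  qed
  then have "eventually (\<lambda>T. integral {-T..T} (\<lambda>t. norm (F (Complex \<sigma> t) - P t)) \<le> \<epsilon> * (2 * T)) at_top"
    unfolding eventually_at_top_linorder by blast
  with tP show ?thesis by blast
qed

end

section \<open>Existence of the Jessen function\<close>

context normalised_dirichlet_function
begin

lemma finite_zeros:
  assumes "compact K" "K \<subseteq> {s. Re s > 0}"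
  shows "finite {s \<in> K. F s = 0}"
proof (cases "F constant_on {s. Re s > 0}")
  case True
  then obtain c where c: "\<And>s. Re s > 0 \<Longrightarrow> F s = c" by (auto simp: constant_on_def)
  have "c \<noteq> 0" using nonzero_right[of "of_real X"] c[of "of_real X"] X by auto
  then have "{s \<in> K. F s = 0} = {}" using c assms(2) by auto
  then show ?thesis by (simp only: finite.emptyI)
next
  case False
  then show ?thesis
    using assms hol half_plane_open convex_connected[OF half_plane_convex]
    by (intro holomorphic_compact_finite_zeros[of F "{s. Re s > 0}"]) auto
qed

lemma finite_zeros_on_line:
  assumes "\<sigma> > 0"
  shows "finite {t \<in> {p..q}. F (Complex \<sigma> t) = 0}"
proof -
  have "compact (Complex \<sigma> ` {p..q})"
    by (intro compact_continuous_image continuous_intros) auto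
  then have "finite {s \<in> Complex \<sigma> ` {p..q}. F s = 0}"
    using assms by (intro finite_zeros) auto
  then have "finite (Im ` {s \<in> Complex \<sigma> ` {p..q}. F s = 0})" by simp
  moreover have "{t \<in> {p..q}. F (Complex \<sigma> t) = 0} \<subseteq> Im ` {s \<in> Complex \<sigma> ` {p..q}. F s = 0}"
    by force
  ultimately show ?thesis using finite_subset by blast
qed

lemma log_measurable:
  assumes "\<sigma> > 0"
  shows "(\<lambda>t. ln (norm (F (Complex \<sigma> t)))) \<in> borel_measurable (lebesgue_on {p..q})"
proof -
  have "continuous_on {p..q} (\<lambda>t. F (Complex \<sigma> t))"
    using assms by (intro contF_compose continuous_intros) auto
  then have "(\<lambda>t. F (Complex \<sigma> t)) \<in> borel_measurable (lebesgue_on {p..q})"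
    by (rule continuous_imp_measurable_on_sets_lebesgue) simp
  then show ?thesis by measurable
qed

text \<open>Sum the local estimates over unit intervals.\<close>

lemma log_square_mean_bound:
  assumes \<kappa>: "\<kappa> > 0" and X1: "X1 \<ge> X" "X1 \<ge> 2 / \<kappa> + \<kappa>"
  shows "\<exists>C>0. \<forall>\<sigma> T. \<kappa> \<le> \<sigma> \<longrightarrow> \<sigma> \<le> X1 \<longrightarrow> 1 \<le> T \<longrightarrow>
     (\<lambda>t. ln (norm (F (Complex \<sigma> t)))) absolutely_integrable_on {-T..T} \<and>
     (\<lambda>t. (ln (norm (F (Complex \<sigma> t))))\<^sup>2) integrable_on {-T..T} \<and>
     integral {-T..T} (\<lambda>t. (ln (norm (F (Complex \<sigma> t))))\<^sup>2) \<le> C * T"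
proof -
  obtain C M where C: "C > 0" and Msum: "\<And>N::nat. N \<ge> 1 \<Longrightarrow> (\<Sum>m\<in>{-int N..<int N}. (M (real_of_int m))\<^sup>2) \<le> C * real N"
    and seg: "\<And>y w e p q. norm e = 1 \<Longrightarrow> p \<le> q \<Longrightarrow>
        (\<forall>t\<in>{p..q}. \<kappa> \<le> Re (w + of_real t * e) \<and> Re (w + of_real t * e) \<le> X1 \<and> \<bar>Im (w + of_real t * e) - y\<bar> \<le> 1) \<Longrightarrow>
     (\<lambda>t. (ln (norm (F (w + of_real t * e))))\<^sup>2) integrable_on {p..q} \<and>
     integral {p..q} (\<lambda>t. (ln (norm (F (w + of_real t * e))))\<^sup>2) \<le> C * (M y)\<^sup>2"
    using strip_log_bound[OF \<kappa> X1] by blast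
  show ?thesis
  proof (intro exI[of _ "2 * C\<^sup>2"] conjI allI impI)
    show "2 * C\<^sup>2 > 0" using C by simp
    fix \<sigma> T :: real assume \<sigma>: "\<kappa> \<le> \<sigma>" "\<sigma> \<le> X1" and T: "1 \<le> T"
    define u where "u = (\<lambda>t. ln (norm (F (Complex \<sigma> t))))"
    have eq: "Complex \<sigma> t = of_real \<sigma> + of_real t * \<i>" for t by (simp add: complex_eq_iff)
    have unit: "(\<lambda>t. (u t)\<^sup>2) integrable_on {real_of_int k..real_of_int k + 1} \<and>
       integral {real_of_int k..real_of_int k + 1} (\<lambda>t. (u t)\<^sup>2) \<le> C * (M (real_of_int k))\<^sup>2" for k
      unfolding u_def eq by (rule seg) (use \<sigma> in auto)
    define N where "N = nat \<lceil>T\<rceil>"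
    have N: "N \<ge> 1" "T \<le> real N" "real N \<le> 2 * T" using T unfolding N_def by linarith+
    have hi: "((\<lambda>t. (u t)\<^sup>2) has_integral (\<Sum>k\<in>{-int N..<int N}. integral {real_of_int k..real_of_int k + 1} (\<lambda>t. (u t)\<^sup>2))) {-real N..real N}"
      using has_integral_unit_intervals[of "-int N" "int N" "\<lambda>t. (u t)\<^sup>2"] unit by simp
    then have i: "(\<lambda>t. (u t)\<^sup>2) integrable_on {-T..T}"
      using integrable_subinterval_real[of "\<lambda>t. (u t)\<^sup>2" "-real N" "real N" "-T" T] N by auto
    then show "(\<lambda>t. (ln (norm (F (Complex \<sigma> t))))\<^sup>2) integrable_on {-T..T}" by (simp add: u_def)
    have "integral {-T..T} (\<lambda>t. (u t)\<^sup>2) \<le> integral {-real N..real N} (\<lambda>t. (u t)\<^sup>2)"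
      using N hi i by (intro integral_subset_le) auto
    also have "\<dots> = (\<Sum>k\<in>{-int N..<int N}. integral {real_of_int k..real_of_int k + 1} (\<lambda>t. (u t)\<^sup>2))"
      using hi by (rule integral_unique)
    also have "\<dots> \<le> (\<Sum>k\<in>{-int N..<int N}. C * (M (real_of_int k))\<^sup>2)" using unit by (intro sum_mono) blast
    also have "\<dots> \<le> C * (C * real N)" unfolding sum_distrib_left[symmetric] using C by (intro mult_left_mono Msum N) auto
    also have "\<dots> \<le> C * (C * (2 * T))" using C N by (intro mult_left_mono) auto
    finally show "integral {-T..T} (\<lambda>t. (ln (norm (F (Complex \<sigma> t))))\<^sup>2) \<le> 2 * C\<^sup>2 * T"
      by (simp add: u_def power2_eq_square mult_ac)
    have "u absolutely_integrable_on {-T..T}"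
    proof (rule measurable_bounded_by_integrable_imp_absolutely_integrable)
      show "u \<in> borel_measurable (lebesgue_on {-T..T})" unfolding u_def using \<sigma> \<kappa> by (intro log_measurable) auto
      show "(\<lambda>t. 1 + (u t)\<^sup>2) integrable_on {-T..T}" using i by (intro integrable_add integrable_const_ivl)
      fix t
      have "0 \<le> (\<bar>u t\<bar> - 1)\<^sup>2 + \<bar>u t\<bar>" by simp
      then show "norm (u t) \<le> 1 + (u t)\<^sup>2" unfolding power2_diff by simp
    qed simp
    then show "(\<lambda>t. ln (norm (F (Complex \<sigma> t)))) absolutely_integrable_on {-T..T}" by (simp add: u_def)
  qed
qed

lemma log_line_integrable:
  assumes "\<sigma> > 0"
  shows "(\<lambda>t. ln (norm (F (Complex \<sigma> t)))) absolutely_integrable_on {p..q}"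
proof -
  define T where "T = max 1 (max \<bar>p\<bar> \<bar>q\<bar>)"
  obtain C where "\<forall>\<sigma>' T. \<sigma> \<le> \<sigma>' \<longrightarrow> \<sigma>' \<le> max X (2 / \<sigma> + \<sigma>) \<longrightarrow> 1 \<le> T \<longrightarrow>
     (\<lambda>t. ln (norm (F (Complex \<sigma>' t)))) absolutely_integrable_on {-T..T}"
    using log_square_mean_bound[OF assms, of "max X (2 / \<sigma> + \<sigma>)"] by fastforce
  moreover have "\<sigma> \<le> max X (2 / \<sigma> + \<sigma>)" using assms by (simp add: le_max_iff_disj)
  ultimately have "(\<lambda>t. ln (norm (F (Complex \<sigma> t)))) absolutely_integrable_on {-T..T}"
    by (simp add: T_def)
  then show ?thesis
    by (rule set_integrable_subset) (auto simp: T_def)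
qed

text \<open>Truncate the logarithm at \<open>\<eta> = exp(-\<Lambda>)\<close>. Where \<open>\<bar>F\<bar> < \<eta>\<close> one has \<open>\<bar>u\<bar> \<ge> \<Lambda>\<close>, so the error is at most \<open>u\<^sup>2 / \<Lambda>\<close>, whose
  mean is small for large \<open>\<Lambda>\<close>. The truncated logarithm is Lipschitz, so \<open>F\<close> may be replaced by a
  trigonometric polynomial close to it in mean.\<close>

lemma log_mean_exists:
  assumes \<sigma>: "\<sigma> > 0"
  shows "\<exists>L. ((\<lambda>T. integral {-T..T} (\<lambda>t. ln (norm (F (Complex \<sigma> t)))) / (2 * T)) \<longlongrightarrow> L) at_top"
proof (rule tendsto_of_approximations)
  fix \<epsilon> :: real assume \<epsilon>: "\<epsilon> > 0"
  obtain C where C: "C > 0" and sq: "\<And>T. 1 \<le> T \<Longrightarrow>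
     (\<lambda>t. (ln (norm (F (Complex \<sigma> t))))\<^sup>2) integrable_on {-T..T} \<and>
     integral {-T..T} (\<lambda>t. (ln (norm (F (Complex \<sigma> t))))\<^sup>2) \<le> C * T"
  proof -
    have "\<sigma> \<le> max X (2 / \<sigma> + \<sigma>)" using \<sigma> by (simp add: le_max_iff_disj)
    then show ?thesis using log_square_mean_bound[OF \<sigma>, of "max X (2 / \<sigma> + \<sigma>)"] that by fastforce
  qed
  define \<Lambda> where "\<Lambda> = C / \<epsilon>"
  have \<Lambda>: "\<Lambda> > 0" using C \<epsilon> by (simp add: \<Lambda>_def)
  define \<eta> where "\<eta> = exp (- \<Lambda>)"
  have \<eta>: "\<eta> > 0" "\<eta> < 1" "ln \<eta> = - \<Lambda>" using \<Lambda> by (auto simp: \<eta>_def)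
  define G where "G = (\<lambda>z::complex. ln (max (norm z) \<eta>))"
  have contG: "continuous_on S G" for S unfolding G_def
    using \<eta> by (intro continuous_intros continuous_on_ln) (auto simp: max_def)
  obtain P where P: "trig_poly P" and PF: "eventually (\<lambda>T. integral {-T..T} (\<lambda>t. norm (F (Complex \<sigma> t) - P t)) \<le> (\<eta> * \<epsilon> / 2) * (2 * T)) at_top"
    using trig_poly_mean_approximation[OF \<sigma>, of "\<eta> * \<epsilon> / 2"] \<eta> \<epsilon> by auto
  obtain L where L: "((\<lambda>T. integral {-T..T} (\<lambda>t. G (P t)) / (2 * T)) \<longlongrightarrow> L) at_top"
    using mean_continuous_trig_poly[OF P contG] by blast
  define u where "u = (\<lambda>t. ln (norm (F (Complex \<sigma> t))))"
  have "eventually (\<lambda>T. \<bar>integral {-T..T} u / (2 * T) - integral {-T..T} (\<lambda>t. G (P t)) / (2 * T)\<bar> \<le> \<epsilon>) at_top"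
    using PF eventually_ge_at_top[of 1]
  proof eventually_elim
    case (elim T)
    define Z where "Z = {t \<in> {-T..T}. F (Complex \<sigma> t) = 0}"
    have Z: "finite Z" unfolding Z_def by (rule finite_zeros_on_line[OF \<sigma>])
    (* At a zero of F both u and h are 0, so the pointwise estimate below has no exceptions. *)
    define h where "h = (\<lambda>t. if t \<in> Z then 0 else G (F (Complex \<sigma> t)))"
    have contF': "continuous_on {-T..T} (\<lambda>t. F (Complex \<sigma> t))"
      using \<sigma> by (intro contF_compose continuous_intros) auto
    have GFi: "(\<lambda>t. G (F (Complex \<sigma> t))) integrable_on {-T..T}"
      by (intro integrable_continuous_interval continuous_on_compose2[OF contG contF']) auto
    have GPi: "(\<lambda>t. G (P t)) integrable_on {-T..T}"
      by (intro integrable_continuous_interval continuous_on_compose2[OF contG trig_poly_continuous[OF P]]) auto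
    have hi: "h integrable_on {-T..T}"
      by (rule integrable_spike_finite[OF Z _ GFi]) (simp add: h_def)
    have hI: "integral {-T..T} h = integral {-T..T} (\<lambda>t. G (F (Complex \<sigma> t)))"
      by (rule integral_spike[OF negligible_finite[OF Z]]) (simp add: h_def)
    have ui: "u integrable_on {-T..T}"
      using log_line_integrable[OF \<sigma>, of "-T" T] unfolding u_def by (rule set_lebesgue_integral_eq_integral)
    have u2: "(\<lambda>t. (u t)\<^sup>2) integrable_on {-T..T}" "integral {-T..T} (\<lambda>t. (u t)\<^sup>2) \<le> C * T"
      using sq[of T] elim by (auto simp: u_def)
    have "norm (integral {-T..T} (\<lambda>t. u t - h t)) \<le> integral {-T..T} (\<lambda>t. (u t)\<^sup>2 / \<Lambda>)"
    proof (rule integral_norm_bound_integral[OF integrable_diff[OF ui hi]])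
      show "(\<lambda>t. (u t)\<^sup>2 / \<Lambda>) integrable_on {-T..T}" using u2(1) by (rule integrable_on_divide)
      fix t assume t: "t \<in> {-T..T}"
      show "norm (u t - h t) \<le> (u t)\<^sup>2 / \<Lambda>"
      proof (cases "t \<in> Z")
        case True
        then have "u t = 0" "h t = 0" by (auto simp: u_def h_def Z_def)
        then show ?thesis by simp
      next
        case False
        then have nz: "norm (F (Complex \<sigma> t)) > 0" using t by (auto simp: Z_def)
        have h: "h t = ln (max (norm (F (Complex \<sigma> t))) \<eta>)" using False by (simp add: h_def G_def)
        show ?thesis
        proof (cases "norm (F (Complex \<sigma> t)) \<ge> \<eta>")
          case True
          then show ?thesis using h \<Lambda> by (simp add: u_def max_def)
        next
          case c: False
          then have "u t \<le> ln \<eta>" using nz unfolding u_def by (intro ln_mono) auto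
          then have ul: "u t \<le> - \<Lambda>" using \<eta> by simp
          have "norm (u t - h t) \<le> \<bar>u t\<bar>" using h c ul \<Lambda> \<eta> by (simp add: max_def)
          also have "\<bar>u t\<bar> \<le> \<bar>u t\<bar> * \<bar>u t\<bar> / \<Lambda>"
          proof -
            have "\<bar>u t\<bar> * \<Lambda> \<le> \<bar>u t\<bar> * \<bar>u t\<bar>" using ul by (intro mult_left_mono) auto
            then show ?thesis using \<Lambda> by (simp only: pos_le_divide_eq)
          qed
          finally show ?thesis by (simp add: power2_eq_square)
        qed
      qed
    qed
    also have "\<dots> \<le> C * T / \<Lambda>" using u2(2) \<Lambda> by (simp add: divide_right_mono)
    also have "\<dots> = \<epsilon> * T" using C \<epsilon> by (simp add: \<Lambda>_def)
    finally have d1: "\<bar>integral {-T..T} u - integral {-T..T} (\<lambda>t. G (F (Complex \<sigma> t)))\<bar> \<le> \<epsilon> * T"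
      by (simp add: integral_diff[OF ui hi] hI)
    have Di: "(\<lambda>t. norm (F (Complex \<sigma> t) - P t)) integrable_on {-T..T}"
      by (intro integrable_continuous_interval continuous_intros contF' trig_poly_continuous P)
    have "norm (integral {-T..T} (\<lambda>t. G (F (Complex \<sigma> t)) - G (P t))) \<le> integral {-T..T} (\<lambda>t. norm (F (Complex \<sigma> t) - P t) / \<eta>)"
    proof (rule integral_norm_bound_integral[OF integrable_diff[OF GFi GPi]])
      show "(\<lambda>t. norm (F (Complex \<sigma> t) - P t) / \<eta>) integrable_on {-T..T}" using Di by (rule integrable_on_divide)
      fix t
      have "norm (G (F (Complex \<sigma> t)) - G (P t)) \<le> \<bar>norm (F (Complex \<sigma> t)) - norm (P t)\<bar> / \<eta>"
        unfolding G_def real_norm_def by (rule abs_ln_max_diff_le[OF \<eta>(1)])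
      also have "\<dots> \<le> norm (F (Complex \<sigma> t) - P t) / \<eta>"
        using \<eta> norm_triangle_ineq3[of "F (Complex \<sigma> t)" "P t"] by (intro divide_right_mono) auto
      finally show "norm (G (F (Complex \<sigma> t)) - G (P t)) \<le> norm (F (Complex \<sigma> t) - P t) / \<eta>" .
    qed
    also have "\<dots> = integral {-T..T} (\<lambda>t. norm (F (Complex \<sigma> t) - P t)) / \<eta>" by simp
    also have "\<dots> \<le> (\<eta> * \<epsilon> / 2) * (2 * T) / \<eta>" using elim \<eta> by (intro divide_right_mono) auto
    also have "\<dots> = \<epsilon> * T" using \<eta> by simp
    finally have d2: "\<bar>integral {-T..T} (\<lambda>t. G (F (Complex \<sigma> t))) - integral {-T..T} (\<lambda>t. G (P t))\<bar> \<le> \<epsilon> * T"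
      by (simp add: integral_diff[OF GFi GPi])
    have "\<bar>integral {-T..T} u - integral {-T..T} (\<lambda>t. G (P t))\<bar> \<le> \<epsilon> * (2 * T)" using d1 d2 by linarith
    moreover have "T > 0" using elim by simp
    ultimately show ?case by (simp add: diff_divide_distrib[symmetric] divide_le_eq)
  qed
  with L show "\<exists>g L. (g \<longlongrightarrow> L) at_top \<and> eventually (\<lambda>T. \<bar>integral {-T..T} (\<lambda>t. ln (norm (F (Complex \<sigma> t)))) / (2 * T) - g T\<bar> \<le> \<epsilon>) at_top"
    unfolding u_def by blast
qed

end

section \<open>The logarithmic potential of one zero\<close>

text \<open>The cut-off equals \<open>1\<close> up to height \<open>T\<close> and \<open>0\<close> from height \<open>T + 1\<close> on. It is piecewise linear, so integrating
  by parts twice against it leaves only values of the second antiderivative at the four corners.\<close>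

definition trapezoid :: "real \<Rightarrow> real \<Rightarrow> real" where
  "trapezoid T y = max 0 (min 1 (T + 1 - \<bar>y\<bar>))"

lemma trapezoid_bounds: "0 \<le> trapezoid T y" "trapezoid T y \<le> 1"
  by (auto simp: trapezoid_def)

lemma trapezoid_second_difference:
  assumes "T \<ge> 0"
  shows "\<bar>T + 1 - \<eta>\<bar> + \<bar>-T - 1 - \<eta>\<bar> - \<bar>T - \<eta>\<bar> - \<bar>-T - \<eta>\<bar> = 2 * trapezoid T \<eta>"
  using assms by (auto simp: trapezoid_def abs_if max_def min_def)

lemma has_integral_linear_weight:
  fixes W P V :: "real \<Rightarrow> real"
  assumes S: "finite S" and ab: "a \<le> b"
    and W: "continuous_on {a..b} W" "\<And>y. y \<in> {a<..<b} - S \<Longrightarrow> (W has_real_derivative P y) (at y)"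
    and P: "continuous_on {a..b} P" "\<And>y. y \<in> {a<..<b} - S \<Longrightarrow> (P has_real_derivative - V y) (at y)"
  shows "((\<lambda>y. (\<alpha> + \<beta> * y) * V y) has_integral
     ((\<beta> * W b - (\<alpha> + \<beta> * b) * P b) - (\<beta> * W a - (\<alpha> + \<beta> * a) * P a))) {a..b}"
proof (rule fundamental_theorem_of_calculus_interior_strong[OF S ab])
  show "continuous_on {a..b} (\<lambda>y. \<beta> * W y - (\<alpha> + \<beta> * y) * P y)"
    by (intro continuous_intros W P)
  fix y assume y: "y \<in> {a<..<b} - S"
  show "((\<lambda>y. \<beta> * W y - (\<alpha> + \<beta> * y) * P y) has_vector_derivative (\<alpha> + \<beta> * y) * V y) (at y)"
    unfolding has_real_derivative_iff_has_vector_derivative[symmetric]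
    using W(2)[OF y] P(2)[OF y] by (auto intro!: derivative_eq_intros simp: algebra_simps)
qed

text \<open>Here \<open>-W\<close> is a second antiderivative of \<open>V\<close> away from finitely many points. On each linear piece the
  \<open>P\<close>-terms at the ends cancel against those of the neighbouring piece.\<close>

lemma has_integral_trapezoid:
  fixes W P V :: "real \<Rightarrow> real"
  assumes S: "finite S" and T: "T \<ge> 0"
    and W: "continuous_on {-T-1..T+1} W" "\<And>y. y \<in> {-T-1<..<T+1} - S \<Longrightarrow> (W has_real_derivative P y) (at y)"
    and P: "continuous_on {-T-1..T+1} P" "\<And>y. y \<in> {-T-1<..<T+1} - S \<Longrightarrow> (P has_real_derivative - V y) (at y)"
  shows "((\<lambda>y. trapezoid T y * V y) has_integral (W (-T) - W (-T-1) - W (T+1) + W T)) {-T-1..T+1}"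
proof -
  have sub: "((\<lambda>y. (\<alpha> + \<beta> * y) * V y) has_integral
     ((\<beta> * W b - (\<alpha> + \<beta> * b) * P b) - (\<beta> * W a - (\<alpha> + \<beta> * a) * P a))) {a..b}"
    if "-T-1 \<le> a" "a \<le> b" "b \<le> T+1" for a b \<alpha> \<beta>
  proof (rule has_integral_linear_weight[OF S that(2)])
    show "continuous_on {a..b} W" "continuous_on {a..b} P"
      using that by (auto intro!: continuous_on_subset[OF W(1)] continuous_on_subset[OF P(1)])
    fix y assume "y \<in> {a<..<b} - S"
    then have "y \<in> {-T-1<..<T+1} - S" using that by auto
    from W(2)[OF this] P(2)[OF this]
    show "(W has_real_derivative P y) (at y)" "(P has_real_derivative - V y) (at y)" .
  qed
  have i1: "((\<lambda>y. trapezoid T y * V y) has_integral (W (-T) - P (-T) - W (-T-1))) {-T-1..-T}"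
  proof -
    have e: "((T + 1) + 1 * y) * V y = trapezoid T y * V y" if "y \<in> {-T-1..-T}" for y
    proof -
      have "(T + 1) + 1 * y = trapezoid T y" using that T by (auto simp: trapezoid_def max_def min_def abs_if)
      then show ?thesis by simp
    qed
    have "((\<lambda>y. trapezoid T y * V y) has_integral ((1 * W (-T) - ((T + 1) + 1 * (-T)) * P (-T)) - (1 * W (-T-1) - ((T + 1) + 1 * (-T-1)) * P (-T-1)))) {-T-1..-T}"
      by (rule has_integral_eq[OF e sub]) (use T in auto)
    then show ?thesis by simp
  qed
  have i2: "((\<lambda>y. trapezoid T y * V y) has_integral (- P T + P (-T))) {-T..T}"
  proof -
    have e: "(1 + 0 * y) * V y = trapezoid T y * V y" if "y \<in> {-T..T}" for y
    proof -
      have "1 + 0 * y = trapezoid T y" using that T by (auto simp: trapezoid_def max_def min_def abs_if)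
      then show ?thesis by simp
    qed
    have "((\<lambda>y. trapezoid T y * V y) has_integral ((0 * W (T) - (1 + 0 * (T)) * P (T)) - (0 * W (-T) - (1 + 0 * (-T)) * P (-T)))) {-T..T}"
      by (rule has_integral_eq[OF e sub]) (use T in auto)
    then show ?thesis by simp
  qed
  have i3: "((\<lambda>y. trapezoid T y * V y) has_integral (- W (T+1) + W T + P T)) {T..T+1}"
  proof -
    have e: "((T + 1) + (-1) * y) * V y = trapezoid T y * V y" if "y \<in> {T..T+1}" for y
    proof -
      have "(T + 1) + (-1) * y = trapezoid T y" using that T by (auto simp: trapezoid_def max_def min_def abs_if)
      then show ?thesis by simp
    qed
    have "((\<lambda>y. trapezoid T y * V y) has_integral (((-1) * W (T+1) - ((T + 1) + (-1) * (T+1)) * P (T+1)) - ((-1) * W (T) - ((T + 1) + (-1) * (T)) * P (T)))) {T..T+1}"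
      by (rule has_integral_eq[OF e sub]) (use T in auto)
    then show ?thesis by (simp add: algebra_simps)
  qed
  have "((\<lambda>y. trapezoid T y * V y) has_integral ((W (-T) - P (-T) - W (-T-1)) + (- P T + P (-T)))) {-T-1..T}"
    by (rule has_integral_combine[OF _ _ i1 i2]) (use T in auto)
  then have "((\<lambda>y. trapezoid T y * V y) has_integral ((W (-T) - P (-T) - W (-T-1)) + (- P T + P (-T)) + (- W (T+1) + W T + P T))) {-T-1..T+1}"
    by (rule has_integral_combine[rotated 2, OF _ i3]) (use T in auto)
  then show ?thesis by (simp add: algebra_simps)
qed

lemma continuous_x_ln_abs: "continuous_on S (\<lambda>x::real. x * ln \<bar>x\<bar>)"
proof -
  have "isCont (\<lambda>x::real. x * ln \<bar>x\<bar>) x" for x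
  proof (cases "x = 0")
    case False
    then show ?thesis by (intro continuous_intros) auto
  next
    case True
    have "((\<lambda>x::real. x * ln \<bar>x\<bar>) \<longlongrightarrow> 0) (at 0)"
    proof (rule Lim_null_comparison)
      have "((\<lambda>x::real. 2 * sqrt \<bar>x\<bar>) \<longlongrightarrow> 2 * sqrt \<bar>0\<bar>) (at 0)" by (intro tendsto_intros)
      then show "((\<lambda>x::real. 2 * sqrt \<bar>x\<bar>) \<longlongrightarrow> 0) (at 0)" by simp
      have "eventually (\<lambda>x::real. x \<in> ball 0 1 - {0}) (at 0)"
        by (intro eventually_at_in_open) auto
      then show "eventually (\<lambda>x::real. norm (x * ln \<bar>x\<bar>) \<le> 2 * sqrt \<bar>x\<bar>) (at 0)"
      proof eventually_elim
        case (elim x)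
        then have x: "\<bar>x\<bar> > 0" "\<bar>x\<bar> < 1" by auto
        have "- ln \<bar>x\<bar> = 2 * ln (1 / sqrt \<bar>x\<bar>)" using x by (simp add: ln_div ln_sqrt)
        also have "\<dots> \<le> 2 * (1 / sqrt \<bar>x\<bar>)" using x ln_bound[of "1 / sqrt \<bar>x\<bar>"] by simp
        finally have "\<bar>x\<bar> * (- ln \<bar>x\<bar>) \<le> \<bar>x\<bar> * (2 * (1 / sqrt \<bar>x\<bar>))" using x by (intro mult_left_mono) auto
        also have "\<dots> = 2 * sqrt \<bar>x\<bar>" using x by (simp add: field_simps)
        finally show ?case using x by (simp add: abs_mult)
      qed
    qed
    then show ?thesis using True by (simp add: isCont_def)
  qed
  then show ?thesis by (simp add: continuous_at_imp_continuous_on)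
qed

lemma continuous_x_ln_abs':
  assumes "continuous_on S g" shows "continuous_on S (\<lambda>x. g x * ln \<bar>g x :: real\<bar>)"
  using continuous_on_compose2[OF continuous_x_ln_abs[of UNIV] assms] by simp

text \<open>An antiderivative of \<open>(X + c) ln \<bar>X + iY\<bar>\<close> in \<open>X\<close>; at \<open>Y = 0\<close> the last term vanishes because \<open>X / 0 = 0\<close>.\<close>

definition log_primitive :: "real \<Rightarrow> real \<Rightarrow> real \<Rightarrow> real" where
  "log_primitive c X Y = ((X\<^sup>2 + Y\<^sup>2) * ln (X\<^sup>2 + Y\<^sup>2) - (X\<^sup>2 + Y\<^sup>2)) / 4
      + c * (X * ln (X\<^sup>2 + Y\<^sup>2) / 2 - X + Y * arctan (X / Y))"

lemma has_integral_log_primitive: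
  assumes "a \<le> b"
  shows "((\<lambda>X. (X + c) * (ln (X\<^sup>2 + Y\<^sup>2) / 2)) has_integral (log_primitive c b Y - log_primitive c a Y)) {a..b}"
proof (rule fundamental_theorem_of_calculus_interior_strong[of "{0}"])
  have "continuous_on {a..b} (\<lambda>X. (X\<^sup>2 + Y\<^sup>2) * ln \<bar>X\<^sup>2 + Y\<^sup>2\<bar>)"
    by (intro continuous_x_ln_abs' continuous_intros)
  then have c1: "continuous_on {a..b} (\<lambda>X. (X\<^sup>2 + Y\<^sup>2) * ln (X\<^sup>2 + Y\<^sup>2))" by simp
  have c2: "continuous_on {a..b} (\<lambda>X. X * ln (X\<^sup>2 + Y\<^sup>2))"
  proof (cases "Y = 0")
    case True
    have "continuous_on {a..b} (\<lambda>X. 2 * (X * ln \<bar>X\<bar>))" by (intro continuous_intros continuous_x_ln_abs)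
    moreover have "2 * (X * ln \<bar>X\<bar>) = X * ln (X\<^sup>2 + Y\<^sup>2)" for X
      using ln_realpow[of "\<bar>X\<bar>" 2] by (cases "X = 0") (auto simp: True)
    ultimately show ?thesis by simp
  next
    case False
    then have "X\<^sup>2 + Y\<^sup>2 \<noteq> 0" for X by (simp add: sum_power2_eq_zero_iff)
    then show ?thesis by (intro continuous_intros) auto
  qed
  show "continuous_on {a..b} (\<lambda>X. log_primitive c X Y)"
    unfolding log_primitive_def divide_inverse[of _ Y] by (intro continuous_intros c1 c2) auto
  fix X assume X: "X \<in> {a<..<b} - {0}"
  define q where "q = X\<^sup>2 + Y\<^sup>2"
  have q: "q > 0" using X by (auto simp: q_def sum_power2_gt_zero_iff)
  have sq: "((\<lambda>X. X\<^sup>2 + Y\<^sup>2) has_real_derivative 2 * X) (at X)" by (auto intro!: derivative_eq_intros)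
  have lnq: "((\<lambda>X. ln (X\<^sup>2 + Y\<^sup>2)) has_real_derivative (2 * X / q)) (at X)"
    using DERIV_chain2[OF DERIV_ln_divide[OF q[unfolded q_def]] sq] by (simp add: q_def)
  have arc: "((\<lambda>X. Y * arctan (X / Y)) has_real_derivative Y\<^sup>2 / q) (at X)"
  proof (cases "Y = 0")
    case False
    have "((\<lambda>X. Y * arctan (X / Y)) has_real_derivative Y * ((1 / Y) * inverse (1 + (X / Y)\<^sup>2))) (at X)"
      using False by (auto intro!: derivative_eq_intros)
    moreover have "Y * ((1 / Y) * inverse (1 + (X / Y)\<^sup>2)) = Y\<^sup>2 / q"
      using False q by (simp add: q_def power_divide divide_simps power2_eq_square)
    ultimately show ?thesis by simp
  qed simp
  have d1: "((\<lambda>X. ((X\<^sup>2 + Y\<^sup>2) * ln (X\<^sup>2 + Y\<^sup>2) - (X\<^sup>2 + Y\<^sup>2)) / 4) has_real_derivative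
     ((2 * X * ln q + (2 * X / q) * q - 2 * X) / 4)) (at X)"
    by (rule DERIV_cdivide[OF DERIV_diff[OF DERIV_mult[OF sq lnq, folded q_def] sq]])
  have d2: "((\<lambda>X. X * ln (X\<^sup>2 + Y\<^sup>2) / 2 - X) has_real_derivative ((1 * ln q + (2 * X / q) * X) / 2 - 1)) (at X)"
    by (rule DERIV_diff[OF DERIV_cdivide[OF DERIV_mult[OF DERIV_ident lnq, folded q_def]] DERIV_ident])
  have "((\<lambda>X. log_primitive c X Y) has_real_derivative
      ((2 * X * ln q + (2 * X / q) * q - 2 * X) / 4 + c * ((1 * ln q + (2 * X / q) * X) / 2 - 1 + Y\<^sup>2 / q))) (at X)"
    unfolding log_primitive_def by (rule DERIV_add[OF d1 DERIV_cmult[OF DERIV_add[OF d2 arc]]])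
  moreover have "(1 * ln q + (2 * X / q) * X) / 2 - 1 + Y\<^sup>2 / q = ln q / 2"
  proof -
    define A B where "A = X\<^sup>2 / q" and "B = Y\<^sup>2 / q"
    have "A + B = q / q" by (simp only: A_def B_def q_def add_divide_distrib)
    then have AB: "A + B = 1" using q by simp
    have "(2 * X / q) * X = 2 * A" by (simp add: A_def power2_eq_square)
    then have "(1 * ln q + (2 * X / q) * X) / 2 - 1 + Y\<^sup>2 / q = (1 * ln q + 2 * A) / 2 - 1 + B"
      by (simp only: B_def)
    also have "\<dots> = ln q / 2"
    proof -
      have "B = 1 - A" using AB by simp
      then show ?thesis by (simp add: add_divide_distrib)
    qed
    finally show ?thesis .
  qed
  moreover have "(2 * X * ln q + (2 * X / q) * q - 2 * X) / 4 = X * (ln q / 2)" using q by simp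
  ultimately have "((\<lambda>X. log_primitive c X Y) has_real_derivative (X + c) * (ln q / 2)) (at X)"
    by (simp only: distrib_right)
  then show "((\<lambda>X. log_primitive c X Y) has_vector_derivative (X + c) * (ln (X\<^sup>2 + Y\<^sup>2) / 2)) (at X)"
    by (simp add: q_def has_real_derivative_iff_has_vector_derivative)
qed (use assms in auto)

text \<open>As a function of \<open>Y\<close>, \<open>log_primitive\<close> has a corner at \<open>0\<close>, coming from \<open>Y arctan(X / Y)\<close>. Rewriting the arctangent
  with its reciprocal argument isolates the corner as a multiple of \<open>\<bar>Y\<bar>\<close>; this is what remains.\<close>

definition log_primitive_smooth :: "real \<Rightarrow> real \<Rightarrow> real \<Rightarrow> real" where
  "log_primitive_smooth c X Y = ((X\<^sup>2 + Y\<^sup>2) * ln (X\<^sup>2 + Y\<^sup>2) - (X\<^sup>2 + Y\<^sup>2)) / 4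
      + c * (X * ln (X\<^sup>2 + Y\<^sup>2) / 2 - X - Y * arctan (Y / X))"

lemma log_primitive_eq:
  assumes "X \<noteq> 0"
  shows "log_primitive c X Y = log_primitive_smooth c X Y + c * (pi / 2) * sgn X * \<bar>Y\<bar>"
proof (cases "Y = 0")
  case False
  have "Y / X \<noteq> 0" using False assms by simp
  from Transcendental.arctan_inverse[OF this] have e: "arctan (X / Y) = sgn (Y / X) * pi / 2 - arctan (Y / X)"
    by (simp only: divide_divide_eq_right mult_1)
  have sg: "sgn (Y / X) = sgn Y * sgn X" by (auto simp: sgn_if divide_less_0_iff zero_less_divide_iff)
  have "Y * arctan (X / Y) = (pi / 2) * sgn X * (Y * sgn Y) - Y * arctan (Y / X)"
    unfolding e sg by (simp add: right_diff_distrib mult_ac)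
  moreover have "Y * sgn Y = \<bar>Y\<bar>" by (simp add: abs_sgn)
  ultimately have "Y * arctan (X / Y) = (pi / 2) * sgn X * \<bar>Y\<bar> - Y * arctan (Y / X)" by (simp only:)
  then show ?thesis unfolding log_primitive_def log_primitive_smooth_def by (simp only:) (simp add: algebra_simps)
qed (simp add: log_primitive_def log_primitive_smooth_def)

lemma log_primitive_smooth_deriv:
  assumes "X \<noteq> 0 \<or> Y \<noteq> 0 \<and> c = 0"
  shows "((\<lambda>Y. log_primitive_smooth c X Y) has_real_derivative (Y * ln (X\<^sup>2 + Y\<^sup>2) / 2 - c * arctan (Y / X))) (at Y)"
    and "((\<lambda>Y. Y * ln (X\<^sup>2 + Y\<^sup>2) / 2 - c * arctan (Y / X)) has_real_derivative
       (ln (X\<^sup>2 + Y\<^sup>2) / 2 + Y\<^sup>2 / (X\<^sup>2 + Y\<^sup>2) - c * (X / (X\<^sup>2 + Y\<^sup>2)))) (at Y)"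
proof -
  define q where "q = X\<^sup>2 + Y\<^sup>2"
  have q: "q > 0" using assms by (auto simp: q_def sum_power2_gt_zero_iff)
  have arc: "((\<lambda>Y. c * arctan (Y / X)) has_real_derivative c * (X / q)) (at Y)"
  proof (cases "c = 0")
    case False
    then have X: "X \<noteq> 0" using assms by simp
    have eq: "(1 / X) * inverse (1 + (Y / X)\<^sup>2) = X / q"
      using X q by (simp add: q_def power_divide divide_simps power2_eq_square)
    have "((\<lambda>Y. c * arctan (Y / X)) has_real_derivative c * ((1 / X) * inverse (1 + (Y / X)\<^sup>2))) (at Y)"
      using X by (auto intro!: derivative_eq_intros)
    then show ?thesis unfolding eq .
  qed simp
  have sq: "((\<lambda>Y. X\<^sup>2 + Y\<^sup>2) has_real_derivative 2 * Y) (at Y)" by (auto intro!: derivative_eq_intros)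
  have lnq: "((\<lambda>Y. ln (X\<^sup>2 + Y\<^sup>2)) has_real_derivative (2 * Y / q)) (at Y)"
    using DERIV_chain2[OF DERIV_ln_divide[OF q[unfolded q_def]] sq] by (simp add: q_def)
  have "((\<lambda>Y. Y * ln (X\<^sup>2 + Y\<^sup>2) / 2 - c * arctan (Y / X)) has_real_derivative
     ((1 * ln q + (2 * Y / q) * Y) / 2 - c * (X / q))) (at Y)"
    by (rule DERIV_diff[OF DERIV_cdivide[OF DERIV_mult[OF DERIV_ident lnq, folded q_def]] arc])
  moreover have "(1 * ln q + (2 * Y / q) * Y) / 2 - c * (X / q) = ln q / 2 + Y\<^sup>2 / q - c * (X / q)"
    by (simp add: power2_eq_square add_divide_distrib)
  ultimately have "((\<lambda>Y. Y * ln (X\<^sup>2 + Y\<^sup>2) / 2 - c * arctan (Y / X)) has_real_derivative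
       (ln q / 2 + Y\<^sup>2 / q - c * (X / q))) (at Y)" by (simp only:)
  then show "((\<lambda>Y. Y * ln (X\<^sup>2 + Y\<^sup>2) / 2 - c * arctan (Y / X)) has_real_derivative
       (ln (X\<^sup>2 + Y\<^sup>2) / 2 + Y\<^sup>2 / (X\<^sup>2 + Y\<^sup>2) - c * (X / (X\<^sup>2 + Y\<^sup>2)))) (at Y)"
    unfolding q_def .
  have d1: "((\<lambda>Y. ((X\<^sup>2 + Y\<^sup>2) * ln (X\<^sup>2 + Y\<^sup>2) - (X\<^sup>2 + Y\<^sup>2)) / 4) has_real_derivative
     ((2 * Y * ln q + (2 * Y / q) * q - 2 * Y) / 4)) (at Y)"
    by (rule DERIV_cdivide[OF DERIV_diff[OF DERIV_mult[OF sq lnq, folded q_def] sq]])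
  have d2: "((\<lambda>Y. c * X * (ln (X\<^sup>2 + Y\<^sup>2) / 2) - c * X) has_real_derivative (c * X * ((2 * Y / q) / 2) - 0)) (at Y)"
    by (rule DERIV_diff[OF DERIV_cmult[OF DERIV_cdivide[OF lnq]] DERIV_const])
  have d3: "((\<lambda>Y. Y * (c * arctan (Y / X))) has_real_derivative (1 * (c * arctan (Y / X)) + c * (X / q) * Y)) (at Y)"
    by (rule DERIV_mult[OF DERIV_ident arc])
  have "((\<lambda>Y. ((X\<^sup>2 + Y\<^sup>2) * ln (X\<^sup>2 + Y\<^sup>2) - (X\<^sup>2 + Y\<^sup>2)) / 4 + (c * X * (ln (X\<^sup>2 + Y\<^sup>2) / 2) - c * X) - Y * (c * arctan (Y / X)))
     has_real_derivative ((2 * Y * ln q + (2 * Y / q) * q - 2 * Y) / 4 + (c * X * ((2 * Y / q) / 2) - 0) - (1 * (c * arctan (Y / X)) + c * (X / q) * Y))) (at Y)"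
    by (rule DERIV_diff[OF DERIV_add[OF d1 d2] d3])
  moreover have "(2 * Y * ln q + (2 * Y / q) * q - 2 * Y) / 4 + (c * X * ((2 * Y / q) / 2) - 0) - (1 * (c * arctan (Y / X)) + c * (X / q) * Y) =
     Y * ln q / 2 - c * arctan (Y / X)" using q by simp
  moreover have "(\<lambda>Y. ((X\<^sup>2 + Y\<^sup>2) * ln (X\<^sup>2 + Y\<^sup>2) - (X\<^sup>2 + Y\<^sup>2)) / 4 + (c * X * (ln (X\<^sup>2 + Y\<^sup>2) / 2) - c * X) - Y * (c * arctan (Y / X))) =
     log_primitive_smooth c X"
    by (auto simp: log_primitive_smooth_def fun_eq_iff algebra_simps)
  ultimately have "(log_primitive_smooth c X has_real_derivative (Y * ln q / 2 - c * arctan (Y / X))) (at Y)"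
    by (simp only:)
  then show "((\<lambda>Y. log_primitive_smooth c X Y) has_real_derivative (Y * ln (X\<^sup>2 + Y\<^sup>2) / 2 - c * arctan (Y / X))) (at Y)"
    unfolding q_def .
qed

lemma log_primitive_smooth_continuous:
  assumes "X \<noteq> 0 \<or> c = 0"
  shows "continuous_on S (\<lambda>Y. log_primitive_smooth c X Y)"
    and "continuous_on S (\<lambda>Y. Y * ln (X\<^sup>2 + Y\<^sup>2) / 2 - c * arctan (Y / X))"
proof -
  have "continuous_on S (\<lambda>Y. log_primitive_smooth c X Y) \<and> continuous_on S (\<lambda>Y. Y * ln (X\<^sup>2 + Y\<^sup>2) / 2 - c * arctan (Y / X))"
  proof (cases "X = 0")
    case False
    then show ?thesis
      using log_primitive_smooth_deriv[of X _ c]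
      by (auto intro!: continuous_at_imp_continuous_on DERIV_isCont)
  next
    case True
    then have c: "c = 0" using assms by simp
    have "continuous_on S (\<lambda>Y. ((Y\<^sup>2) * ln \<bar>Y\<^sup>2\<bar> - Y\<^sup>2) / 4)"
      by (intro continuous_on_divide continuous_on_diff continuous_x_ln_abs' continuous_on_power continuous_on_id continuous_on_const) auto
    moreover have "continuous_on S (\<lambda>Y::real. Y * ln (Y\<^sup>2) / 2)"
    proof -
      have e: "Y * ln (Y\<^sup>2) / 2 = Y * ln \<bar>Y\<bar>" for Y :: real
        using ln_realpow[of "\<bar>Y\<bar>" 2] by (cases "Y = 0") auto
      show ?thesis unfolding e by (rule continuous_x_ln_abs)
    qed
    ultimately show ?thesis using True c by (simp add: log_primitive_smooth_def)
  qed
  then show "continuous_on S (\<lambda>Y. log_primitive_smooth c X Y)"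
    "continuous_on S (\<lambda>Y. Y * ln (X\<^sup>2 + Y\<^sup>2) / 2 - c * arctan (Y / X))" by auto
qed

lemma ln_norm_Complex: "ln (norm (Complex x y)) = ln (x\<^sup>2 + y\<^sup>2) / 2"
  by (cases "x\<^sup>2 + y\<^sup>2 = 0") (auto simp: complex_norm ln_sqrt sum_power2_gt_zero_iff sum_power2_eq_zero_iff)

text \<open>Off the height of \<open>\<rho>\<close>, the horizontal integral \<open>W\<close> satisfies \<open>W'' = -V\<close> because \<open>ln \<bar>s - \<rho>\<bar>\<close> and \<open>x - \<sigma>\<^sub>0\<close> are
  harmonic. At the height of \<open>\<rho>\<close> its derivative jumps by \<open>2\<pi> max 0 (Re \<rho> - \<sigma>\<^sub>0)\<close>, the mass of the zero
  weighted by \<open>x - \<sigma>\<^sub>0\<close>; subtracting half that multiple of \<open>\<bar>y - Im \<rho>\<bar>\<close> removes the jump, and the second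
  difference of \<open>\<bar>y - Im \<rho>\<bar>\<close> over the corners is twice the cut-off.\<close>

lemma littlewood_linear_factor:
  fixes \<rho> :: complex and \<sigma>\<^sub>0 \<sigma>\<^sub>1 T :: real
  assumes \<sigma>: "\<sigma>\<^sub>0 \<le> \<sigma>\<^sub>1" and \<rho>: "Re \<rho> < \<sigma>\<^sub>1" and T: "T \<ge> 0"
  defines "W \<equiv> \<lambda>y. integral {\<sigma>\<^sub>0..\<sigma>\<^sub>1} (\<lambda>x. (x - \<sigma>\<^sub>0) * ln (norm (Complex x y - \<rho>)))"
  shows "(\<lambda>x. (x - \<sigma>\<^sub>0) * ln (norm (Complex x y - \<rho>))) integrable_on {\<sigma>\<^sub>0..\<sigma>\<^sub>1}"
    and "((\<lambda>y. trapezoid T y * (ln (norm (Complex \<sigma>\<^sub>0 y - \<rho>)) - ln (norm (Complex \<sigma>\<^sub>1 y - \<rho>))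
            + (\<sigma>\<^sub>1 - \<sigma>\<^sub>0) * Re (1 / (Complex \<sigma>\<^sub>1 y - \<rho>)))) has_integral
          (W (-T) - W (-T-1) - W (T+1) + W T + 2 * pi * max 0 (Re \<rho> - \<sigma>\<^sub>0) * trapezoid T (Im \<rho>))) {-T-1..T+1}"
proof -
  define \<xi> \<eta> c where "\<xi> = Re \<rho>" and "\<eta> = Im \<rho>" and "c = \<xi> - \<sigma>\<^sub>0"
  define k where "k = max 0 c"
  define X1 where "X1 = \<sigma>\<^sub>1 - \<xi>"
  have X1: "X1 > 0" using \<rho> by (simp add: X1_def \<xi>_def)
  have lnC: "ln (norm (Complex x y - \<rho>)) = ln ((x - \<xi>)\<^sup>2 + (y - \<eta>)\<^sup>2) / 2" for x y
  proof -
    have "Complex x y - \<rho> = Complex (x - \<xi>) (y - \<eta>)" by (simp add: complex_eq_iff \<xi>_def \<eta>_def)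
    then show ?thesis by (simp only: ln_norm_Complex)
  qed
  have hi: "((\<lambda>x. (x - \<sigma>\<^sub>0) * ln (norm (Complex x y - \<rho>))) has_integral
     (log_primitive c X1 (y - \<eta>) - log_primitive c (-c) (y - \<eta>))) {\<sigma>\<^sub>0..\<sigma>\<^sub>1}" for y
  proof -
    have "((\<lambda>X. (X + c) * (ln (X\<^sup>2 + (y-\<eta>)\<^sup>2) / 2)) has_integral (log_primitive c X1 (y-\<eta>) - log_primitive c (-c) (y-\<eta>))) {-c..X1}"
      by (rule has_integral_log_primitive) (use \<sigma> in \<open>simp add: c_def X1_def\<close>)
    from has_integral_shift_real_ivl[OF this, of "-\<xi>"] show ?thesis
      by (simp add: lnC c_def X1_def algebra_simps)
  qed
  then show "(\<lambda>x. (x - \<sigma>\<^sub>0) * ln (norm (Complex x y - \<rho>))) integrable_on {\<sigma>\<^sub>0..\<sigma>\<^sub>1}" by blast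
  (* W without its corner *)
  define W' where "W' = (\<lambda>y. log_primitive_smooth c X1 (y - \<eta>) - log_primitive_smooth c (-c) (y - \<eta>))"
  have WW': "W y = W' y + pi * k * \<bar>y - \<eta>\<bar>" for y
  proof -
    have "log_primitive c (-c) (y - \<eta>) = log_primitive_smooth c (-c) (y - \<eta>) + c * (pi / 2) * sgn (-c) * \<bar>y - \<eta>\<bar>"
    proof (cases "c = 0")
      case True
      then show ?thesis by (simp add: log_primitive_def log_primitive_smooth_def)
    qed (intro log_primitive_eq, simp)
    moreover have "log_primitive c X1 (y - \<eta>) = log_primitive_smooth c X1 (y - \<eta>) + c * (pi / 2) * 1 * \<bar>y - \<eta>\<bar>"
      using log_primitive_eq[of X1 c "y - \<eta>"] X1 by simp
    moreover have "c * (pi / 2) * 1 * \<bar>y - \<eta>\<bar> - c * (pi / 2) * sgn (-c) * \<bar>y - \<eta>\<bar> = pi * k * \<bar>y - \<eta>\<bar>"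
      by (auto simp: k_def sgn_if max_def)
    ultimately show ?thesis using integral_unique[OF hi[of y]] unfolding W_def W'_def by linarith
  qed
  define P where "P = (\<lambda>y. ((y-\<eta>) * ln (X1\<^sup>2 + (y-\<eta>)\<^sup>2) / 2 - c * arctan ((y-\<eta>) / X1)) -
     ((y-\<eta>) * ln ((-c)\<^sup>2 + (y-\<eta>)\<^sup>2) / 2 - c * arctan ((y-\<eta>) / (-c))))"
  define V where "V = (\<lambda>y. ln (norm (Complex \<sigma>\<^sub>0 y - \<rho>)) - ln (norm (Complex \<sigma>\<^sub>1 y - \<rho>))
            + (\<sigma>\<^sub>1 - \<sigma>\<^sub>0) * Re (1 / (Complex \<sigma>\<^sub>1 y - \<rho>)))"
  have shift: "((\<lambda>y. g (y - \<eta>)) has_real_derivative D) (at y)" if "(g has_real_derivative D) (at (y - \<eta>))" for g D y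
    using DERIV_shift[of g D y "-\<eta>"] that by simp
  have "((\<lambda>y. trapezoid T y * V y) has_integral (W' (-T) - W' (-T-1) - W' (T+1) + W' T)) {-T-1..T+1}"
  proof (rule has_integral_trapezoid[of "{\<eta>}" T W' P V])
    have sh: "continuous_on S (\<lambda>y. g (y - \<eta>))" if "\<And>S. continuous_on S g" for S and g :: "real \<Rightarrow> real"
      by (rule continuous_on_compose2[OF that[of UNIV]]) (auto intro!: continuous_intros)
    have nz: "X1 \<noteq> 0 \<or> c = 0" "- c \<noteq> 0 \<or> c = 0" using X1 by auto
    show "continuous_on {-T-1..T+1} W'" unfolding W'_def
      by (intro continuous_on_diff sh log_primitive_smooth_continuous nz)
    show "continuous_on {-T-1..T+1} P" unfolding P_def
      by (intro continuous_on_diff sh[OF log_primitive_smooth_continuous(2)] nz)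
    fix y assume y: "y \<in> {-T-1<..<T+1} - {\<eta>}"
    have n0: "- c \<noteq> 0 \<or> y - \<eta> \<noteq> 0 \<and> c = 0" and n1: "X1 \<noteq> 0 \<or> y - \<eta> \<noteq> 0 \<and> c = 0" using y X1 by auto
    show "(W' has_real_derivative P y) (at y)" unfolding W'_def P_def
      by (intro DERIV_diff shift log_primitive_smooth_deriv n0 n1)
    define q0 q1 where "q0 = (-c)\<^sup>2 + (y - \<eta>)\<^sup>2" and "q1 = X1\<^sup>2 + (y - \<eta>)\<^sup>2"
    have q: "q0 > 0" "q1 > 0" using n0 n1 by (auto simp: q0_def q1_def sum_power2_gt_zero_iff)
    have "(P has_real_derivative ((ln q1 / 2 + (y-\<eta>)\<^sup>2 / q1 - c * (X1 / q1)) - (ln q0 / 2 + (y-\<eta>)\<^sup>2 / q0 - c * (-c / q0)))) (at y)"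
      unfolding P_def q0_def q1_def
      by (intro DERIV_diff shift[OF log_primitive_smooth_deriv(2)] n0 n1)
    moreover have "(ln q1 / 2 + (y-\<eta>)\<^sup>2 / q1 - c * (X1 / q1)) - (ln q0 / 2 + (y-\<eta>)\<^sup>2 / q0 - c * (-c / q0)) = - V y"
    proof -
      have "Complex \<sigma>\<^sub>1 y - \<rho> = Complex X1 (y - \<eta>)" by (simp add: complex_eq_iff X1_def \<xi>_def \<eta>_def)
      then have "Re (1 / (Complex \<sigma>\<^sub>1 y - \<rho>)) = X1 / q1" by (simp add: Re_divide q1_def)
      moreover have "\<sigma>\<^sub>1 - \<sigma>\<^sub>0 = X1 + c" by (simp add: X1_def c_def)
      ultimately have V: "V y = ln q0 / 2 - ln q1 / 2 + (X1 + c) * (X1 / q1)"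
        unfolding V_def lnC by (simp add: q0_def q1_def c_def X1_def power2_commute)
      have "(y-\<eta>)\<^sup>2 / q1 + X1 * (X1 / q1) = ((y-\<eta>)\<^sup>2 + X1 * X1) / q1" by (simp add: add_divide_distrib)
      moreover have "(y-\<eta>)\<^sup>2 + X1 * X1 = q1" by (simp add: q1_def power2_eq_square)
      moreover have "(y-\<eta>)\<^sup>2 / q0 - c * (-c / q0) = ((y-\<eta>)\<^sup>2 + c * c) / q0" by (simp add: add_divide_distrib)
      moreover have "(y-\<eta>)\<^sup>2 + c * c = q0" by (simp add: q0_def power2_eq_square)
      moreover have "(X1 + c) * (X1 / q1) = X1 * (X1 / q1) + c * (X1 / q1)" by (simp only: distrib_right)
      ultimately show ?thesis unfolding V using q by simp
    qed
    ultimately show "(P has_real_derivative - V y) (at y)" by simp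
  qed (use T in auto)
  moreover have "W' (-T) - W' (-T-1) - W' (T+1) + W' T = W (-T) - W (-T-1) - W (T+1) + W T + 2 * pi * k * trapezoid T \<eta>"
  proof -
    have "pi * k * (\<bar>T + 1 - \<eta>\<bar> + \<bar>-T - 1 - \<eta>\<bar> - \<bar>T - \<eta>\<bar> - \<bar>-T - \<eta>\<bar>) = pi * k * (2 * trapezoid T \<eta>)"
      by (simp only: trapezoid_second_difference[OF T])
    then show ?thesis unfolding WW' by (simp add: algebra_simps)
  qed
  ultimately show "((\<lambda>y. trapezoid T y * (ln (norm (Complex \<sigma>\<^sub>0 y - \<rho>)) - ln (norm (Complex \<sigma>\<^sub>1 y - \<rho>))
            + (\<sigma>\<^sub>1 - \<sigma>\<^sub>0) * Re (1 / (Complex \<sigma>\<^sub>1 y - \<rho>)))) has_integral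
          (W (-T) - W (-T-1) - W (T+1) + W T + 2 * pi * max 0 (Re \<rho> - \<sigma>\<^sub>0) * trapezoid T (Im \<rho>))) {-T-1..T+1}"
    unfolding V_def k_def c_def \<xi>_def \<eta>_def by simp
qed

section \<open>A smoothed Littlewood lemma\<close>

lemma has_real_derivative_Re_vertical:
  assumes "(G has_field_derivative D) (at (Complex x y))"
  shows "((\<lambda>y. Re (G (Complex x y))) has_real_derivative Re (\<i> * D)) (at y)"
proof -
  have "((\<lambda>y. of_real x + of_real y * \<i>) has_vector_derivative \<i>) (at y)"
    by (auto intro!: derivative_eq_intros)
  then have "((\<lambda>y. Complex x y) has_vector_derivative \<i>) (at y)"
    by (simp add: Complex_eq mult.commute)
  from field_vector_diff_chain_at[OF this assms]
  have "((\<lambda>y. G (Complex x y)) has_vector_derivative \<i> * D) (at y)" by (simp add: o_def)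
  from bounded_linear.has_vector_derivative[OF bounded_linear_Re this]
  show ?thesis by (simp add: has_real_derivative_iff_has_vector_derivative)
qed

lemma has_vector_derivative_horizontal:
  assumes "(G has_field_derivative D) (at (Complex x y))"
  shows "((\<lambda>x. G (Complex x y)) has_vector_derivative D) (at x)"
proof -
  have "((\<lambda>x. of_real x + of_real y * \<i>) has_vector_derivative 1) (at x)"
    by (auto intro!: derivative_eq_intros)
  then have "((\<lambda>x. Complex x y) has_vector_derivative 1) (at x)"
    by (simp add: Complex_eq mult.commute)
  from field_vector_diff_chain_at[OF this assms] show ?thesis by (simp add: o_def)
qed

text \<open>The same computation for a harmonic function without singularity. Two antiderivatives of \<open>h\<close> replace
  the explicit formulas.\<close>

lemma littlewood_zero_free:
  fixes h :: "complex \<Rightarrow> complex" and \<sigma>\<^sub>0 \<sigma>\<^sub>1 T :: real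
  assumes U: "open U" "convex U" "h holomorphic_on U"
    and sub: "cbox (Complex \<sigma>\<^sub>0 (-T-1)) (Complex \<sigma>\<^sub>1 (T+1)) \<subseteq> U"
    and \<sigma>: "\<sigma>\<^sub>0 \<le> \<sigma>\<^sub>1" and T: "T \<ge> 0"
  defines "W \<equiv> \<lambda>y. integral {\<sigma>\<^sub>0..\<sigma>\<^sub>1} (\<lambda>x. (x - \<sigma>\<^sub>0) * Re (h (Complex x y)))"
  shows "((\<lambda>y. trapezoid T y * (Re (h (Complex \<sigma>\<^sub>0 y)) - Re (h (Complex \<sigma>\<^sub>1 y))
            + (\<sigma>\<^sub>1 - \<sigma>\<^sub>0) * Re (deriv h (Complex \<sigma>\<^sub>1 y)))) has_integral
          (W (-T) - W (-T-1) - W (T+1) + W T)) {-T-1..T+1}"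
proof -
  have inU: "Complex x y \<in> U" if "x \<in> {\<sigma>\<^sub>0..\<sigma>\<^sub>1}" "y \<in> {-T-1..T+1}" for x y
    using sub that by (auto simp: in_cbox_complex_iff subset_iff)
  obtain H1 where H1': "\<And>z. z \<in> U \<Longrightarrow> (H1 has_field_derivative h z) (at z within U)"
    using holomorphic_convex_primitive'[OF U(2,1,3)] by blast
  have H1: "(H1 has_field_derivative h z) (at z)" if "z \<in> U" for z
    using H1'[OF that] at_within_open[OF that U(1)] by simp
  have "H1 holomorphic_on U" using H1' by (auto simp: holomorphic_on_def field_differentiable_def)
  then obtain H2 where H2': "\<And>z. z \<in> U \<Longrightarrow> (H2 has_field_derivative H1 z) (at z within U)"
    using holomorphic_convex_primitive'[OF U(2,1)] by blast
  have H2: "(H2 has_field_derivative H1 z) (at z)" if "z \<in> U" for z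
    using H2'[OF that] at_within_open[OF that U(1)] by simp
  have h: "(h has_field_derivative deriv h z) (at z)" if "z \<in> U" for z
    using holomorphic_derivI[OF U(3,1) that] by blast
  define Q where "Q = (\<lambda>z. of_real (\<sigma>\<^sub>1 - \<sigma>\<^sub>0) * H1 z - H2 z)"
  define Q' where "Q' = (\<lambda>z. of_real (\<sigma>\<^sub>1 - \<sigma>\<^sub>0) * h z - H1 z)"
  define Q'' where "Q'' = (\<lambda>z. of_real (\<sigma>\<^sub>1 - \<sigma>\<^sub>0) * deriv h z - h z)"
  have Q: "(Q has_field_derivative Q' z) (at z)" and Q': "(Q' has_field_derivative Q'' z) (at z)" if "z \<in> U" for z
    unfolding Q_def Q'_def Q''_def by (intro DERIV_diff DERIV_cmult H1 H2 h that)+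
  define W' where "W' = (\<lambda>y. Re (Q (Complex \<sigma>\<^sub>1 y)) + Re (H2 (Complex \<sigma>\<^sub>0 y)))"
  define P where "P = (\<lambda>y. Re (\<i> * Q' (Complex \<sigma>\<^sub>1 y)) + Re (\<i> * H1 (Complex \<sigma>\<^sub>0 y)))"
  define V where "V = (\<lambda>y. Re (h (Complex \<sigma>\<^sub>0 y)) - Re (h (Complex \<sigma>\<^sub>1 y))
            + (\<sigma>\<^sub>1 - \<sigma>\<^sub>0) * Re (deriv h (Complex \<sigma>\<^sub>1 y)))"
  have WW': "W y = W' y" if y: "y \<in> {-T-1..T+1}" for y
  proof -
    have "((\<lambda>x. of_real (x - \<sigma>\<^sub>0) * h (Complex x y)) has_integral
       ((of_real (\<sigma>\<^sub>1 - \<sigma>\<^sub>0) * H1 (Complex \<sigma>\<^sub>1 y) - H2 (Complex \<sigma>\<^sub>1 y)) -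
        (of_real (\<sigma>\<^sub>0 - \<sigma>\<^sub>0) * H1 (Complex \<sigma>\<^sub>0 y) - H2 (Complex \<sigma>\<^sub>0 y)))) {\<sigma>\<^sub>0..\<sigma>\<^sub>1}"
    proof (rule fundamental_theorem_of_calculus[OF \<sigma>])
      fix x assume x: "x \<in> {\<sigma>\<^sub>0..\<sigma>\<^sub>1}"
      have l: "((\<lambda>x. of_real (x - \<sigma>\<^sub>0) :: complex) has_vector_derivative 1) (at x)"
        by (auto intro!: derivative_eq_intros simp: has_vector_derivative_def scaleR_conv_of_real fun_eq_iff)
      have "((\<lambda>x. of_real (x - \<sigma>\<^sub>0) * H1 (Complex x y) - H2 (Complex x y)) has_vector_derivative
         (of_real (x - \<sigma>\<^sub>0) * h (Complex x y) + 1 * H1 (Complex x y) - H1 (Complex x y))) (at x)"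
        by (intro has_vector_derivative_diff has_vector_derivative_mult l
             has_vector_derivative_horizontal H1 H2 inU x y)
      then show "((\<lambda>x. of_real (x - \<sigma>\<^sub>0) * H1 (Complex x y) - H2 (Complex x y)) has_vector_derivative
         (of_real (x - \<sigma>\<^sub>0) * h (Complex x y))) (at x within {\<sigma>\<^sub>0..\<sigma>\<^sub>1})"
        by (simp add: has_vector_derivative_at_within)
    qed
    from has_integral_linear[OF this bounded_linear_Re]
    have "((\<lambda>x. (x - \<sigma>\<^sub>0) * Re (h (Complex x y))) has_integral W' y) {\<sigma>\<^sub>0..\<sigma>\<^sub>1}"
      by (simp add: o_def W'_def Q_def)
    then show ?thesis unfolding W_def by (rule integral_unique)
  qed
  have dW: "(W' has_real_derivative P y) (at y)" and dP: "(P has_real_derivative - V y) (at y)"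
    if y: "y \<in> {-T-1..T+1}" for y
  proof -
    have i: "Complex \<sigma>\<^sub>0 y \<in> U" "Complex \<sigma>\<^sub>1 y \<in> U" using inU y \<sigma> by auto
    show "(W' has_real_derivative P y) (at y)" unfolding W'_def P_def
      by (intro DERIV_add has_real_derivative_Re_vertical Q H2 i)
    have "(P has_real_derivative (Re (\<i> * (\<i> * Q'' (Complex \<sigma>\<^sub>1 y))) + Re (\<i> * (\<i> * h (Complex \<sigma>\<^sub>0 y))))) (at y)"
      unfolding P_def
      by (intro DERIV_add has_real_derivative_Re_vertical[where G="\<lambda>z. \<i> * Q' z"]
           has_real_derivative_Re_vertical[where G="\<lambda>z. \<i> * H1 z"] DERIV_cmult Q' H1 i)
    moreover have "Re (\<i> * (\<i> * Q'' (Complex \<sigma>\<^sub>1 y))) + Re (\<i> * (\<i> * h (Complex \<sigma>\<^sub>0 y))) = - V y"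
      by (simp add: V_def Q''_def)
    ultimately show "(P has_real_derivative - V y) (at y)" by (simp only:)
  qed
  have "((\<lambda>y. trapezoid T y * V y) has_integral (W' (-T) - W' (-T-1) - W' (T+1) + W' T)) {-T-1..T+1}"
  proof (rule has_integral_trapezoid[of "{}" T W' P V])
    show "continuous_on {-T-1..T+1} W'"
      by (intro continuous_at_imp_continuous_on ballI DERIV_isCont[OF dW])
    show "continuous_on {-T-1..T+1} P"
      by (intro continuous_at_imp_continuous_on ballI DERIV_isCont[OF dP])
  qed (use T dW dP in auto)
  then show ?thesis using WW' T unfolding V_def by simp
qed

lemma has_field_derivative_linear_product:
  assumes "finite A" "s \<notin> A"
  shows "((\<lambda>z. \<Prod>\<rho>\<in>A. (z - \<rho>) ^ m \<rho>) has_field_derivative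
     ((\<Prod>\<rho>\<in>A. (s - \<rho>) ^ m \<rho>) * (\<Sum>\<rho>\<in>A. of_nat (m \<rho>) * (1 / (s - \<rho>))))) (at (s::complex))"
  using assms
proof (induction A rule: finite_induct)
  case (insert \<rho> A)
  have IH: "((\<lambda>z. \<Prod>\<rho>\<in>A. (z - \<rho>) ^ m \<rho>) has_field_derivative
     ((\<Prod>\<rho>\<in>A. (s - \<rho>) ^ m \<rho>) * (\<Sum>\<rho>\<in>A. of_nat (m \<rho>) * (1 / (s - \<rho>))))) (at s)"
    using insert by simp
  have nz: "s - \<rho> \<noteq> 0" using insert.prems by auto
  have p: "((\<lambda>z. (z - \<rho>) ^ m \<rho>) has_field_derivative (s - \<rho>) ^ m \<rho> * (of_nat (m \<rho>) * (1 / (s - \<rho>)))) (at s)"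
  proof -
    have "((\<lambda>z. (z - \<rho>) ^ m \<rho>) has_field_derivative of_nat (m \<rho>) * (1 * (s - \<rho>) ^ (m \<rho> - Suc 0))) (at s)"
      by (rule DERIV_power) (auto intro!: derivative_eq_intros)
    moreover have "of_nat (m \<rho>) * (1 * (s - \<rho>) ^ (m \<rho> - Suc 0)) = (s - \<rho>) ^ m \<rho> * (of_nat (m \<rho>) * (1 / (s - \<rho>)))"
      using nz by (cases "m \<rho>") (auto simp: field_simps)
    ultimately show ?thesis by (simp only:)
  qed
  show ?case using DERIV_mult[OF p IH] insert.hyps by (simp add: algebra_simps)
qed simp

lemma factor_out_zeros:
  fixes f :: "complex \<Rightarrow> complex"
  assumes U: "open U" "convex U" "f holomorphic_on U" and nz: "\<exists>w\<in>U. f w \<noteq> 0"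
    and fin: "finite {z \<in> U. f z = 0}"
  shows "\<exists>h. h holomorphic_on U \<and>
     (\<forall>z\<in>U. f z = (\<Prod>\<rho>\<in>{z \<in> U. f z = 0}. (z - \<rho>) ^ nat (zorder f \<rho>)) * exp (h z))"
proof -
  define Z where "Z = {z \<in> U. f z = 0}"
  define m where "m = (\<lambda>\<rho>. nat (zorder f \<rho>))"
  define Q where "Q = (\<lambda>z. \<Prod>\<rho>\<in>Z. (z - \<rho>) ^ m \<rho>)"
  have finZ: "finite Z" using fin by (simp add: Z_def)
  have conn: "connected U" using U(2) by (rule convex_connected)
  have pos: "zorder f z > 0" if "z \<in> Z" for z
    using zorder_exist_zero[OF U(3,1) conn _ nz, of z] that by (auto simp: Z_def split: if_splits)
  have holQ: "Q holomorphic_on U" unfolding Q_def by (intro holomorphic_intros)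
  have Q0: "Q z = 0 \<longleftrightarrow> f z = 0" if "z \<in> U" for z
    using finZ pos that by (auto simp: Q_def m_def Z_def)
  have zQ: "zorder Q z = zorder f z" if z: "z \<in> U" for z
  proof (cases "z \<in> Z")
    case False
    then have "f z \<noteq> 0" "Q z \<noteq> 0" using z Q0 by (auto simp: Z_def)
    moreover have "f analytic_on {z}" "Q analytic_on {z}"
      using U(1,3) holQ z analytic_at by blast+
    ultimately show ?thesis by (simp add: zorder_eq_0I)
  next
    case True
    show ?thesis
    proof (rule zorder_eqI[where S = UNIV and g = "\<lambda>w. \<Prod>\<rho>\<in>Z-{z}. (w - \<rho>) ^ m \<rho>"])
      show "(\<Prod>\<rho>\<in>Z-{z}. (z - \<rho>) ^ m \<rho>) \<noteq> 0" using finZ by auto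
      show "(\<lambda>w. \<Prod>\<rho>\<in>Z-{z}. (w - \<rho>) ^ m \<rho>) holomorphic_on UNIV" by (intro holomorphic_intros)
      fix w
      have "Q w = (w - z) ^ m z * (\<Prod>\<rho>\<in>Z-{z}. (w - \<rho>) ^ m \<rho>)"
        unfolding Q_def using finZ True by (rule prod.remove)
      moreover have "(w - z) ^ m z = (w - z) powi zorder f z"
        using pos[OF True] by (simp add: m_def power_int_def)
      ultimately show "Q w = (\<Prod>\<rho>\<in>Z-{z}. (w - \<rho>) ^ m \<rho>) * (w - z) powi zorder f z" by simp
    qed auto
  qed
  obtain g where g: "g holomorphic_on U" "\<And>z. z \<in> U \<Longrightarrow> g z \<noteq> 0" "\<And>z. z \<in> U \<Longrightarrow> f z = g z * Q z"
    using holomorphic_zorder_factorization[OF U(3,1) conn holQ Q0 zQ] by blast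
  obtain h where h: "h holomorphic_on U" "\<And>z. z \<in> U \<Longrightarrow> g z = exp (h z)"
    using contractible_imp_holomorphic_log[OF g(1) convex_imp_contractible[OF U(2)] g(2)] by blast
  show ?thesis
    using h g(3) unfolding Q_def m_def Z_def by (intro exI[of _ h]) (auto simp: mult.commute)
qed

context normalised_dirichlet_function
begin

text \<open>The identity is linear in \<open>ln \<bar>F\<bar>\<close>. On a neighbourhood of the rectangle \<open>F\<close> is a finite product of linear
  factors and an exponential, so the two previous cases add up.\<close>

lemma littlewood_trapezoid:
  fixes \<sigma>\<^sub>0 \<sigma>\<^sub>1 T :: real
  assumes \<sigma>\<^sub>0: "0 < \<sigma>\<^sub>0" "\<sigma>\<^sub>0 \<le> \<sigma>\<^sub>1" and \<sigma>\<^sub>1: "X \<le> \<sigma>\<^sub>1" and T: "T \<ge> 0"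
  defines "W \<equiv> \<lambda>y. integral {\<sigma>\<^sub>0..\<sigma>\<^sub>1} (\<lambda>x. (x - \<sigma>\<^sub>0) * ln (norm (F (Complex x y))))"
  defines "Z \<equiv> {s. \<sigma>\<^sub>0 < Re s \<and> \<bar>Im s\<bar> < T + 1 \<and> F s = 0}"
  shows "((\<lambda>y. trapezoid T y * (ln (norm (F (Complex \<sigma>\<^sub>0 y))) - ln (norm (F (Complex \<sigma>\<^sub>1 y)))
            + (\<sigma>\<^sub>1 - \<sigma>\<^sub>0) * Re (deriv F (Complex \<sigma>\<^sub>1 y) / F (Complex \<sigma>\<^sub>1 y)))) has_integral
          (W (-T) - W (-T-1) - W (T+1) + W T +
           2 * pi * (\<Sum>\<rho>\<in>Z. of_int (zorder F \<rho>) * (Re \<rho> - \<sigma>\<^sub>0) * trapezoid T (Im \<rho>)))) {-T-1..T+1}"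
proof -
  (* slightly larger than the rectangle; zeros in the margin do not contribute *)
  define U where "U = box (Complex (\<sigma>\<^sub>0/2) (-T-2)) (Complex (\<sigma>\<^sub>1+1) (T+2))"
  have U: "open U" "convex U" by (auto simp: U_def open_box convex_box)
  have UF: "U \<subseteq> {s. Re s > 0}" using \<sigma>\<^sub>0 by (auto simp: U_def in_box_complex_iff)
  have holU: "F holomorphic_on U" using hol UF by (rule holomorphic_on_subset)
  have finU: "finite {z \<in> U. F z = 0}"
  proof (rule finite_subset)
    show "{z \<in> U. F z = 0} \<subseteq> {z \<in> cbox (Complex (\<sigma>\<^sub>0/2) (-T-2)) (Complex (\<sigma>\<^sub>1+1) (T+2)). F z = 0}"
      using box_subset_cbox unfolding U_def by blast
    show "finite {z \<in> cbox (Complex (\<sigma>\<^sub>0/2) (-T-2)) (Complex (\<sigma>\<^sub>1+1) (T+2)). F z = 0}"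
      using \<sigma>\<^sub>0 by (intro finite_zeros compact_cbox) (auto simp: in_cbox_complex_iff)
  qed
  have inU: "Complex x y \<in> U" if "x \<in> {\<sigma>\<^sub>0..\<sigma>\<^sub>1}" "y \<in> {-T-1..T+1}" for x y
    using that \<sigma>\<^sub>0 by (auto simp: U_def in_box_complex_iff)
  have "Complex \<sigma>\<^sub>1 0 \<in> U" using inU[of \<sigma>\<^sub>1 0] \<sigma>\<^sub>0 T by simp
  then have nz: "\<exists>w\<in>U. F w \<noteq> 0" using nonzero_right[of "Complex \<sigma>\<^sub>1 0"] \<sigma>\<^sub>1 by auto
  define ZU where "ZU = {z \<in> U. F z = 0}"
  define m where "m = (\<lambda>\<rho>. nat (zorder F \<rho>))"
  have finZ: "finite ZU" using finU by (simp add: ZU_def)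
  obtain h where h: "h holomorphic_on U"
    and fac: "\<And>z. z \<in> U \<Longrightarrow> F z = (\<Prod>\<rho>\<in>ZU. (z - \<rho>) ^ m \<rho>) * exp (h z)"
    using factor_out_zeros[OF U holU nz finU] unfolding ZU_def m_def by blast
  have Zre: "Re \<rho> < \<sigma>\<^sub>1" if "\<rho> \<in> ZU" for \<rho>
    using that nonzero_right[of \<rho>] \<sigma>\<^sub>1 by (force simp: ZU_def)
  have lnF: "ln (norm (F s)) = (\<Sum>\<rho>\<in>ZU. real (m \<rho>) * ln (norm (s - \<rho>))) + Re (h s)" if s: "s \<in> U" "F s \<noteq> 0" for s
  proof -
    have ne: "s - \<rho> \<noteq> 0" if "\<rho> \<in> ZU" for \<rho> using that s by (auto simp: ZU_def)
    have pr: "ln (norm (\<Prod>\<rho>\<in>A. (s - \<rho>) ^ m \<rho>)) = (\<Sum>\<rho>\<in>A. real (m \<rho>) * ln (norm (s - \<rho>)))" if "A \<subseteq> ZU" for A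
      using finite_subset[OF that finZ] that
    proof (induction A rule: finite_induct)
      case (insert \<rho> A)
      then have "\<rho> \<in> ZU" "A \<subseteq> ZU" by auto
      moreover have "(\<Prod>\<rho>\<in>A. (s - \<rho>) ^ m \<rho>) \<noteq> 0" using insert ne by (auto simp: prod_zero_iff)
      ultimately show ?case using insert ne[of \<rho>]
        by (simp add: norm_mult ln_mult norm_power ln_realpow)
    qed simp
    have "(\<Prod>\<rho>\<in>ZU. (s - \<rho>) ^ m \<rho>) \<noteq> 0" using fac[OF s(1)] s(2) by auto
    then show ?thesis using pr[of ZU] fac[OF s(1)] by (simp add: norm_mult ln_mult)
  qed
  have logderiv: "deriv F s / F s = (\<Sum>\<rho>\<in>ZU. of_nat (m \<rho>) * (1 / (s - \<rho>))) + deriv h s"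
    if s: "s \<in> U" "F s \<noteq> 0" for s
  proof -
    have sZ: "s \<notin> ZU" using s by (simp add: ZU_def)
    have dh: "(h has_field_derivative deriv h s) (at s)" using holomorphic_derivI[OF h U(1) s(1)] by blast
    let ?q = "\<Prod>\<rho>\<in>ZU. (s - \<rho>) ^ m \<rho>" and ?S = "\<Sum>\<rho>\<in>ZU. of_nat (m \<rho>) * (1 / (s - \<rho>))"
    have "((\<lambda>z. (\<Prod>\<rho>\<in>ZU. (z - \<rho>) ^ m \<rho>) * exp (h z)) has_field_derivative
       (?q * ?S * exp (h s) + (exp (h s) * deriv h s) * ?q)) (at s)"
      by (rule DERIV_mult[OF has_field_derivative_linear_product[OF finZ sZ] DERIV_chain2[OF DERIV_exp dh]])
    then have "(F has_field_derivative (?q * ?S * exp (h s) + (exp (h s) * deriv h s) * ?q)) (at s)"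
      by (rule DERIV_cong_ev[THEN iffD1, rotated 3])
         (use fac eventually_nhds_in_open[OF U(1) s(1)] in \<open>auto elim!: eventually_mono\<close>)
    then have "deriv F s = F s * (?S + deriv h s)"
      using fac[OF s(1)] by (simp add: DERIV_imp_deriv algebra_simps)
    then show ?thesis using s(2) by simp
  qed
  have Re_logderiv: "Re (deriv F s / F s) = (\<Sum>\<rho>\<in>ZU. real (m \<rho>) * Re (1 / (s - \<rho>))) + Re (deriv h s)"
    if s: "s \<in> U" "F s \<noteq> 0" for s
  proof -
    have "Re (of_nat n * w) = real n * Re w" for n w by simp
    then show ?thesis unfolding logderiv[OF s] by (simp only: plus_complex.sel Re_sum)
  qed
  define W\<^sub>\<rho> where "W\<^sub>\<rho> = (\<lambda>\<rho> y. integral {\<sigma>\<^sub>0..\<sigma>\<^sub>1} (\<lambda>x. (x - \<sigma>\<^sub>0) * ln (norm (Complex x y - \<rho>))))"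
  define W\<^sub>h where "W\<^sub>h = (\<lambda>y. integral {\<sigma>\<^sub>0..\<sigma>\<^sub>1} (\<lambda>x. (x - \<sigma>\<^sub>0) * Re (h (Complex x y))))"
  have Wsum: "W y = (\<Sum>\<rho>\<in>ZU. real (m \<rho>) * W\<^sub>\<rho> \<rho> y) + W\<^sub>h y" if y: "y \<in> {-T-1..T+1}" for y
  proof -
    have ih: "(\<lambda>x. (x - \<sigma>\<^sub>0) * Re (h (Complex x y))) integrable_on {\<sigma>\<^sub>0..\<sigma>\<^sub>1}"
      using inU[OF _ y] by (intro integrable_continuous_interval continuous_intros
          continuous_on_compose2[OF holomorphic_on_imp_continuous_on[OF h]]) auto
    have i\<rho>: "(\<lambda>x. (x - \<sigma>\<^sub>0) * ln (norm (Complex x y - \<rho>))) integrable_on {\<sigma>\<^sub>0..\<sigma>\<^sub>1}" if "\<rho> \<in> ZU" for \<rho>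
      by (rule littlewood_linear_factor(1)[OF \<sigma>\<^sub>0(2) Zre[OF that] T])
    have "W y = integral {\<sigma>\<^sub>0..\<sigma>\<^sub>1} (\<lambda>x. (\<Sum>\<rho>\<in>ZU. real (m \<rho>) * ((x - \<sigma>\<^sub>0) * ln (norm (Complex x y - \<rho>)))) + (x - \<sigma>\<^sub>0) * Re (h (Complex x y)))"
      unfolding W_def
    proof (rule integral_spike[of "Re ` ZU"])
      show "negligible (Re ` ZU)" using finZ by (intro negligible_finite) simp
      fix x assume x: "x \<in> {\<sigma>\<^sub>0..\<sigma>\<^sub>1} - Re ` ZU"
      then have "Complex x y \<in> U" using inU y by auto
      moreover have "F (Complex x y) \<noteq> 0"
      proof
        assume "F (Complex x y) = 0"
        then have "Complex x y \<in> ZU" using \<open>Complex x y \<in> U\<close> by (simp add: ZU_def)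
        then show False using x by force
      qed
      ultimately show "(\<Sum>\<rho>\<in>ZU. real (m \<rho>) * ((x - \<sigma>\<^sub>0) * ln (norm (Complex x y - \<rho>)))) + (x - \<sigma>\<^sub>0) * Re (h (Complex x y)) = (x - \<sigma>\<^sub>0) * ln (norm (F (Complex x y)))"
        by (simp add: lnF distrib_left sum_distrib_left mult_ac)
    qed
    also have "\<dots> = integral {\<sigma>\<^sub>0..\<sigma>\<^sub>1} (\<lambda>x. \<Sum>\<rho>\<in>ZU. real (m \<rho>) * ((x - \<sigma>\<^sub>0) * ln (norm (Complex x y - \<rho>)))) + W\<^sub>h y"
      unfolding W\<^sub>h_def by (intro integral_add integrable_sum finZ integrable_on_mult_right i\<rho> ih)
    also have "integral {\<sigma>\<^sub>0..\<sigma>\<^sub>1} (\<lambda>x. \<Sum>\<rho>\<in>ZU. real (m \<rho>) * ((x - \<sigma>\<^sub>0) * ln (norm (Complex x y - \<rho>)))) =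
       (\<Sum>\<rho>\<in>ZU. integral {\<sigma>\<^sub>0..\<sigma>\<^sub>1} (\<lambda>x. real (m \<rho>) * ((x - \<sigma>\<^sub>0) * ln (norm (Complex x y - \<rho>)))))"
      by (intro integral_sum finZ integrable_on_mult_right i\<rho>)
    finally show ?thesis by (simp add: W\<^sub>\<rho>_def)
  qed
  define V\<^sub>\<rho> where "V\<^sub>\<rho> = (\<lambda>\<rho> y. ln (norm (Complex \<sigma>\<^sub>0 y - \<rho>)) - ln (norm (Complex \<sigma>\<^sub>1 y - \<rho>))
            + (\<sigma>\<^sub>1 - \<sigma>\<^sub>0) * Re (1 / (Complex \<sigma>\<^sub>1 y - \<rho>)))"
  define V\<^sub>h where "V\<^sub>h = (\<lambda>y. Re (h (Complex \<sigma>\<^sub>0 y)) - Re (h (Complex \<sigma>\<^sub>1 y)) + (\<sigma>\<^sub>1 - \<sigma>\<^sub>0) * Re (deriv h (Complex \<sigma>\<^sub>1 y)))"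
  define V where "V = (\<lambda>y. ln (norm (F (Complex \<sigma>\<^sub>0 y))) - ln (norm (F (Complex \<sigma>\<^sub>1 y)))
            + (\<sigma>\<^sub>1 - \<sigma>\<^sub>0) * Re (deriv F (Complex \<sigma>\<^sub>1 y) / F (Complex \<sigma>\<^sub>1 y)))"
  define E where "E = (\<lambda>w. w (-T) - w (-T-1) - w (T+1) + w (T::real) :: real)"
  define K where "K = (\<lambda>\<rho>. 2 * pi * max 0 (Re \<rho> - \<sigma>\<^sub>0) * trapezoid T (Im \<rho>))"
  have "((\<lambda>y. trapezoid T y * V\<^sub>\<rho> \<rho> y) has_integral (E (W\<^sub>\<rho> \<rho>) + K \<rho>)) {-T-1..T+1}" if "\<rho> \<in> ZU" for \<rho>
    unfolding V\<^sub>\<rho>_def W\<^sub>\<rho>_def E_def K_def by (rule littlewood_linear_factor(2)[OF \<sigma>\<^sub>0(2) Zre[OF that] T])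
  then have "((\<lambda>y. \<Sum>\<rho>\<in>ZU. real (m \<rho>) * (trapezoid T y * V\<^sub>\<rho> \<rho> y)) has_integral (\<Sum>\<rho>\<in>ZU. real (m \<rho>) * (E (W\<^sub>\<rho> \<rho>) + K \<rho>))) {-T-1..T+1}"
    by (intro has_integral_sum finZ has_integral_mult_right)
  moreover have "((\<lambda>y. trapezoid T y * V\<^sub>h y) has_integral E W\<^sub>h) {-T-1..T+1}"
    unfolding V\<^sub>h_def W\<^sub>h_def E_def
    by (rule littlewood_zero_free[OF U h _ \<sigma>\<^sub>0(2) T]) (use \<sigma>\<^sub>0(1) in \<open>auto simp: U_def in_box_complex_iff in_cbox_complex_iff\<close>)
  ultimately have tot: "((\<lambda>y. (\<Sum>\<rho>\<in>ZU. real (m \<rho>) * (trapezoid T y * V\<^sub>\<rho> \<rho> y)) + trapezoid T y * V\<^sub>h y) has_integral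
      ((\<Sum>\<rho>\<in>ZU. real (m \<rho>) * (E (W\<^sub>\<rho> \<rho>) + K \<rho>)) + E W\<^sub>h)) {-T-1..T+1}"
    by (rule has_integral_add)
  have "((\<lambda>y. trapezoid T y * V y) has_integral ((\<Sum>\<rho>\<in>ZU. real (m \<rho>) * (E (W\<^sub>\<rho> \<rho>) + K \<rho>)) + E W\<^sub>h)) {-T-1..T+1}"
  proof (rule has_integral_spike[OF negligible_finite _ tot])
    show "finite (Im ` ZU)" using finZ by simp
    fix y assume y: "y \<in> {-T-1..T+1} - Im ` ZU"
    have i: "Complex \<sigma>\<^sub>0 y \<in> U" "Complex \<sigma>\<^sub>1 y \<in> U" using inU y \<sigma>\<^sub>0 by auto
    have n: "F (Complex x y) \<noteq> 0" if "Complex x y \<in> U" for x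
    proof
      assume "F (Complex x y) = 0"
      then have "Complex x y \<in> ZU" using that by (simp add: ZU_def)
      then show False using y by force
    qed
    have "V y = (\<Sum>\<rho>\<in>ZU. real (m \<rho>) * V\<^sub>\<rho> \<rho> y) + V\<^sub>h y"
      unfolding V_def V\<^sub>\<rho>_def V\<^sub>h_def lnF[OF i(1) n[OF i(1)]] lnF[OF i(2) n[OF i(2)]] Re_logderiv[OF i(2) n[OF i(2)]]
      by (simp add: sum.distrib sum_subtractf sum_distrib_left algebra_simps)
    then show "trapezoid T y * V y = (\<Sum>\<rho>\<in>ZU. real (m \<rho>) * (trapezoid T y * V\<^sub>\<rho> \<rho> y)) + trapezoid T y * V\<^sub>h y"
      by (simp add: distrib_left sum_distrib_left mult_ac)
  qed
  moreover have "E W = (\<Sum>\<rho>\<in>ZU. real (m \<rho>) * E (W\<^sub>\<rho> \<rho>)) + E W\<^sub>h"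
    unfolding E_def using Wsum[of "-T"] Wsum[of "-T-1"] Wsum[of "T+1"] Wsum[of T] T
    by (simp add: algebra_simps sum.distrib sum_subtractf)
  moreover have "(\<Sum>\<rho>\<in>ZU. real (m \<rho>) * K \<rho>) = 2 * pi * (\<Sum>\<rho>\<in>Z. of_int (zorder F \<rho>) * (Re \<rho> - \<sigma>\<^sub>0) * trapezoid T (Im \<rho>))"
  proof -
    have ZZ: "Z \<subseteq> ZU"
    proof
      fix \<rho> assume \<rho>: "\<rho> \<in> Z"
      then have "Re \<rho> < \<sigma>\<^sub>1" using nonzero_right[of \<rho>] \<sigma>\<^sub>1 by (force simp: Z_def)
      with \<rho> \<sigma>\<^sub>0 show "\<rho> \<in> ZU" by (auto simp: Z_def ZU_def U_def in_box_complex_iff)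
    qed
    have "(\<Sum>\<rho>\<in>ZU. real (m \<rho>) * K \<rho>) = (\<Sum>\<rho>\<in>Z. real (m \<rho>) * K \<rho>)"
    proof (rule sum.mono_neutral_right[OF finZ ZZ], rule ballI)
      fix \<rho> assume "\<rho> \<in> ZU - Z"
      then have "Re \<rho> \<le> \<sigma>\<^sub>0 \<or> \<bar>Im \<rho>\<bar> \<ge> T + 1" by (auto simp: ZU_def Z_def)
      then show "real (m \<rho>) * K \<rho> = 0" by (auto simp: K_def trapezoid_def)
    qed
    also have "\<dots> = (\<Sum>\<rho>\<in>Z. 2 * pi * (of_int (zorder F \<rho>) * (Re \<rho> - \<sigma>\<^sub>0) * trapezoid T (Im \<rho>)))"
    proof (rule sum.cong[OF refl])
      fix \<rho> assume \<rho>: "\<rho> \<in> Z"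
      then have "zorder F \<rho> \<ge> 0"
        using ZZ zorder_exist_zero[OF holU U(1) convex_connected[OF U(2)] _ nz, of \<rho>]
        by (auto simp: ZU_def split: if_splits)
      then have "real (m \<rho>) = of_int (zorder F \<rho>)" by (simp add: m_def)
      moreover have "max 0 (Re \<rho> - \<sigma>\<^sub>0) = Re \<rho> - \<sigma>\<^sub>0" using \<rho> by (simp add: Z_def)
      ultimately show "real (m \<rho>) * K \<rho> = 2 * pi * (of_int (zorder F \<rho>) * (Re \<rho> - \<sigma>\<^sub>0) * trapezoid T (Im \<rho>))"
        unfolding K_def by (simp only: mult_ac)
    qed
    finally show ?thesis by (simp only: sum_distrib_left)
  qed
  ultimately show ?thesis
    unfolding V_def E_def by (simp add: distrib_left sum.distrib add_ac)
qed

end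

section \<open>Horizontal integrals and bounds far to the right\<close>

text \<open>Convergence at the points of a finite net is carried to the points in between by the Lipschitz
  bound, which the limit inherits.\<close>

lemma uniform_limit_of_lipschitz:
  fixes g :: "real \<Rightarrow> real \<Rightarrow> real" and G :: "real \<Rightarrow> real"
  assumes \<Lambda>: "\<Lambda> \<ge> 0"
    and lip: "eventually (\<lambda>T. \<forall>x\<in>{a..b}. \<forall>y\<in>{a..b}. \<bar>g T x - g T y\<bar> \<le> \<Lambda> * \<bar>x - y\<bar>) at_top"
    and lim: "\<And>x. x \<in> {a..b} \<Longrightarrow> ((\<lambda>T. g T x) \<longlongrightarrow> G x) at_top"
  shows "uniform_limit {a..b} g G at_top"
proof (rule uniform_limitI)
  fix e :: real assume e: "e > 0"
  have lipG: "\<bar>G x - G y\<bar> \<le> \<Lambda> * \<bar>x - y\<bar>" if "x \<in> {a..b}" "y \<in> {a..b}" for x y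
  proof (rule tendsto_upperbound)
    show "((\<lambda>T. \<bar>g T x - g T y\<bar>) \<longlongrightarrow> \<bar>G x - G y\<bar>) at_top"
      by (intro tendsto_intros lim that)
    show "eventually (\<lambda>T. \<bar>g T x - g T y\<bar> \<le> \<Lambda> * \<bar>x - y\<bar>) at_top"
      using lip by eventually_elim (use that in blast)
  qed simp
  define \<delta> where "\<delta> = e / (4 * (\<Lambda> + 1))"
  have \<delta>: "\<delta> > 0" "\<Lambda> * \<delta> < e / 3"
  proof -
    show "\<delta> > 0" using e \<Lambda> by (simp add: \<delta>_def)
    have "\<Lambda> * \<delta> = \<Lambda> / (\<Lambda> + 1) * (e / 4)" by (simp add: \<delta>_def)
    also have "\<dots> \<le> 1 * (e / 4)" using e \<Lambda> by (intro mult_right_mono) auto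
    finally show "\<Lambda> * \<delta> < e / 3" using e by simp
  qed
  obtain k where k: "finite k" "k \<subseteq> {a..b}" "{a..b} \<subseteq> (\<Union>x\<in>k. ball x \<delta>)"
  proof (rule compactE_image[of "{a..b}" "{a..b}" "\<lambda>x. ball x \<delta>"])
    show "{a..b} \<subseteq> (\<Union>x\<in>{a..b}. ball x \<delta>)" using \<delta>(1) by force
  qed (use that in auto)
  have "eventually (\<lambda>T. \<forall>x\<in>k. dist (g T x) (G x) < e / 3) at_top"
  proof (rule eventually_ball_finite[OF k(1)], rule ballI)
    fix x assume "x \<in> k"
    then show "eventually (\<lambda>T. dist (g T x) (G x) < e / 3) at_top"
      using k(2) e by (intro tendstoD lim) auto
  qed
  then show "eventually (\<lambda>T. \<forall>x\<in>{a..b}. dist (g T x) (G x) < e) at_top"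
    using lip
  proof eventually_elim
    case (elim T)
    show ?case
    proof
      fix x assume x: "x \<in> {a..b}"
      then obtain y where y: "y \<in> k" "dist y x < \<delta>" using k(3) by auto
      have yab: "y \<in> {a..b}" using y k(2) by auto
      have d: "\<Lambda> * \<bar>x - y\<bar> \<le> \<Lambda> * \<delta>"
        using y(2) \<Lambda> by (intro mult_left_mono) (auto simp: dist_real_def)
      have "\<bar>g T x - g T y\<bar> \<le> \<Lambda> * \<bar>x - y\<bar>" using elim(2) x yab by blast
      moreover have "\<bar>G x - G y\<bar> \<le> \<Lambda> * \<bar>x - y\<bar>" by (rule lipG[OF x yab])
      moreover have "dist (g T y) (G y) < e / 3" using elim(1) y(1) by blast
      ultimately show "dist (g T x) (G x) < e"
        using d \<delta>(2) unfolding dist_real_def by linarith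
    qed
  qed
qed

context normalised_dirichlet_function
begin

lemma A_nonneg: "A \<ge> 0"
proof -
  have "0 \<le> A / X ^ 3" using order_trans[OF norm_ge_zero decay[of "of_real X"]] by simp
  then show ?thesis using X by (simp add: zero_le_divide_iff)
qed

lemma log_tail_bound:
  assumes s: "Re s \<ge> X"
  shows "\<bar>ln (norm (F s))\<bar> \<le> 2 * A / Re s ^ 3"
proof -
  define r where "r = norm (F s)"
  have r: "r \<ge> 1 / 2" unfolding r_def by (rule norm_ge_half[OF s])
  have d: "\<bar>r - 1\<bar> \<le> norm (F s - 1)" unfolding r_def using norm_triangle_ineq3[of "F s" 1] by simp
  have "ln r \<le> r - 1" using r by (intro ln_le_minus_one) simp
  moreover have "- ln r \<le> 2 * \<bar>r - 1\<bar>"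
  proof -
    have "- ln r = ln (1 / r)" using r by (simp add: ln_div)
    also have "\<dots> \<le> 1 / r - 1" using r by (intro ln_le_minus_one) simp
    also have "\<dots> = (1 - r) / r" using r by (simp add: field_simps)
    also have "\<dots> \<le> \<bar>r - 1\<bar> / r" using r by (intro divide_right_mono) auto
    also have "\<dots> \<le> \<bar>r - 1\<bar> / (1 / 2)" using r by (intro divide_left_mono) auto
    finally show ?thesis by simp
  qed
  moreover have "r - 1 \<le> 2 * \<bar>r - 1\<bar>"
    unfolding mult_2 by (rule order_trans[OF abs_ge_self]) simp
  ultimately have "\<bar>ln r\<bar> \<le> 2 * \<bar>r - 1\<bar>" by (intro abs_leI) (rule order_trans)
  also have "\<dots> \<le> 2 * (A / Re s ^ 3)" using d decay[OF s] by simp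
  finally show ?thesis by (simp add: r_def)
qed

text \<open>Cauchy's estimate on the unit circle around \<open>s\<close>.\<close>

lemma logderiv_tail_bound:
  assumes s: "Re s \<ge> X + 1"
  shows "norm (deriv F s / F s) \<le> 2 * A / (Re s - 1) ^ 3"
proof -
  have nn: "norm (F w - 1) \<le> A / (Re s - 1) ^ 3" if "norm (s - w) = 1" for w
  proof -
    have "Re w \<ge> Re s - 1" using abs_Re_le_cmod[of "s - w"] that by simp
    then have w: "Re w \<ge> X" "Re s - 1 \<le> Re w" using s by auto
    have "norm (F w - 1) \<le> A / Re w ^ 3" using decay w by blast
    also have "\<dots> \<le> A / (Re s - 1) ^ 3"
      using w s X A_nonneg by (intro divide_left_mono power_mono mult_pos_pos zero_less_power) auto
    finally show ?thesis .
  qed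
  have pos: "Re w > 0" if "w \<in> cball s 1" for w
  proof -
    have "\<bar>Re (s - w)\<bar> \<le> 1" using that abs_Re_le_cmod[of "s - w"] by (simp add: dist_norm)
    then show ?thesis using s X by simp
  qed
  have hol1: "(\<lambda>w. F w - 1) holomorphic_on cball s 1"
    using pos by (intro holomorphic_intros holomorphic_on_subset[OF hol]) auto
  have "norm ((deriv ^^ 1) (\<lambda>w. F w - 1) s) \<le> fact 1 * (A / (Re s - 1) ^ 3) / 1 ^ 1"
  proof (rule Cauchy_inequality)
    show "(\<lambda>w. F w - 1) holomorphic_on ball s 1" by (rule holomorphic_on_subset[OF hol1]) auto
    show "continuous_on (cball s 1) (\<lambda>w. F w - 1)" by (rule holomorphic_on_imp_continuous_on[OF hol1])
  qed (use nn in auto)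
  moreover have "deriv (\<lambda>w. F w - 1) s = deriv F s"
  proof -
    have "F field_differentiable at s"
      using hol half_plane_open s X holomorphic_on_imp_differentiable_at by auto
    then show ?thesis by (subst deriv_diff) (auto simp: deriv_const)
  qed
  ultimately have d: "norm (deriv F s) \<le> A / (Re s - 1) ^ 3" by simp
  have g: "norm (F s) \<ge> 1 / 2" using s by (intro norm_ge_half) auto
  have "norm (deriv F s / F s) \<le> (A / (Re s - 1) ^ 3) / (1 / 2)"
    unfolding norm_divide using d g order_trans[OF norm_ge_zero d] by (intro frac_le) auto
  then show ?thesis by (simp add: mult.commute)
qed

definition weighted_zero_sum :: "real \<Rightarrow> real \<Rightarrow> real" where
  "weighted_zero_sum \<sigma> T = (\<Sum>\<rho>\<in>{s. \<sigma> < Re s \<and> \<bar>Im s\<bar> < T \<and> F s = 0}. of_int (zorder F \<rho>) * (Re \<rho> - \<sigma>))"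

definition log_line_integral :: "real \<Rightarrow> real \<Rightarrow> real" where
  "log_line_integral \<sigma> T = integral {-T..T} (\<lambda>t. ln (norm (F (Complex \<sigma> t))))"

lemma finite_zero_rectangle:
  assumes "\<sigma> > 0"
  shows "finite {s. \<sigma> < Re s \<and> \<bar>Im s\<bar> < T \<and> F s = 0}"
proof (rule finite_subset)
  show "{s. \<sigma> < Re s \<and> \<bar>Im s\<bar> < T \<and> F s = 0} \<subseteq> {s \<in> cbox (Complex \<sigma> (-T)) (Complex X T). F s = 0}"
    using nonzero_right by (force simp: in_cbox_complex_iff)
  show "finite {s \<in> cbox (Complex \<sigma> (-T)) (Complex X T). F s = 0}"
    using assms by (intro finite_zeros compact_cbox) (auto simp: in_cbox_complex_iff)
qed

lemma zorder_zero_pos: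
  assumes "Re s > 0" "F s = 0"
  shows "zorder F s > 0"
proof -
  have "\<exists>w\<in>{s. Re s > 0}. F w \<noteq> 0"
    using nonzero_right[of "of_real X"] X by (intro bexI[of _ "of_real X"]) auto
  with zorder_exist_zero[OF hol half_plane_open convex_connected[OF half_plane_convex], of s] assms
  show ?thesis by auto
qed

lemma horizontal_tail_bound:
  assumes x: "X \<le> p" "p \<le> q" and \<sigma>: "0 \<le> \<sigma>" "\<sigma> \<le> p"
  shows "(\<lambda>x. (x - \<sigma>) * ln (norm (F (Complex x y)))) integrable_on {p..q}"
    and "\<bar>integral {p..q} (\<lambda>x. (x - \<sigma>) * ln (norm (F (Complex x y))))\<bar> \<le> 2 * A"
proof -
  have nz: "F (Complex x y) \<noteq> 0" if "x \<in> {p..q}" for x using that x by (intro nonzero_right) auto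
  show i: "(\<lambda>x. (x - \<sigma>) * ln (norm (F (Complex x y)))) integrable_on {p..q}"
    using nz x X by (intro integrable_continuous_interval continuous_intros contF_compose) auto
  have "((\<lambda>x. 2 * A / x\<^sup>2) has_integral (- (2 * A) / q - (- (2 * A) / p))) {p..q}"
  proof (rule fundamental_theorem_of_calculus[OF x(2)])
    fix t assume t: "t \<in> {p..q}"
    then have "t \<noteq> 0" using x X by auto
    then have "((\<lambda>x. - (2 * A) / x) has_real_derivative 2 * A / t\<^sup>2) (at t)"
      by (auto intro!: derivative_eq_intros simp: power2_eq_square)
    then show "((\<lambda>x. - (2 * A) / x) has_vector_derivative 2 * A / t\<^sup>2) (at t within {p..q})"
      by (simp add: has_real_derivative_iff_has_vector_derivative has_vector_derivative_at_within)
  qed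
  then have hi: "((\<lambda>x. 2 * A / x\<^sup>2) has_integral (2 * A / p - 2 * A / q)) {p..q}" by simp
  have "norm (integral {p..q} (\<lambda>x. (x - \<sigma>) * ln (norm (F (Complex x y))))) \<le> integral {p..q} (\<lambda>x. 2 * A / x\<^sup>2)"
  proof (rule integral_norm_bound_integral[OF i])
    show "(\<lambda>x. 2 * A / x\<^sup>2) integrable_on {p..q}" using hi by blast
    fix t assume t: "t \<in> {p..q}"
    have t1: "t \<ge> 1" using t x X by auto
    have "norm ((t - \<sigma>) * ln (norm (F (Complex t y)))) = (t - \<sigma>) * \<bar>ln (norm (F (Complex t y)))\<bar>"
      using t \<sigma> by (simp add: abs_mult)
    also have "\<dots> \<le> t * (2 * A / t ^ 3)"
      using log_tail_bound[of "Complex t y"] t x \<sigma> t1 by (intro mult_mono) auto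
    also have "\<dots> = 2 * A / t\<^sup>2" using t1 by (simp add: power2_eq_square power3_eq_cube)
    finally show "norm ((t - \<sigma>) * ln (norm (F (Complex t y)))) \<le> 2 * A / t\<^sup>2" .
  qed
  also have "\<dots> = 2 * A / p - 2 * A / q" using hi by (rule integral_unique)
  also have "\<dots> \<le> 2 * A"
  proof -
    have "2 * A / p \<le> 2 * A" using A_nonneg x X by (simp add: divide_le_eq mult_le_cancel_left1)
    moreover have "2 * A / q \<ge> 0" using A_nonneg x X by simp
    ultimately show ?thesis by linarith
  qed
  finally show "\<bar>integral {p..q} (\<lambda>x. (x - \<sigma>) * ln (norm (F (Complex x y))))\<bar> \<le> 2 * A" by simp
qed

text \<open>The part of the horizontal segment inside the strip is controlled by \<open>strip_log_bound\<close>, the part to the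
  right of the strip by the decay of \<open>F - 1\<close>; the bound does not depend on how far the segment extends.\<close>

lemma segment_log_bounds:
  assumes \<kappa>: "\<kappa> > 0"
  shows "\<exists>C>0. \<forall>\<sigma>\<ge>\<kappa>. \<forall>y. 
     (\<forall>q\<ge>max \<sigma> X. \<bar>integral {\<sigma>..q} (\<lambda>x. (x - \<sigma>) * ln (norm (F (Complex x y))))\<bar> \<le> C * ln (3 + \<bar>y\<bar>)) \<and>
     integral {y..y+1} (\<lambda>t. \<bar>ln (norm (F (Complex \<sigma> t)))\<bar>) \<le> C * ln (3 + \<bar>y\<bar>)"
proof -
  define X1 where "X1 = max X (2 / \<kappa> + \<kappa>)"
  have X1: "X1 \<ge> X" "X1 \<ge> 2 / \<kappa> + \<kappa>" by (auto simp: X1_def)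
  obtain C M where C: "C > 0" and M: "\<And>y. M y \<le> C * ln (3 + \<bar>y\<bar>)"
    and seg: "\<And>y w e p q. norm e = 1 \<Longrightarrow> p \<le> q \<Longrightarrow>
        (\<forall>t\<in>{p..q}. \<kappa> \<le> Re (w + of_real t * e) \<and> Re (w + of_real t * e) \<le> X1 \<and> \<bar>Im (w + of_real t * e) - y\<bar> \<le> 1) \<Longrightarrow>
     (\<lambda>t. ln (norm (F (w + of_real t * e)))) absolutely_integrable_on {p..q} \<and>
     integral {p..q} (\<lambda>t. \<bar>ln (norm (F (w + of_real t * e)))\<bar>) \<le> C * M y"
    using strip_log_bound[OF \<kappa> X1] by blast
  have ln1: "ln (3 + \<bar>y\<bar>) \<ge> 1" for y :: real
  proof -
    have "exp (1::real) \<le> 3" by (rule exp_le)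
    then show ?thesis by (subst ln_ge_iff) auto
  qed
  define K where "K = X1 * C\<^sup>2 + C\<^sup>2 + 2 * A + 1"
  have X1p: "X1 \<ge> 1" using X1 X by simp
  have K: "K > 0" "2 * A \<le> K" "C\<^sup>2 \<le> K" using A_nonneg X1p by (auto simp: K_def add_nonneg_pos)
  have CM: "C * M y \<le> C\<^sup>2 * ln (3 + \<bar>y\<bar>)" for y
    using mult_left_mono[OF M[of y], of C] C by (simp add: power2_eq_square mult.assoc)
  have hor: "\<bar>integral {\<sigma>..q} (\<lambda>x. (x - \<sigma>) * ln (norm (F (Complex x y))))\<bar> \<le> K * ln (3 + \<bar>y\<bar>)"
    if \<sigma>: "\<sigma> \<ge> \<kappa>" and q: "q \<ge> max \<sigma> X" for \<sigma> q y
  proof -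
    let ?g = "\<lambda>x. (x - \<sigma>) * ln (norm (F (Complex x y)))"
    have near: "?g integrable_on {\<sigma>..r} \<and> \<bar>integral {\<sigma>..r} ?g\<bar> \<le> X1 * C\<^sup>2 * ln (3 + \<bar>y\<bar>)"
      if r: "\<sigma> \<le> r" "r \<le> X1" for r
    proof -
      have eq: "Complex x y = of_real y * \<i> + of_real x * 1" for x by (simp add: complex_eq_iff)
      have s: "(\<lambda>x. ln (norm (F (Complex x y)))) absolutely_integrable_on {\<sigma>..r} \<and>
          integral {\<sigma>..r} (\<lambda>x. \<bar>ln (norm (F (Complex x y)))\<bar>) \<le> C * M y"
        unfolding eq by (rule seg) (use r \<sigma> in auto)
      have ai: "?g absolutely_integrable_on {\<sigma>..r}"
      proof (rule absolutely_integrable_bounded_measurable_product_real)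
        show "(\<lambda>x. x - \<sigma>) \<in> borel_measurable (lebesgue_on {\<sigma>..r})"
          by (intro continuous_imp_measurable_on_sets_lebesgue continuous_intros) auto
        show "bounded ((\<lambda>x. x - \<sigma>) ` {\<sigma>..r})"
          by (intro compact_imp_bounded compact_continuous_image continuous_intros) auto
        show "{\<sigma>..r} \<in> sets lebesgue" by simp
        show "(\<lambda>x. ln (norm (F (Complex x y)))) absolutely_integrable_on {\<sigma>..r}"
          by (rule s[THEN conjunct1])
      qed
      have gi: "?g integrable_on {\<sigma>..r}" using ai by (rule set_lebesgue_integral_eq_integral)
      have ui: "(\<lambda>x. \<bar>ln (norm (F (Complex x y)))\<bar>) integrable_on {\<sigma>..r}"
        using s by (auto simp: absolutely_integrable_on_def)
      have "norm (integral {\<sigma>..r} ?g) \<le> integral {\<sigma>..r} (\<lambda>x. X1 * \<bar>ln (norm (F (Complex x y)))\<bar>)"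
      proof (rule integral_norm_bound_integral[OF gi integrable_on_mult_right[OF ui]])
        fix x assume "x \<in> {\<sigma>..r}"
        then show "norm (?g x) \<le> X1 * \<bar>ln (norm (F (Complex x y)))\<bar>"
          using r \<sigma> \<kappa> by (auto simp: abs_mult intro!: mult_right_mono)
      qed
      also have "\<dots> = X1 * integral {\<sigma>..r} (\<lambda>x. \<bar>ln (norm (F (Complex x y)))\<bar>)" by simp
      also have "\<dots> \<le> X1 * (C\<^sup>2 * ln (3 + \<bar>y\<bar>))"
        using X1p by (intro mult_left_mono order_trans[OF conjunct2[OF s] CM]) auto
      finally show ?thesis using gi by (simp add: mult.assoc)
    qed
    have total: "\<bar>integral {\<sigma>..q} ?g\<bar> \<le> X1 * C\<^sup>2 * ln (3 + \<bar>y\<bar>) + 2 * A"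
    proof (cases "q \<le> X1")
      case True
      then show ?thesis using near[of q] q A_nonneg by auto
    next
      case False
      define r where "r = max \<sigma> X1"
      have r: "\<sigma> \<le> r" "X \<le> r" "r \<le> q" using X1 q False by (auto simp: r_def)
      have t: "?g integrable_on {r..q}" "\<bar>integral {r..q} ?g\<bar> \<le> 2 * A"
        using horizontal_tail_bound[of r q \<sigma> y] r \<sigma> \<kappa> by auto
      have n: "?g integrable_on {\<sigma>..r} \<and> \<bar>integral {\<sigma>..r} ?g\<bar> \<le> X1 * C\<^sup>2 * ln (3 + \<bar>y\<bar>)"
      proof (cases "\<sigma> \<le> X1")
        case True
        then show ?thesis using near[of r] by (simp add: r_def)
      next
        case False
        then have "r = \<sigma>" by (simp add: r_def)
        then show ?thesis using X1p ln1[of y] integrable_on_refl[of ?g \<sigma>] by auto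
      qed
      have "?g integrable_on {\<sigma>..q}"
        by (rule Henstock_Kurzweil_Integration.integrable_combine[OF r(1) r(3) conjunct1[OF n] t(1)])
      then have "integral {\<sigma>..q} ?g = integral {\<sigma>..r} ?g + integral {r..q} ?g"
        by (rule Henstock_Kurzweil_Integration.integral_combine[OF r(1) r(3), symmetric])
      then show ?thesis using n t by linarith
    qed
    also have "X1 * C\<^sup>2 * ln (3 + \<bar>y\<bar>) + 2 * A \<le> X1 * C\<^sup>2 * ln (3 + \<bar>y\<bar>) + 2 * A * ln (3 + \<bar>y\<bar>)"
      using ln1[of y] A_nonneg mult_left_mono[of 1 "ln (3 + \<bar>y\<bar>)" "2 * A"] by simp
    also have "\<dots> = (X1 * C\<^sup>2 + 2 * A) * ln (3 + \<bar>y\<bar>)" by (simp add: distrib_right)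
    also have "\<dots> \<le> K * ln (3 + \<bar>y\<bar>)" using ln1[of y] by (intro mult_right_mono) (auto simp: K_def)
    finally show ?thesis .
  qed
  have ver: "integral {y..y+1} (\<lambda>t. \<bar>ln (norm (F (Complex \<sigma> t)))\<bar>) \<le> K * ln (3 + \<bar>y\<bar>)"
    if \<sigma>: "\<sigma> \<ge> \<kappa>" for \<sigma> y
  proof (cases "\<sigma> \<le> X1")
    case True
    have eq: "Complex \<sigma> t = of_real \<sigma> + of_real t * \<i>" for t by (simp add: complex_eq_iff)
    have "(\<lambda>t. ln (norm (F (Complex \<sigma> t)))) absolutely_integrable_on {y..y+1} \<and>
        integral {y..y+1} (\<lambda>t. \<bar>ln (norm (F (Complex \<sigma> t)))\<bar>) \<le> C * M y"
      unfolding eq by (rule seg) (use \<sigma> True in auto)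
    then have "integral {y..y+1} (\<lambda>t. \<bar>ln (norm (F (Complex \<sigma> t)))\<bar>) \<le> C\<^sup>2 * ln (3 + \<bar>y\<bar>)"
      using CM[of y] by linarith
    also have "\<dots> \<le> K * ln (3 + \<bar>y\<bar>)" using K ln1[of y] by (intro mult_right_mono) auto
    finally show ?thesis .
  next
    case False
    have sX: "\<sigma> \<ge> X" "\<sigma> \<ge> 1" using False X1 X by auto
    have i: "(\<lambda>t. \<bar>ln (norm (F (Complex \<sigma> t)))\<bar>) integrable_on {y..y+1}"
      using log_line_integrable[of \<sigma> y "y+1"] \<sigma> \<kappa> by (auto simp: absolutely_integrable_on_def)
    have "integral {y..y+1} (\<lambda>t. \<bar>ln (norm (F (Complex \<sigma> t)))\<bar>) \<le> integral {y..y+1} (\<lambda>_. 2 * A)"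
    proof (intro integral_le i integrable_const_ivl)
      fix t
      have "\<bar>ln (norm (F (Complex \<sigma> t)))\<bar> \<le> 2 * A / \<sigma> ^ 3" using log_tail_bound[of "Complex \<sigma> t"] sX by simp
      also have "\<dots> \<le> 2 * A / 1" using sX A_nonneg by (intro divide_left_mono one_le_power) auto
      finally show "\<bar>ln (norm (F (Complex \<sigma> t)))\<bar> \<le> 2 * A" by simp
    qed
    also have "\<dots> = 2 * A * 1" by simp
    also have "\<dots> \<le> K * ln (3 + \<bar>y\<bar>)" using K ln1[of y] by (intro mult_mono) auto
    finally show ?thesis .
  qed
  show ?thesis using K(1) hor ver by blast
qed

end

section \<open>Zeros and the Jessen function\<close>

context normalised_dirichlet_function
begin

definition smoothed_zero_sum :: "real \<Rightarrow> real \<Rightarrow> real" where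
  "smoothed_zero_sum \<sigma> T = (\<Sum>\<rho>\<in>{s. \<sigma> < Re s \<and> \<bar>Im s\<bar> < T + 1 \<and> F s = 0}.
     of_int (zorder F \<rho>) * (Re \<rho> - \<sigma>) * trapezoid T (Im \<rho>))"

text \<open>The smoothed Littlewood identity with right edge at distance about \<open>T\<close>: there \<open>ln \<bar>F\<bar>\<close> and the logarithmic
  derivative, multiplied by the width and integrated over the height, are bounded. The horizontal
  integrals and the two unit intervals on which the cut-off is not constant cost \<open>O(log T)\<close>.\<close>

lemma smoothed_zero_sum_log_integral:
  assumes \<kappa>: "\<kappa> > 0"
  shows "\<exists>C>0. \<forall>\<sigma>\<ge>\<kappa>. \<forall>T\<ge>1.
     \<bar>2 * pi * smoothed_zero_sum \<sigma> T
       - log_line_integral \<sigma> T\<bar> \<le> C * ln (4 + T)"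
proof -
  obtain C where C: "C > 0"
    and hor: "\<And>\<sigma> y q. \<sigma> \<ge> \<kappa> \<Longrightarrow> q \<ge> max \<sigma> X \<Longrightarrow> \<bar>integral {\<sigma>..q} (\<lambda>x. (x - \<sigma>) * ln (norm (F (Complex x y))))\<bar> \<le> C * ln (3 + \<bar>y\<bar>)"
    and ver: "\<And>\<sigma> y. \<sigma> \<ge> \<kappa> \<Longrightarrow> integral {y..y+1} (\<lambda>t. \<bar>ln (norm (F (Complex \<sigma> t)))\<bar>) \<le> C * ln (3 + \<bar>y\<bar>)"
    using segment_log_bounds[OF \<kappa>] by blast
  define K where "K = 6 * C + 20 * A"
  have K: "K > 0" using C A_nonneg by (simp add: K_def add_pos_nonneg)
  show ?thesis
  proof (intro exI[of _ K] conjI allI impI K)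
    fix \<sigma> T :: real assume \<sigma>: "\<kappa> \<le> \<sigma>" and T: "1 \<le> T"
    (* to the right of the line through sigma, and at distance at least T *)
    define \<sigma>\<^sub>1 where "\<sigma>\<^sub>1 = \<sigma> + X + T + 2"
    have \<sigma>0: "\<sigma> > 0" using \<sigma> \<kappa> by simp
    have \<sigma>1: "\<sigma> \<le> \<sigma>\<^sub>1" "X + 1 \<le> \<sigma>\<^sub>1" "T + 1 \<le> \<sigma>\<^sub>1 - 1" "max \<sigma> X \<le> \<sigma>\<^sub>1" "1 \<le> \<sigma>\<^sub>1" "X \<le> \<sigma>\<^sub>1"
      using X T \<sigma>0 by (auto simp: \<sigma>\<^sub>1_def)
    define W where "W = (\<lambda>y. integral {\<sigma>..\<sigma>\<^sub>1} (\<lambda>x. (x - \<sigma>) * ln (norm (F (Complex x y)))))"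
    define u where "u = (\<lambda>y. ln (norm (F (Complex \<sigma> y))))"
    define r where "r = (\<lambda>y. - ln (norm (F (Complex \<sigma>\<^sub>1 y))) + (\<sigma>\<^sub>1 - \<sigma>) * Re (deriv F (Complex \<sigma>\<^sub>1 y) / F (Complex \<sigma>\<^sub>1 y)))"
    define S where "S = 2 * pi * smoothed_zero_sum \<sigma> T"
    define \<Delta> where "\<Delta> = W (-T) - W (-T-1) - W (T+1) + W T"
    have id: "((\<lambda>y. trapezoid T y * (u y + r y)) has_integral (\<Delta> + S)) {-T-1..T+1}"
    proof -
      have "((\<lambda>y. trapezoid T y * (u y - ln (norm (F (Complex \<sigma>\<^sub>1 y)))
            + (\<sigma>\<^sub>1 - \<sigma>) * Re (deriv F (Complex \<sigma>\<^sub>1 y) / F (Complex \<sigma>\<^sub>1 y)))) has_integral (\<Delta> + S)) {-T-1..T+1}"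
        unfolding \<Delta>_def S_def W_def u_def smoothed_zero_sum_def
        by (rule littlewood_trapezoid) (use \<sigma>0 \<sigma>1 T in auto)
      moreover have "u y - ln (norm (F (Complex \<sigma>\<^sub>1 y))) + (\<sigma>\<^sub>1 - \<sigma>) * Re (deriv F (Complex \<sigma>\<^sub>1 y) / F (Complex \<sigma>\<^sub>1 y)) = u y + r y" for y
        by (simp add: r_def)
      ultimately show ?thesis by (simp only:)
    qed
    have lnT: "ln (4 + T) \<ge> 1"
    proof -
      have "exp (1::real) \<le> 4 + T" using exp_le T by linarith
      then show ?thesis using T by (subst ln_ge_iff) auto
    qed
    have lnle: "C * ln (3 + \<bar>y\<bar>) \<le> C * ln (4 + T)" if "\<bar>y\<bar> \<le> T + 1" for y
      using that T C by (intro mult_left_mono ln_mono) auto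
    have Wb: "\<bar>W y\<bar> \<le> C * ln (4 + T)" if "\<bar>y\<bar> \<le> T + 1" for y
      unfolding W_def using hor[OF \<sigma> \<sigma>1(4), of y] lnle[OF that] by linarith
    have \<Delta>: "\<bar>\<Delta>\<bar> \<le> 4 * (C * ln (4 + T))"
      using Wb[of "-T"] Wb[of "-T-1"] Wb[of "T+1"] Wb[of T] T unfolding \<Delta>_def by (simp add: abs_le_iff)
    have rb: "\<bar>r y\<bar> \<le> 5 * A / (T + 1)" for y
    proof -
      let ?s = "Complex \<sigma>\<^sub>1 y"
      have T1: "T + 1 > 0" using T by simp
      have "\<bar>ln (norm (F ?s))\<bar> \<le> 2 * A / \<sigma>\<^sub>1 ^ 3" using log_tail_bound[of ?s] \<sigma>1 by simp
      also have "\<dots> \<le> 2 * A / (T + 1)"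
      proof (intro divide_left_mono mult_pos_pos)
        have "(T + 1) ^ 1 \<le> \<sigma>\<^sub>1 ^ 1" using \<sigma>1 by simp
        also have "\<dots> \<le> \<sigma>\<^sub>1 ^ 3" using \<sigma>1 by (intro power_increasing) auto
        finally show "T + 1 \<le> \<sigma>\<^sub>1 ^ 3" by simp
      qed (use A_nonneg T1 \<sigma>1 in auto)
      finally have a: "\<bar>ln (norm (F ?s))\<bar> \<le> 2 * A / (T + 1)" .
      have "\<bar>(\<sigma>\<^sub>1 - \<sigma>) * Re (deriv F ?s / F ?s)\<bar> \<le> (\<sigma>\<^sub>1 - \<sigma>) * norm (deriv F ?s / F ?s)"
        using \<sigma>1 abs_Re_le_cmod[of "deriv F ?s / F ?s"] by (simp add: abs_mult mult_left_mono)
      also have "\<dots> \<le> (3 / 2 * (\<sigma>\<^sub>1 - 1)) * (2 * A / (\<sigma>\<^sub>1 - 1) ^ 3)"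
        using logderiv_tail_bound[of ?s] \<sigma>1 T X \<sigma>0 by (intro mult_mono) (auto simp: \<sigma>\<^sub>1_def)
      also have "\<dots> = 3 * A / (\<sigma>\<^sub>1 - 1)\<^sup>2"
      proof -
        have "(3 / 2 * q) * (2 * A / q ^ 3) = 3 * A / q\<^sup>2" if "q > 0" for q
          using that by (simp add: power2_eq_square power3_eq_cube)
        moreover have "\<sigma>\<^sub>1 - 1 > 0" using \<sigma>1 T1 by simp
        ultimately show ?thesis by blast
      qed
      also have "\<dots> \<le> 3 * A / (T + 1)"
      proof (intro divide_left_mono mult_pos_pos)
        have "T + 1 \<le> (\<sigma>\<^sub>1 - 1) ^ 1" using \<sigma>1 by simp
        also have "\<dots> \<le> (\<sigma>\<^sub>1 - 1)\<^sup>2" using \<sigma>1 T by (intro power_increasing) auto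
        finally show "T + 1 \<le> (\<sigma>\<^sub>1 - 1)\<^sup>2" .
      qed (use A_nonneg T1 \<sigma>1 in auto)
      finally have b: "\<bar>(\<sigma>\<^sub>1 - \<sigma>) * Re (deriv F ?s / F ?s)\<bar> \<le> 3 * A / (T + 1)" .
      have "\<bar>r y\<bar> \<le> \<bar>ln (norm (F ?s))\<bar> + \<bar>(\<sigma>\<^sub>1 - \<sigma>) * Re (deriv F ?s / F ?s)\<bar>"
        unfolding r_def using abs_triangle_ineq[of "- ln (norm (F ?s))" "(\<sigma>\<^sub>1 - \<sigma>) * Re (deriv F ?s / F ?s)"] by simp
      also have "\<dots> \<le> 2 * A / (T + 1) + 3 * A / (T + 1)" using a b by (rule add_mono)
      also have "\<dots> = 5 * A / (T + 1)" by (simp add: add_divide_distrib[symmetric])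
      finally show ?thesis .
    qed
    have conttr: "continuous_on Q (trapezoid T)" for Q
      unfolding trapezoid_def[abs_def] by (intro continuous_intros)
    have contr: "continuous_on Q r" for Q
    proof -
      have "(deriv F) holomorphic_on {s. Re s > 0}" by (intro holomorphic_deriv hol half_plane_open)
      then have cd: "continuous_on {s. Re s > 0} (deriv F)" by (rule holomorphic_on_imp_continuous_on)
      have d: "continuous_on Q (\<lambda>y. deriv F (Complex \<sigma>\<^sub>1 y))"
        by (rule continuous_on_compose2[OF cd]) (use \<sigma>1 in \<open>auto intro!: continuous_intros\<close>)
      have f: "continuous_on Q (\<lambda>y. F (Complex \<sigma>\<^sub>1 y))"
        using \<sigma>1 by (intro contF_compose continuous_intros) auto
      have nz: "F (Complex \<sigma>\<^sub>1 y) \<noteq> 0" for y using \<sigma>1 by (intro nonzero_right) auto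
      show ?thesis unfolding r_def using nz by (intro continuous_intros d f) auto
    qed
    have rhi: "(\<lambda>y. trapezoid T y * r y) integrable_on {-T-1..T+1}"
      by (intro integrable_continuous_interval continuous_on_mult conttr contr)
    have rI: "\<bar>integral {-T-1..T+1} (\<lambda>y. trapezoid T y * r y)\<bar> \<le> 10 * A"
    proof -
      have "norm (integral {-T-1..T+1} (\<lambda>y. trapezoid T y * r y)) \<le> integral {-T-1..T+1} (\<lambda>_. 5 * A / (T + 1))"
      proof (rule integral_norm_bound_integral[OF rhi integrable_const_ivl])
        fix y
        have "norm (trapezoid T y * r y) = trapezoid T y * \<bar>r y\<bar>" using trapezoid_bounds[of T y] by (simp add: abs_mult)
        also have "\<dots> \<le> 1 * (5 * A / (T + 1))" using trapezoid_bounds[of T y] rb[of y] by (intro mult_mono) auto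
        finally show "norm (trapezoid T y * r y) \<le> 5 * A / (T + 1)" by simp
      qed
      also have "\<dots> = (2 * (T + 1)) * (5 * A / (T + 1))" using T by simp
      also have "\<dots> = 10 * A"
      proof -
        have "(2 * q) * (5 * A / q) = 10 * A" if "q > 0" for q using that by simp
        moreover have "T + 1 > 0" using T by simp
        ultimately show ?thesis by blast
      qed
      finally show ?thesis by simp
    qed
    have uhi: "((\<lambda>y. trapezoid T y * u y) has_integral (\<Delta> + S - integral {-T-1..T+1} (\<lambda>y. trapezoid T y * r y))) {-T-1..T+1}"
      using has_integral_diff[OF id integrable_integral[OF rhi]] by (simp add: distrib_left)
    have ua: "u absolutely_integrable_on {p..q}" for p q unfolding u_def by (rule log_line_integrable[OF \<sigma>0])
    have ui: "u integrable_on {p..q}" "(\<lambda>y. \<bar>u y\<bar>) integrable_on {p..q}" for p q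
      using ua[of p q] by (auto simp: absolutely_integrable_on_def)
    have tui: "(\<lambda>y. trapezoid T y * u y) integrable_on {p..q}" if "-T-1 \<le> p" "q \<le> T+1" for p q
      using has_integral_integrable[OF uhi] that integrable_subinterval_real[of "\<lambda>y. trapezoid T y * u y" "-T-1" "T+1" p q] by auto
    have edge: "\<bar>integral {y..y+1} (\<lambda>y. trapezoid T y * u y)\<bar> \<le> C * ln (4 + T)"
      if "y = T \<or> y = -T-1" for y
    proof -
      have "norm (integral {y..y+1} (\<lambda>y. trapezoid T y * u y)) \<le> integral {y..y+1} (\<lambda>y. \<bar>u y\<bar>)"
      proof (rule integral_norm_bound_integral[OF tui ui(2)])
        fix t
        have "norm (trapezoid T t * u t) = trapezoid T t * \<bar>u t\<bar>" using trapezoid_bounds[of T t] by (simp add: abs_mult)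
        also have "\<dots> \<le> 1 * \<bar>u t\<bar>" using trapezoid_bounds[of T t] by (intro mult_right_mono) auto
        finally show "norm (trapezoid T t * u t) \<le> \<bar>u t\<bar>" by simp
      qed (use that T in auto)
      also have "\<dots> \<le> C * ln (3 + \<bar>y\<bar>)" unfolding u_def by (rule ver[OF \<sigma>])
      also have "\<dots> \<le> C * ln (4 + T)" using that T by (intro lnle) auto
      finally show ?thesis by simp
    qed
    have mid: "integral {-T..T} (\<lambda>y. trapezoid T y * u y) = log_line_integral \<sigma> T"
      unfolding log_line_integral_def u_def
      by (rule integral_cong) (auto simp: trapezoid_def abs_if max_def min_def)
    have split: "integral {-T-1..T+1} (\<lambda>y. trapezoid T y * u y) =
       integral {-T-1..(-T-1)+1} (\<lambda>y. trapezoid T y * u y) + log_line_integral \<sigma> T + integral {T..T+1} (\<lambda>y. trapezoid T y * u y)"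
    proof -
      have "integral {-T-1..-T} (\<lambda>y. trapezoid T y * u y) + integral {-T..T+1} (\<lambda>y. trapezoid T y * u y) = integral {-T-1..T+1} (\<lambda>y. trapezoid T y * u y)"
        by (rule Henstock_Kurzweil_Integration.integral_combine) (use T tui[of "-T-1" "T+1"] in auto)
      moreover have "integral {-T..T} (\<lambda>y. trapezoid T y * u y) + integral {T..T+1} (\<lambda>y. trapezoid T y * u y) = integral {-T..T+1} (\<lambda>y. trapezoid T y * u y)"
        by (rule Henstock_Kurzweil_Integration.integral_combine) (use T tui[of "-T" "T+1"] in auto)
      ultimately show ?thesis using mid by simp
    qed
    have "S - log_line_integral \<sigma> T = integral {-T-1..(-T-1)+1} (\<lambda>y. trapezoid T y * u y) + integral {T..T+1} (\<lambda>y. trapezoid T y * u y)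
       + integral {-T-1..T+1} (\<lambda>y. trapezoid T y * r y) - \<Delta>"
      using split integral_unique[OF uhi] by linarith
    then have "\<bar>S - log_line_integral \<sigma> T\<bar> \<le> C * ln (4 + T) + C * ln (4 + T) + 10 * A + 4 * (C * ln (4 + T))"
      using edge[of T] edge[of "-T-1"] rI \<Delta> by linarith
    also have "\<dots> \<le> 6 * C * ln (4 + T) + 20 * A * ln (4 + T)"
      using mult_left_mono[OF lnT, of "10 * A"] mult_left_mono[OF lnT, of "10 * A"] A_nonneg by simp
    also have "\<dots> = K * ln (4 + T)" by (simp add: K_def distrib_right)
    finally show "\<bar>2 * pi * smoothed_zero_sum \<sigma> T
       - log_line_integral \<sigma> T\<bar> \<le> K * ln (4 + T)" by (simp only: S_def)
  qed
qed

lemma zero_sum_sandwich: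
  assumes \<sigma>: "\<sigma> > 0"
  shows "weighted_zero_sum \<sigma> T \<le> smoothed_zero_sum \<sigma> T"
    and "smoothed_zero_sum \<sigma> T \<le> weighted_zero_sum \<sigma> (T + 1)"
proof -
  let ?Z = "\<lambda>T. {s. \<sigma> < Re s \<and> \<bar>Im s\<bar> < T \<and> F s = 0}"
  have nn: "0 \<le> of_int (zorder F \<rho>) * (Re \<rho> - \<sigma>)" if "\<rho> \<in> ?Z (T + 1)" for \<rho>
    using zorder_zero_pos[of \<rho>] that \<sigma> by (intro mult_nonneg_nonneg) auto
  have "weighted_zero_sum \<sigma> T = (\<Sum>\<rho>\<in>?Z T. of_int (zorder F \<rho>) * (Re \<rho> - \<sigma>) * trapezoid T (Im \<rho>))"
    unfolding weighted_zero_sum_def by (intro sum.cong refl) (auto simp: trapezoid_def)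
  also have "\<dots> \<le> (\<Sum>\<rho>\<in>?Z (T + 1). of_int (zorder F \<rho>) * (Re \<rho> - \<sigma>) * trapezoid T (Im \<rho>))"
    using nn trapezoid_bounds by (intro sum_mono2 finite_zero_rectangle \<sigma>) (auto intro!: mult_nonneg_nonneg)
  finally show "weighted_zero_sum \<sigma> T \<le> smoothed_zero_sum \<sigma> T" unfolding smoothed_zero_sum_def .
  show "smoothed_zero_sum \<sigma> T \<le> weighted_zero_sum \<sigma> (T + 1)"
    unfolding weighted_zero_sum_def smoothed_zero_sum_def
    by (intro sum_mono mult_left_le nn trapezoid_bounds)
qed

lemma ln_over_T_tendsto_0: "((\<lambda>T::real. C * ln (4 + T) / T) \<longlongrightarrow> 0) at_top"
proof -
  have a: "((\<lambda>T::real. ln (4 + T) / (4 + T)) \<longlongrightarrow> 0) at_top"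
  proof (rule filterlim_compose[where f="\<lambda>T. 4 + T" and g="\<lambda>x. ln x / x"])
    show "((\<lambda>x::real. ln x / x) \<longlongrightarrow> 0) at_top" by (rule ln_x_over_x_tendsto_0)
    show "filterlim (\<lambda>T::real. 4 + T) at_top at_top"
      by (rule filterlim_tendsto_add_at_top[OF tendsto_const filterlim_ident])
  qed
  have "((\<lambda>T::real. 4 / T) \<longlongrightarrow> 0) at_top"
    by (rule tendsto_divide_at_top)
  then have b: "((\<lambda>T::real. 4 / T + 1) \<longlongrightarrow> 0 + 1) at_top" by (intro tendsto_add tendsto_const)
  have "((\<lambda>T. C * (ln (4 + T) / (4 + T) * (4 / T + 1))) \<longlongrightarrow> C * (0 * (0 + 1))) at_top"
    by (intro tendsto_mult tendsto_const a b)
  moreover have "eventually (\<lambda>T::real. C * (ln (4 + T) / (4 + T) * (4 / T + 1)) = C * ln (4 + T) / T) at_top"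
    using eventually_gt_at_top[of 0]
  proof eventually_elim
    case (elim T)
    have "4 / T + 1 = (4 + T) / T" using elim by (simp add: add_divide_distrib)
    moreover have "4 + T \<noteq> 0" using elim by simp
    ultimately show ?case by simp
  qed
  ultimately show ?thesis using Lim_transform_eventually by fastforce
qed

text \<open>By \<open>zero_sum_sandwich\<close> the sharp count up to \<open>T\<close> lies between the smoothed counts for \<open>T - 1\<close> and \<open>T\<close>; the
  difference in height and the logarithmic error disappear after division by \<open>T\<close>.\<close>

lemma weighted_zero_sum_limit:
  assumes \<sigma>: "\<sigma> > 0" and L: "((\<lambda>T. log_line_integral \<sigma> T / (2 * T)) \<longlongrightarrow> L) at_top"
  shows "((\<lambda>T. pi / T * weighted_zero_sum \<sigma> T) \<longlongrightarrow> L) at_top"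
proof -
  obtain C where C: "\<And>T. T \<ge> 1 \<Longrightarrow>
     \<bar>2 * pi * smoothed_zero_sum \<sigma> T
       - log_line_integral \<sigma> T\<bar> \<le> C * ln (4 + T)"
    using smoothed_zero_sum_log_integral[OF \<sigma>] by blast
  define I where "I = log_line_integral \<sigma>"
  have up: "2 * pi * weighted_zero_sum \<sigma> T \<le> I T + C * ln (4 + T)" if "T \<ge> 1" for T
  proof -
    have "2 * pi * weighted_zero_sum \<sigma> T \<le> 2 * pi * smoothed_zero_sum \<sigma> T"
      by (intro mult_left_mono zero_sum_sandwich(1) \<sigma>) auto
    then show ?thesis using C[OF that] unfolding I_def by linarith
  qed
  have low: "I (T - 1) - C * ln (4 + (T - 1)) \<le> 2 * pi * weighted_zero_sum \<sigma> T" if "T \<ge> 2" for T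
  proof -
    have "2 * pi * smoothed_zero_sum \<sigma> (T - 1) \<le> 2 * pi * weighted_zero_sum \<sigma> ((T - 1) + 1)"
      by (intro mult_left_mono zero_sum_sandwich(2) \<sigma>) auto
    moreover have "T - 1 \<ge> 1" using that by simp
    note C[OF this]
    ultimately show ?thesis unfolding I_def diff_add_cancel by linarith
  qed
  have sh: "filterlim (\<lambda>T::real. T - 1) at_top at_top"
    using filterlim_tendsto_add_at_top[OF tendsto_const filterlim_ident, of "-1::real"] by simp
  show ?thesis
  proof (rule tendsto_sandwich)
    show "eventually (\<lambda>T. (I (T - 1) / (2 * (T - 1)) - C / 2 * ln (4 + (T - 1)) / (T - 1)) * (1 - 1 / T) \<le> pi / T * weighted_zero_sum \<sigma> T) at_top"
      using eventually_ge_at_top[of 2]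
    proof eventually_elim
      case (elim T)
      have "(I (T - 1) / (2 * (T - 1)) - C / 2 * ln (4 + (T - 1)) / (T - 1)) * (1 - 1 / T) = (I (T - 1) - C * ln (4 + (T - 1))) / (2 * T)"
      proof -
        have "1 - 1 / T = (T - 1) / T" using elim by (simp add: field_simps)
        moreover have "I (T - 1) / (2 * (T - 1)) - C / 2 * ln (4 + (T - 1)) / (T - 1) = (I (T - 1) - C * ln (4 + (T - 1))) / (2 * (T - 1))"
          by (simp add: diff_divide_distrib)
        moreover have "n / (2 * d) * (d / T) = n / (2 * T)" if "d > 0" for n d :: real using that by simp
        moreover have "T - 1 > 0" using elim by simp
        ultimately show ?thesis by (simp only:)
      qed
      also have "\<dots> \<le> (2 * pi * weighted_zero_sum \<sigma> T) / (2 * T)" using low[OF elim] elim by (intro divide_right_mono) auto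
      also have "\<dots> = pi / T * weighted_zero_sum \<sigma> T" using elim by simp
      finally show ?case .
    qed
    show "eventually (\<lambda>T. pi / T * weighted_zero_sum \<sigma> T \<le> I T / (2 * T) + C / 2 * ln (4 + T) / T) at_top"
      using eventually_ge_at_top[of 1]
    proof eventually_elim
      case (elim T)
      have "pi / T * weighted_zero_sum \<sigma> T = (2 * pi * weighted_zero_sum \<sigma> T) / (2 * T)" using elim by simp
      also have "\<dots> \<le> (I T + C * ln (4 + T)) / (2 * T)" using up[OF elim] elim by (intro divide_right_mono) auto
      also have "\<dots> = I T / (2 * T) + C / 2 * ln (4 + T) / T" by (simp add: add_divide_distrib)
      finally show ?case .
    qed
    show "((\<lambda>T. I T / (2 * T) + C / 2 * ln (4 + T) / T) \<longlongrightarrow> L) at_top"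
      using tendsto_add[OF L ln_over_T_tendsto_0[of "C / 2"]] by (simp add: I_def)
    have 1: "((\<lambda>T. I (T - 1) / (2 * (T - 1))) \<longlongrightarrow> L) at_top"
      using filterlim_compose[OF L sh] by (simp add: I_def)
    have 2: "((\<lambda>T. C / 2 * ln (4 + (T - 1)) / (T - 1)) \<longlongrightarrow> 0) at_top"
      by (rule filterlim_compose[OF ln_over_T_tendsto_0[of "C / 2"] sh])
    have 3: "((\<lambda>T::real. 1 / T) \<longlongrightarrow> 0) at_top"
      by (rule tendsto_divide_at_top)
    show "((\<lambda>T. (I (T - 1) / (2 * (T - 1)) - C / 2 * ln (4 + (T - 1)) / (T - 1)) * (1 - 1 / T)) \<longlongrightarrow> L) at_top"
      using tendsto_mult[OF tendsto_diff[OF 1 2] tendsto_diff[OF tendsto_const[of 1] 3]] by simp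
  qed
qed

text \<open>Each zero to the right of \<open>\<kappa>\<close> contributes slope at most its multiplicity, and it has distance at least
  \<open>\<kappa>/2\<close> from the line \<open>Re s = \<kappa>/2\<close>.\<close>

lemma weighted_zero_sum_lipschitz:
  assumes \<kappa>: "\<kappa> > 0" and x: "\<kappa> \<le> x" and y: "\<kappa> \<le> y"
  shows "\<bar>weighted_zero_sum x T - weighted_zero_sum y T\<bar> \<le> 2 / \<kappa> * weighted_zero_sum (\<kappa> / 2) T * \<bar>x - y\<bar>"
proof -
  define Z where "Z = {s. \<kappa> / 2 < Re s \<and> \<bar>Im s\<bar> < T \<and> F s = 0}"
  define m where "m = (\<lambda>\<rho>. real_of_int (zorder F \<rho>))"
  have fin: "finite Z" unfolding Z_def using \<kappa> by (intro finite_zero_rectangle) auto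
  have m: "m \<rho> \<ge> 0" if "\<rho> \<in> Z" for \<rho>
    using zorder_zero_pos[of \<rho>] that \<kappa> by (auto simp: Z_def m_def)
  have pos: "weighted_zero_sum \<sigma> T = (\<Sum>\<rho>\<in>Z. m \<rho> * max 0 (Re \<rho> - \<sigma>))" if "\<kappa> / 2 \<le> \<sigma>" for \<sigma>
  proof -
    have "(\<Sum>\<rho>\<in>Z. m \<rho> * max 0 (Re \<rho> - \<sigma>)) = (\<Sum>\<rho>\<in>{s. \<sigma> < Re s \<and> \<bar>Im s\<bar> < T \<and> F s = 0}. m \<rho> * max 0 (Re \<rho> - \<sigma>))"
      by (rule sum.mono_neutral_right[OF fin]) (use that in \<open>auto simp: Z_def\<close>)
    also have "\<dots> = weighted_zero_sum \<sigma> T"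
      unfolding weighted_zero_sum_def m_def by (intro sum.cong refl) auto
    finally show ?thesis by simp
  qed
  have "weighted_zero_sum x T - weighted_zero_sum y T = (\<Sum>\<rho>\<in>Z. m \<rho> * (max 0 (Re \<rho> - x) - max 0 (Re \<rho> - y)))"
    using x y \<kappa> by (simp add: pos sum_subtractf right_diff_distrib)
  also have "\<bar>\<dots>\<bar> \<le> (\<Sum>\<rho>\<in>Z. 2 / \<kappa> * (m \<rho> * max 0 (Re \<rho> - \<kappa> / 2)) * \<bar>x - y\<bar>)"
  proof (rule order_trans[OF sum_abs sum_mono])
    fix \<rho> assume \<rho>: "\<rho> \<in> Z"
    have r: "\<bar>max 0 (Re \<rho> - x) - max 0 (Re \<rho> - y)\<bar> \<le> (2 / \<kappa> * max 0 (Re \<rho> - \<kappa> / 2)) * \<bar>x - y\<bar>"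
    proof (cases "Re \<rho> \<le> \<kappa>")
      case True
      then have "max 0 (Re \<rho> - x) = 0" "max 0 (Re \<rho> - y) = 0" using x y by auto
      then show ?thesis using \<kappa> by simp
    next
      case False
      have "\<bar>max 0 (Re \<rho> - x) - max 0 (Re \<rho> - y)\<bar> \<le> 1 * \<bar>x - y\<bar>" by (auto simp: max_def abs_if)
      also have "\<dots> \<le> (2 / \<kappa> * max 0 (Re \<rho> - \<kappa> / 2)) * \<bar>x - y\<bar>"
      proof (intro mult_right_mono)
        have "1 = 2 / \<kappa> * (\<kappa> / 2)" using \<kappa> by simp
        also have "\<dots> \<le> 2 / \<kappa> * max 0 (Re \<rho> - \<kappa> / 2)" using \<kappa> False by (intro mult_left_mono) (auto simp: max_def)
        finally show "1 \<le> 2 / \<kappa> * max 0 (Re \<rho> - \<kappa> / 2)" .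
      qed auto
      finally show ?thesis .
    qed
    have "\<bar>m \<rho> * (max 0 (Re \<rho> - x) - max 0 (Re \<rho> - y))\<bar> = m \<rho> * \<bar>max 0 (Re \<rho> - x) - max 0 (Re \<rho> - y)\<bar>"
      using m[OF \<rho>] by (simp add: abs_mult)
    also have "\<dots> \<le> m \<rho> * ((2 / \<kappa> * max 0 (Re \<rho> - \<kappa> / 2)) * \<bar>x - y\<bar>)" by (intro mult_left_mono r m \<rho>)
    finally show "\<bar>m \<rho> * (max 0 (Re \<rho> - x) - max 0 (Re \<rho> - y))\<bar> \<le> 2 / \<kappa> * (m \<rho> * max 0 (Re \<rho> - \<kappa> / 2)) * \<bar>x - y\<bar>"
      by (simp only: mult_ac)
  qed
  also have "\<dots> = 2 / \<kappa> * weighted_zero_sum (\<kappa> / 2) T * \<bar>x - y\<bar>"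
    by (simp only: pos[OF order_refl] sum_distrib_left sum_distrib_right)
  finally show ?thesis .
qed

lemma weighted_zero_sum_right: "\<sigma> \<ge> X \<Longrightarrow> weighted_zero_sum \<sigma> T = 0"
  unfolding weighted_zero_sum_def using nonzero_right
  by (intro sum.neutral) force

lemma zero_sum_uniform_limit:
  assumes \<kappa>: "\<kappa> > 0" and L: "\<And>\<sigma>. \<sigma> > 0 \<Longrightarrow> ((\<lambda>T. log_line_integral \<sigma> T / (2 * T)) \<longlongrightarrow> L \<sigma>) at_top"
  shows "uniform_limit {\<kappa><..} (\<lambda>T \<sigma>. pi / T * weighted_zero_sum \<sigma> T) L at_top"
proof -
  have lim: "((\<lambda>T. pi / T * weighted_zero_sum \<sigma> T) \<longlongrightarrow> L \<sigma>) at_top" if "\<sigma> > 0" for \<sigma>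
    by (rule weighted_zero_sum_limit[OF that L[OF that]])
  have L0: "L \<sigma> = 0" if "\<sigma> \<ge> X" for \<sigma>
  proof -
    have "((\<lambda>T. pi / T * weighted_zero_sum \<sigma> T) \<longlongrightarrow> 0) at_top" using that by (simp add: weighted_zero_sum_right)
    moreover have "\<sigma> > 0" using that X by simp
    ultimately show ?thesis using tendsto_unique[OF trivial_limit_at_top_linorder lim] by blast
  qed
  define \<Lambda> where "\<Lambda> = 2 / \<kappa> * (\<bar>L (\<kappa> / 2)\<bar> + 1)"
  have \<Lambda>: "\<Lambda> \<ge> 0" using \<kappa> by (simp add: \<Lambda>_def)
  have uni: "uniform_limit {\<kappa>..X} (\<lambda>T \<sigma>. pi / T * weighted_zero_sum \<sigma> T) L at_top"
  proof (rule uniform_limit_of_lipschitz[OF \<Lambda>])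
    have "eventually (\<lambda>T. dist (pi / T * weighted_zero_sum (\<kappa> / 2) T) (L (\<kappa> / 2)) < 1) at_top"
      using \<kappa> by (intro tendstoD lim) auto
    then show "eventually (\<lambda>T. \<forall>x\<in>{\<kappa>..X}. \<forall>y\<in>{\<kappa>..X}. \<bar>pi / T * weighted_zero_sum x T - pi / T * weighted_zero_sum y T\<bar> \<le> \<Lambda> * \<bar>x - y\<bar>) at_top"
      using eventually_gt_at_top[of 0]
    proof eventually_elim
      case (elim T)
      show ?case
      proof (intro ballI)
        fix x y assume xy: "x \<in> {\<kappa>..X}" "y \<in> {\<kappa>..X}"
        have "\<bar>pi / T * weighted_zero_sum x T - pi / T * weighted_zero_sum y T\<bar> = pi / T * \<bar>weighted_zero_sum x T - weighted_zero_sum y T\<bar>"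
          unfolding right_diff_distrib[symmetric] abs_mult using elim by simp
        also have "\<dots> \<le> pi / T * (2 / \<kappa> * weighted_zero_sum (\<kappa> / 2) T * \<bar>x - y\<bar>)"
          using xy elim \<kappa> by (intro mult_left_mono weighted_zero_sum_lipschitz) auto
        also have "\<dots> = (2 / \<kappa> * (pi / T * weighted_zero_sum (\<kappa> / 2) T)) * \<bar>x - y\<bar>" by (simp only: mult_ac)
        also have "\<dots> \<le> \<Lambda> * \<bar>x - y\<bar>"
          unfolding \<Lambda>_def using elim \<kappa> by (intro mult_right_mono mult_left_mono) (auto simp: dist_real_def)
        finally show "\<bar>pi / T * weighted_zero_sum x T - pi / T * weighted_zero_sum y T\<bar> \<le> \<Lambda> * \<bar>x - y\<bar>" .
      qed
    qed
    show "((\<lambda>T. pi / T * weighted_zero_sum x T) \<longlongrightarrow> L x) at_top" if "x \<in> {\<kappa>..X}" for x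
      using that \<kappa> by (intro lim) auto
  qed
  show ?thesis
  proof (rule uniform_limitI)
    fix e :: real assume e: "e > 0"
    show "eventually (\<lambda>T. \<forall>x\<in>{\<kappa><..}. dist (pi / T * weighted_zero_sum x T) (L x) < e) at_top"
      using uniform_limitD[OF uni e]
    proof eventually_elim
      case (elim T)
      show ?case
      proof
        fix x assume "x \<in> {\<kappa><..}"
        then show "dist (pi / T * weighted_zero_sum x T) (L x) < e"
          using elim e by (cases "x \<le> X") (auto simp: L0 weighted_zero_sum_right)
      qed
    qed
  qed
qed

end

section \<open>Continued Dirichlet series\<close>

lemma exp_minus_le_inverse_cube:
  fixes x :: real
  assumes "x > 0"
  shows "exp (- x) \<le> 27 / x ^ 3"
proof -
  have "(x / 3) ^ 3 \<le> exp (x / 3) ^ 3"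
  proof (rule power_mono)
    have "x / 3 \<le> 1 + x / 3" by simp
    also have "\<dots> \<le> exp (x / 3)" by (rule exp_ge_add_one_self)
    finally show "x / 3 \<le> exp (x / 3)" .
  qed (use assms in simp)
  also have "\<dots> = exp x" by (simp add: exp_of_nat_mult[symmetric])
  finally have "x ^ 3 / 27 \<le> exp x" by (simp add: power_divide)
  then have "inverse (exp x) \<le> inverse (x ^ 3 / 27)"
    using assms by (intro le_imp_inverse_le) auto
  then show ?thesis by (simp add: exp_minus)
qed

lemma dirichlet_term_exp: "dirichlet_term a s n = a (Suc n) * exp (- s * ln (real (Suc n)))"
proof -
  have "Ln (of_nat (Suc n)) = of_real (ln (real (Suc n)))" by (rule Ln_of_nat) simp
  moreover have "of_nat (Suc n) \<noteq> (0::complex)" by (rule of_nat_neq_0)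
  ultimately show ?thesis unfolding dirichlet_term_def powr_def by (simp only: if_False)
qed

lemma norm_dirichlet_term: "norm (dirichlet_term a s n) = norm (a (Suc n)) * real (Suc n) powr (- Re s)"
proof -
  have "Re (- s * ln (real (Suc n))) = - Re s * ln (real (Suc n))" by simp
  then show ?thesis unfolding dirichlet_term_exp norm_mult norm_exp_eq_Re powr_def by simp
qed

text \<open>Convergence at one point \<open>s\<^sub>0\<close> gives \<open>a\<^sub>n = O(n\<^sup>\<alpha>)\<close> with \<open>\<alpha> = Re s\<^sub>0\<close>. For \<open>Re s \<ge> \<alpha> + 2\<close> the terms are dominated by
  \<open>n\<^sup>-\<^sup>2\<close>, and for \<open>n \<ge> 2\<close> there is an additional factor \<open>2 powr (\<alpha> + 2 - Re s)\<close>.\<close>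

lemma dirichlet_far_right:
  assumes conv: "somewhere_convergent a" and cont: "continues_dirichlet a f"
  shows "\<exists>\<beta> M A. \<beta> > 0 \<and> A \<ge> 0 \<and> summable M \<and>
     (\<forall>s n. Re s \<ge> \<beta> \<longrightarrow> norm (dirichlet_term a s n) \<le> M n) \<and>
     (\<forall>s. Re s \<ge> \<beta> \<longrightarrow> f s = (\<Sum>n. dirichlet_term a s n) \<and> norm (f s - a 1) \<le> A / Re s ^ 3)"
proof -
  obtain s0 where s0: "summable (dirichlet_term a s0)"
    using conv by (auto simp: somewhere_convergent_def dirichlet_converges_def)
  define \<alpha> where "\<alpha> = Re s0"
  have "Bseq (dirichlet_term a s0)"
    using summable_LIMSEQ_zero[OF s0] convergent_imp_Bseq convergentI by blast
  then obtain K where K: "K > 0" "\<And>n. norm (dirichlet_term a s0 n) \<le> K" by (auto simp: Bseq_def)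
  have aK: "norm (a (Suc n)) \<le> K * real (Suc n) powr \<alpha>" for n
  proof -
    have "norm (a (Suc n)) = norm (dirichlet_term a s0 n) * real (Suc n) powr \<alpha>"
      unfolding norm_dirichlet_term \<alpha>_def by (simp add: mult.assoc powr_add[symmetric])
    also have "\<dots> \<le> K * real (Suc n) powr \<alpha>" using K by (intro mult_right_mono) auto
    finally show ?thesis .
  qed
  define \<beta> where "\<beta> = max 1 (\<alpha> + 2)"
  have \<beta>: "\<beta> \<ge> 1" "\<beta> \<ge> \<alpha> + 2" by (auto simp: \<beta>_def)
  define M where "M = (\<lambda>n. K * (1 / real (Suc n) ^ 2))"
  have "summable (\<lambda>n. 1 / real n ^ 2)" by (rule inverse_power_summable[of 2, where 'a=real, unfolded inverse_eq_divide]) simp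
  then have sM0: "summable (\<lambda>n. 1 / real (Suc n) ^ 2)" by (subst summable_Suc_iff)
  then have sM: "summable M" unfolding M_def by (rule summable_mult)
  have coeff: "norm (dirichlet_term a s n) \<le> K * real (Suc n) powr (\<alpha> + 2 - Re s) * (1 / real (Suc n) ^ 2)" for s n
  proof -
    have "norm (dirichlet_term a s n) \<le> (K * real (Suc n) powr \<alpha>) * real (Suc n) powr (- Re s)"
      unfolding norm_dirichlet_term by (intro mult_right_mono aK) auto
    also have "\<dots> = K * (real (Suc n) powr (\<alpha> + 2 - Re s) * real (Suc n) powr (- 2))"
      by (simp only: mult.assoc powr_add[symmetric]) simp
    also have "real (Suc n) powr (- 2) = 1 / real (Suc n) ^ 2" by (simp add: powr_minus inverse_eq_divide)
    finally show ?thesis by (simp only: mult.assoc)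
  qed
  have termM: "norm (dirichlet_term a s n) \<le> M n" if "Re s \<ge> \<beta>" for s n
  proof -
    have "real (Suc n) powr (\<alpha> + 2 - Re s) \<le> real (Suc n) powr 0"
      using that \<beta> by (intro powr_mono) auto
    then have "K * real (Suc n) powr (\<alpha> + 2 - Re s) * (1 / real (Suc n) ^ 2) \<le> K * 1 * (1 / real (Suc n) ^ 2)"
      using K by (intro mult_right_mono mult_left_mono) auto
    with coeff[of s n] show ?thesis by (simp add: M_def)
  qed
  have fs: "f s = (\<Sum>n. dirichlet_term a s n)" if s: "Re s \<ge> \<beta>" for s
  proof -
    have "conv_abscissa a \<le> ereal \<alpha>" unfolding conv_abscissa_def \<alpha>_def
      using s0 by (intro INF_lower) (auto simp: dirichlet_converges_def)
    also have "ereal \<alpha> < ereal (Re s)" using s \<beta> by simp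
    finally show ?thesis using cont s \<beta>
      by (auto simp: continues_dirichlet_def half_plane_def dirichlet_sum_def)
  qed
  define S where "S = (\<Sum>n. 1 / real (Suc (Suc n)) ^ 2)"
  have sS: "summable (\<lambda>n. 1 / real (Suc (Suc n)) ^ 2)" using sM0 by (subst summable_Suc_iff)
  have S: "S \<ge> 0" unfolding S_def by (intro suminf_nonneg sS) auto
  define A where "A = K * S * 2 powr (\<alpha> + 2) * (27 / ln 2 ^ 3)"
  have A: "A \<ge> 0" using K S by (simp add: A_def)
  have decay: "norm (f s - a 1) \<le> A / Re s ^ 3" if s: "Re s \<ge> \<beta>" for s
  proof -
    have sumd: "summable (dirichlet_term a s)"
      by (rule summable_comparison_test'[OF sM, of 0]) (use termM[OF s] in auto)
    have "dirichlet_term a s 0 = a 1" by (simp add: dirichlet_term_exp)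
    then have "f s - a 1 = (\<Sum>n. dirichlet_term a s (Suc n))"
      using suminf_split_head[OF sumd] fs[OF s] by simp
    also have "norm \<dots> \<le> (\<Sum>n. K * 2 powr (\<alpha> + 2 - Re s) * (1 / real (Suc (Suc n)) ^ 2))"
    proof (rule norm_suminf_le)
      fix n
      have "norm (dirichlet_term a s (Suc n)) \<le> K * real (Suc (Suc n)) powr (\<alpha> + 2 - Re s) * (1 / real (Suc (Suc n)) ^ 2)"
        by (rule coeff)
      also have "\<dots> \<le> K * 2 powr (\<alpha> + 2 - Re s) * (1 / real (Suc (Suc n)) ^ 2)"
        using K s \<beta> by (intro mult_right_mono mult_left_mono powr_mono2') auto
      finally show "norm (dirichlet_term a s (Suc n)) \<le> K * 2 powr (\<alpha> + 2 - Re s) * (1 / real (Suc (Suc n)) ^ 2)" .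
    qed (intro summable_mult sS)
    also have "\<dots> = K * 2 powr (\<alpha> + 2 - Re s) * S" unfolding S_def by (rule suminf_mult[OF sS])
    also have "\<dots> = K * S * 2 powr (\<alpha> + 2) * exp (- (Re s * ln 2))"
    proof -
      have "2 powr (\<alpha> + 2 - Re s) = 2 powr (\<alpha> + 2) * exp (- (Re s * ln 2))"
        by (simp add: powr_def exp_add[symmetric] algebra_simps)
      then show ?thesis by (simp only: mult_ac)
    qed
    also have "\<dots> \<le> K * S * 2 powr (\<alpha> + 2) * (27 / (Re s * ln 2) ^ 3)"
      using K S s \<beta> by (intro mult_left_mono exp_minus_le_inverse_cube) auto
    also have "\<dots> = A / Re s ^ 3" by (simp add: A_def power_mult_distrib)
    finally show ?thesis .
  qed
  show ?thesis
    using \<beta>(1) A sM termM fs decay by (intro exI[of _ \<beta>] exI[of _ M] exI[of _ A]) auto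
qed

text \<open>Compare \<open>\<bar>f\<bar>\<close> with \<open>1 + \<bar>f\<bar>\<^sup>p\<close>.\<close>

lemma mean_modulus_bound:
  assumes p: "1 \<le> p" and hol: "f holomorphic_on half_plane 0"
    and sup: "(SUP \<sigma>\<in>{0<..}. SUP T\<in>{1..}. ereal (mean_pow p f \<sigma> T)) < \<infinity>"
  shows "\<exists>B. \<forall>\<sigma>>0. \<forall>T\<ge>1. integral {-T..T} (\<lambda>t. norm (f (Complex \<sigma> t))) \<le> B * T"
proof -
  define S where "S = (SUP \<sigma>\<in>{0<..}. SUP T\<in>{1..}. ereal (mean_pow p f \<sigma> T))"
  have "S \<noteq> \<infinity>" using sup by (simp add: S_def)
  then obtain n :: nat where n: "S < ereal (real n)"
    unfolding less_PInf_Ex_of_nat by blast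
  have mp: "mean_pow p f \<sigma> T \<le> real n" if "\<sigma> > 0" "T \<ge> 1" for \<sigma> T
  proof -
    have "ereal (mean_pow p f \<sigma> T) \<le> (SUP T\<in>{1..}. ereal (mean_pow p f \<sigma> T))"
      using that by (intro SUP_upper) auto
    also have "\<dots> \<le> S"
      unfolding S_def using that by (intro SUP_upper) auto
    also note n
    finally show ?thesis by simp
  qed
  have "integral {-T..T} (\<lambda>t. norm (f (Complex \<sigma> t))) \<le> (2 * real n + 2) * T" if \<sigma>: "\<sigma> > 0" and T: "T \<ge> 1" for \<sigma> T
  proof -
    have "continuous_on {s. Re s > 0} f"
      using hol holomorphic_on_imp_continuous_on by (auto simp: half_plane_def)
    then have cf: "continuous_on {-T..T} (\<lambda>t. f (Complex \<sigma> t))"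
      by (rule continuous_on_compose2) (use \<sigma> in \<open>auto intro!: continuous_intros\<close>)
    have cp: "continuous_on {-T..T} (\<lambda>t. norm (f (Complex \<sigma> t)) powr p)"
      using p by (intro continuous_on_powr' continuous_intros cf) auto
    have ip: "(\<lambda>t. norm (f (Complex \<sigma> t)) powr p) integrable_on {-T..T}"
      by (rule integrable_continuous_interval[OF cp])
    have "(LBINT t:{-T..T}. norm (f (Complex \<sigma> t)) powr p) = integral {-T..T} (\<lambda>t. norm (f (Complex \<sigma> t)) powr p)"
      by (rule set_borel_integral_eq_integral(2)[OF borel_integrable_atLeastAtMost'[OF cp]])
    then have "integral {-T..T} (\<lambda>t. norm (f (Complex \<sigma> t)) powr p) = 2 * T * mean_pow p f \<sigma> T"
      using T by (simp add: mean_pow_def)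
    also have "\<dots> \<le> 2 * T * real n" using T by (intro mult_left_mono mp[OF \<sigma> T]) auto
    finally have I: "integral {-T..T} (\<lambda>t. norm (f (Complex \<sigma> t)) powr p) \<le> 2 * T * real n" .
    have "integral {-T..T} (\<lambda>t. norm (f (Complex \<sigma> t))) \<le> integral {-T..T} (\<lambda>t. 1 + norm (f (Complex \<sigma> t)) powr p)"
    proof (intro integral_le integrable_add integrable_const_ivl ip integrable_continuous_interval continuous_on_norm cf)
      fix t
      show "norm (f (Complex \<sigma> t)) \<le> 1 + norm (f (Complex \<sigma> t)) powr p"
      proof (cases "norm (f (Complex \<sigma> t)) \<le> 1")
        case True
        moreover have "0 \<le> norm (f (Complex \<sigma> t)) powr p" by simp
        ultimately show ?thesis by linarith
      next
        case False
        then have "norm (f (Complex \<sigma> t)) powr 1 \<le> norm (f (Complex \<sigma> t)) powr p" using p by (intro powr_mono) auto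
        then show ?thesis using False by simp
      qed
    qed
    also have "\<dots> = 2 * T + integral {-T..T} (\<lambda>t. norm (f (Complex \<sigma> t)) powr p)"
      using T by (subst integral_add[OF integrable_const_ivl ip]) simp
    also have "\<dots> \<le> (2 * real n + 2) * T" using I by (simp add: algebra_simps)
    finally show ?thesis .
  qed
  then show ?thesis by blast
qed

lemma normalised_dirichlet_function_exists:
  fixes a :: "nat \<Rightarrow> complex" and f :: "complex \<Rightarrow> complex"
  assumes "1 \<le> p" and conv: "somewhere_convergent a" and a1: "a 1 \<noteq> 0" and cont: "continues_dirichlet a f"
    and "(SUP \<sigma>\<in>{0<..}. SUP T\<in>{1..}. ereal (mean_pow p f \<sigma> T)) < \<infinity>"
  shows "\<exists>B A X b. normalised_dirichlet_function (\<lambda>s. f s / a 1) B A X b"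
proof -
  have hol: "f holomorphic_on half_plane 0" using cont by (simp add: continues_dirichlet_def)
  obtain B where B: "\<And>\<sigma> T. \<sigma> > 0 \<Longrightarrow> T \<ge> 1 \<Longrightarrow> integral {-T..T} (\<lambda>t. norm (f (Complex \<sigma> t))) \<le> B * T"
    using mean_modulus_bound[OF assms(1) hol assms(5)] by blast
  obtain \<beta> M A where \<beta>: "\<beta> > 0" and A: "A \<ge> 0" and M: "summable M"
    and termM: "\<And>s n. Re s \<ge> \<beta> \<Longrightarrow> norm (dirichlet_term a s n) \<le> M n"
    and fs: "\<And>s. Re s \<ge> \<beta> \<Longrightarrow> f s = (\<Sum>n. dirichlet_term a s n)"
    and decay: "\<And>s. Re s \<ge> \<beta> \<Longrightarrow> norm (f s - a 1) \<le> A / Re s ^ 3"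
    using dirichlet_far_right[OF conv cont] by blast
  define A' where "A' = A / norm (a 1)"
  have A': "A' \<ge> 0" using A by (simp add: A'_def)
  define X where "X = max 1 (max \<beta> (2 * A'))"
  have X: "X \<ge> 1" "X \<ge> \<beta>" "X \<ge> 2 * A'" by (auto simp: X_def)
  have decay': "norm (f s / a 1 - 1) \<le> A' / Re s ^ 3" if "Re s \<ge> X" for s
  proof -
    have "f s / a 1 - 1 = (f s - a 1) / a 1" using a1 by (simp add: diff_divide_distrib)
    then have "norm (f s / a 1 - 1) = norm (f s - a 1) / norm (a 1)" by (simp add: norm_divide)
    also have "\<dots> \<le> (A / Re s ^ 3) / norm (a 1)" using that X by (intro divide_right_mono decay) auto
    finally show ?thesis by (simp add: A'_def mult.commute)
  qed
  have "normalised_dirichlet_function (\<lambda>s. f s / a 1) (B / norm (a 1)) A' X (\<lambda>n. a (Suc n) / a 1)"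
  proof
    show "(\<lambda>s. f s / a 1) holomorphic_on {s. 0 < Re s}"
      using hol a1 unfolding half_plane_def by (intro holomorphic_intros) auto
    show "integral {-T..T} (\<lambda>t. norm (f (Complex \<sigma> t) / a 1)) \<le> B / norm (a 1) * T"
      if "0 < \<sigma>" "1 \<le> T" for \<sigma> T
      using divide_right_mono[OF B[OF that], of "norm (a 1)"] by (simp add: norm_divide)
    show "norm (f s / a 1 - 1) \<le> A' / Re s ^ 3" if "Re s \<ge> X" for s by (rule decay'[OF that])
    show "norm (f s / a 1 - 1) \<le> 1 / 2" if s: "Re s \<ge> X" for s
    proof -
      have "2 * A' \<le> Re s ^ 1" using s X by simp
      also have "\<dots> \<le> Re s ^ 3" using s X by (intro power_increasing) auto
      finally have "A' / Re s ^ 3 \<le> 1 / 2" using s X by (simp add: divide_le_eq)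
      then show ?thesis using decay'[OF s] by linarith
    qed
    fix c assume c: "c \<ge> X"
    have "uniform_limit UNIV (\<lambda>N t. \<Sum>n<N. dirichlet_term a (Complex c t) n) (\<lambda>t. \<Sum>n. dirichlet_term a (Complex c t) n) sequentially"
      by (rule Weierstrass_m_test[OF _ M]) (use termM c X in auto)
    then have "uniform_limit UNIV (\<lambda>N t. (\<Sum>n<N. dirichlet_term a (Complex c t) n) / a 1) (\<lambda>t. (\<Sum>n. dirichlet_term a (Complex c t) n) / a 1) sequentially"
      by (rule bounded_linear.uniform_limit[OF bounded_linear_divide])
    moreover have "(\<Sum>n. dirichlet_term a (Complex c t) n) / a 1 = f (Complex c t) / a 1" for t
      using fs[of "Complex c t"] c X by simp
    moreover have "(\<Sum>n<N. dirichlet_term a (Complex c t) n) / a 1 = (\<Sum>n<N. a (Suc n) / a 1 * exp (- Complex c t * ln (real (Suc n))))" for N t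
      unfolding sum_divide_distrib dirichlet_term_exp by (intro sum.cong refl) simp
    ultimately show "uniform_limit UNIV (\<lambda>N t. \<Sum>n<N. a (Suc n) / a 1 * exp (- Complex c t * ln (real (Suc n)))) (\<lambda>t. f (Complex c t) / a 1) sequentially"
      by (simp only:)
  qed (rule X)
  then show ?thesis by blast
qed

theorem theorem6p1:
  fixes p :: real and a :: "nat \<Rightarrow> complex" and f :: "complex \<Rightarrow> complex"
  assumes "1 \<le> p"
    and "somewhere_convergent a"
    and "value_at_infinity a \<noteq> 0"
    and "continues_dirichlet a f"
    and "(SUP \<sigma>\<in>{0<..}. SUP T\<in>{1..}. ereal (mean_pow p f \<sigma> T)) < \<infinity>"
  shows "(\<forall>\<sigma>>0. (mean_log f \<sigma> \<longlongrightarrow> jessen f \<sigma>) at_top) \<and>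
    (\<forall>\<kappa>>0. uniform_limit {\<kappa><..}
        (\<lambda>T \<sigma>\<^sub>0. pi / T * zero_sum f \<sigma>\<^sub>0 T)
        (\<lambda>\<sigma>\<^sub>0. jessen f \<sigma>\<^sub>0 - ln (norm (value_at_infinity a)))
        at_top)"
proof -
  have a1: "a 1 \<noteq> 0" using assms(3) by (simp add: value_at_infinity_def)
  define F where "F = (\<lambda>s. f s / a 1)"
  obtain B A X b where "normalised_dirichlet_function F B A X b"
    using normalised_dirichlet_function_exists[OF assms(1,2) a1 assms(4,5)] unfolding F_def by blast
  then interpret normalised_dirichlet_function F B A X b .
  define l where "l = ln (norm (a 1))"
  have mean: "mean_log f \<sigma> T = log_line_integral \<sigma> T / (2 * T) + l" if \<sigma>: "\<sigma> > 0" and T: "T > 0" for \<sigma> T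
  proof -
    define u where "u = (\<lambda>t. ln (norm (F (Complex \<sigma> t))))"
    define v where "v = (\<lambda>t. ln (norm (f (Complex \<sigma> t))))"
    define Z where "Z = {t \<in> {-T..T}. F (Complex \<sigma> t) = 0}"
    have Z: "finite Z" unfolding Z_def by (rule finite_zeros_on_line[OF \<sigma>])
    have vu: "v t = u t + l" if "t \<in> {-T..T} - Z" for t
    proof -
      have "f (Complex \<sigma> t) \<noteq> 0" using that by (auto simp: Z_def F_def)
      then show ?thesis using a1 by (simp add: u_def v_def l_def F_def norm_divide ln_div)
    qed
    have ua: "u absolutely_integrable_on {-T..T}" unfolding u_def by (rule log_line_integrable[OF \<sigma>])
    then have ui: "u integrable_on {-T..T}" by (rule set_lebesgue_integral_eq_integral)
    have "(\<lambda>t. u t + l) absolutely_integrable_on {-T..T}"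
      by (intro set_integral_add ua) (auto intro!: absolutely_integrable_continuous_real)
    then have va: "v absolutely_integrable_on {-T..T}"
      by (rule absolutely_integrable_spike[OF _ negligible_finite[OF Z]]) (use vu in auto)
    have "f holomorphic_on {s. Re s > 0}" using assms(4) by (simp add: continues_dirichlet_def half_plane_def)
    then have "continuous_on {s. Re s > 0} f" by (rule holomorphic_on_imp_continuous_on)
    then have "continuous_on UNIV (\<lambda>t. f (Complex \<sigma> t))"
      by (rule continuous_on_compose2) (use \<sigma> in \<open>auto intro!: continuous_intros\<close>)
    then have "(\<lambda>t. f (Complex \<sigma> t)) \<in> borel_measurable borel" by (rule borel_measurable_continuous_onI)
    then have "v \<in> borel_measurable borel" unfolding v_def by measurable
    then have "(\<lambda>t. indicat_real {-T..T} t *\<^sub>R v t) \<in> borel_measurable lborel" by measurable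
    then have vs: "set_integrable lborel {-T..T} v"
      using va unfolding set_integrable_def by (simp only: integrable_completion)
    have "(LBINT t:{-T..T}. v t) = integral {-T..T} v"
      by (rule set_borel_integral_eq_integral(2)[OF vs])
    also have "\<dots> = integral {-T..T} (\<lambda>t. u t + l)"
      by (rule integral_spike[OF negligible_finite[OF Z]]) (use vu in auto)
    also have "\<dots> = log_line_integral \<sigma> T + 2 * T * l"
      using T by (subst integral_add[OF ui integrable_const_ivl]) (simp add: log_line_integral_def u_def)
    finally show ?thesis using T unfolding mean_log_def v_def by (simp add: add_divide_distrib)
  qed
  have ex: "\<exists>L. ((\<lambda>T. log_line_integral \<sigma> T / (2 * T)) \<longlongrightarrow> L) at_top" if "\<sigma> > 0" for \<sigma>
    using log_mean_exists[OF that] by (simp only: log_line_integral_def)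
  have lim: "(mean_log f \<sigma> \<longlongrightarrow> jessen f \<sigma>) at_top"
    and lim': "((\<lambda>T. log_line_integral \<sigma> T / (2 * T)) \<longlongrightarrow> jessen f \<sigma> - l) at_top" if \<sigma>: "\<sigma> > 0" for \<sigma>
  proof -
    obtain L where L: "((\<lambda>T. log_line_integral \<sigma> T / (2 * T)) \<longlongrightarrow> L) at_top" using ex[OF \<sigma>] by blast
    have "((\<lambda>T. log_line_integral \<sigma> T / (2 * T) + l) \<longlongrightarrow> L + l) at_top" by (intro tendsto_add L tendsto_const)
    moreover have "eventually (\<lambda>T. log_line_integral \<sigma> T / (2 * T) + l = mean_log f \<sigma> T) at_top"
      using eventually_gt_at_top[of 0] by eventually_elim (rule mean[OF \<sigma>, symmetric])
    ultimately have m: "(mean_log f \<sigma> \<longlongrightarrow> L + l) at_top" by (rule Lim_transform_eventually)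
    then have j: "jessen f \<sigma> = L + l" unfolding jessen_def by (intro tendsto_Lim) auto
    show "(mean_log f \<sigma> \<longlongrightarrow> jessen f \<sigma>) at_top" using m unfolding j .
    show "((\<lambda>T. log_line_integral \<sigma> T / (2 * T)) \<longlongrightarrow> jessen f \<sigma> - l) at_top" using L unfolding j by simp
  qed
  have zs: "zero_sum f \<sigma> T = weighted_zero_sum \<sigma> T" if \<sigma>: "\<sigma> > 0" for \<sigma> T
  proof -
    have "{s \<in> zero_set f. \<bar>Im s\<bar> < T \<and> Re s > \<sigma>} = {s. \<sigma> < Re s \<and> \<bar>Im s\<bar> < T \<and> F s = 0}"
      using \<sigma> a1 by (auto simp: zero_set_def half_plane_def F_def)
    moreover have "zorder F s = zorder f s" for s
    proof -
      have "F = (\<lambda>s. inverse (a 1) * f s)" by (simp add: F_def fun_eq_iff field_simps)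
      then show ?thesis using a1 by (simp add: zorder_cmult)
    qed
    ultimately show ?thesis unfolding zero_sum_def weighted_zero_sum_def by simp
  qed
  have "uniform_limit {\<kappa><..} (\<lambda>T \<sigma>\<^sub>0. pi / T * zero_sum f \<sigma>\<^sub>0 T)
        (\<lambda>\<sigma>\<^sub>0. jessen f \<sigma>\<^sub>0 - ln (norm (value_at_infinity a))) at_top" if \<kappa>: "\<kappa> > 0" for \<kappa>
  proof -
    have "uniform_limit {\<kappa><..} (\<lambda>T \<sigma>. pi / T * weighted_zero_sum \<sigma> T) (\<lambda>\<sigma>. jessen f \<sigma> - l) at_top"
      by (rule zero_sum_uniform_limit[OF \<kappa> lim'])
    also have "?this \<longleftrightarrow> ?thesis"
      by (rule uniform_limit_cong') (use \<kappa> zs in \<open>auto simp: l_def value_at_infinity_def\<close>)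
    finally show ?thesis .
  qed
  with lim show ?thesis by blast
qed

end
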